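(* Let $T\ge 1$, let $\lambda\ge 0$, and let $\mu=\mathcal N(a,A)$ and $\nu=\mathcal N(b,B)$ be non-degenerate Gaussian measures on $\mathbb R^{T}$ whose covariance matrices have Cholesky decompositions $A=LL^\top$ and $B=MM^\top$. Let $N=\operatorname{diag}\big((M^\top L)_{11},\dots,(M^\top L)_{TT}\big)$ and $P_\lambda=f_\lambda(N)$, with $f_\lambda$ applied element-wise. For any diagonal matrix $P\in\mathbb R^{T\times T}$ with $P_{tt}\in[-1,1]$ for all $t\le T$, define $$\pi_P:=\mathcal N\left(\begin{bmatrix}a\\ b\end{bmatrix},\begin{bmatrix}LL^\top & LPM^\top\\ MP^\top L^\top & MM^\top\end{bmatrix}\right).$$ Then: (i) If $\lambda>0$, let $P=P_\lambda$. Then $\pi^*=\pi_P$ is the unique optimizer of $\mathcal{AW}_{2,\lambda}(\mu,\nu)$. (ii) If $\lambda=0$, let $P$ (diagonal with entries in $[-1,1]$) satisfy $P_{tt}=(P_\lambda)_{tt}=\operatorname{sign}(N_{tt})$ for every $t\le T$ with $N_{tt}\ne0$. Then $\pi^*=\pi_P$ is an optimizer of $\mathcal{AW}_{2,\lambda}(\mu,\nu)$, and all Gaussian optimizers have such a representation. Moreover, $\pi^*$ is the unique optimizer if and only if $N$ is invertible.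
   Context: Elements of $\mathbb R^{T}$ are paths $x=(x_1,\dots,x_T)$ of real-valued processes with $T$ time steps; $|\cdot|$ is the Euclidean norm. Write $x_{1:t}=(x_1,\dots,x_t)$. For a probability measure $\mu$ on $\mathbb R^{T}$, $\mu_{x_{1:t}}$ denotes the regular conditional law under $\mu$ of $x_{t+1:T}$ given $x_{1:t}$; for a probability $\pi$ on $\mathbb R^{T}\times\mathbb R^{T}$, $\pi_{x_{1:t},y_{1:t}}$ denotes the regular conditional law of $(x_{t+1:T},y_{t+1:T})$ given $(x_{1:t},y_{1:t})$ (kernels being understood up to a.e. equality). $\mathrm{Cpl}(\mu,\nu)$ is the set of probability measures with first marginal $\mu$ and second marginal $\nu$. A coupling $\pi\in\mathrm{Cpl}(\mu,\nu)$ is bi-causal, written $\pi\in\mathrm{Cpl}_{\mathrm{bc}}(\mu,\nu)$, if for all $t=1,\dots,T-1$ and all $x_{1:t},y_{1:t}$ one has $\pi_{x_{1:t},y_{1:t}}\in\mathrm{Cpl}(\mu_{x_{1:t}},\nu_{y_{1:t}})$. The entropic adapted 2-Wasserstein distance is $$\mathcal{AW}_{2,\lambda}^2(\mu,\nu)=\inf_{\pi\in\mathrm{Cpl}_{\mathrm{bc}}(\mu,\nu)}\int|x-y|^2\,d\pi+\lambda\,\mathcal D_{\mathrm{KL}}(\pi\,|\,\mu\otimes\nu),$$ where $\mathcal D_{\mathrm{KL}}(\mu|\nu)=\int\log(d\mu/d\nu)\,d\mu$ if $\mu\ll\nu$ and $+\infty$ otherwise. For $\lambda=0$ the entropic term is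 absent. An optimizer of $\mathcal{AW}_{2,\lambda}(\mu,\nu)$ is a bi-causal coupling attaining the infimum. Gaussian measures such as $\pi_P$ may have singular covariance. In the Cholesky decompositions, $L$ and $M$ are lower triangular with positive diagonal entries. For $\lambda\ge0$, $f_\lambda:\mathbb R\to\mathbb R$ is $$f_\lambda(x)=\operatorname{sign}(x)\Big(\sqrt{\big(\tfrac{\lambda}{4|x|}\big)^2+1}-\tfrac{\lambda}{4|x|}\Big)\ \text{ if }x\ne0,\qquad f_\lambda(0)=0.$$ In particular $f_0=\operatorname{sign}$, with $\operatorname{sign}(0)=0$. *)

theory Defs
  imports "HOL-Probability.Probability"
begin

text \<open>
  The time axis \<open>{1, ..., T}\<close> is a type \<open>'n :: {finite, linorder}\<close>; its order is the order of time,
  \<open>T = CARD('n) \<ge> 1\<close>, and paths are vectors of type \<open>real ^ 'n\<close>.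
\<close>

type_synonym 'n path = "(real, 'n) vec"
type_synonym 'n mat = "((real, 'n) vec, 'n) vec"

section \<open>Gaussian measures, possibly singular\<close>

text \<open>
  The covariance is a linear operator, so that the notion makes sense on \<open>real ^ 'n\<close> and on
  \<open>real ^ 'n \<times> real ^ 'n\<close> alike. Positive semidefiniteness need not be demanded: it follows from
  the boundedness of the characteristic function.
\<close>

definition gaussian_law :: "'a::euclidean_space measure \<Rightarrow> 'a \<Rightarrow> ('a \<Rightarrow> 'a) \<Rightarrow> bool" where
  "gaussian_law M m S \<longleftrightarrow>
     prob_space M \<and> sets M = sets borel \<and>
     linear S \<and> (\<forall>u v. u \<bullet> S v = S u \<bullet> v) \<and>
     (\<forall>u. (CLINT x|M. iexp (u \<bullet> x)) = exp (\<i> * complex_of_real (u \<bullet> m) - complex_of_real (u \<bullet> S u) / 2))"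

definition gaussian :: "'a::euclidean_space \<Rightarrow> ('a \<Rightarrow> 'a) \<Rightarrow> 'a measure" where
  "gaussian m S = (THE M. gaussian_law M m S)"

definition is_gaussian :: "'a::euclidean_space measure \<Rightarrow> bool" where
  "is_gaussian M \<longleftrightarrow> (\<exists>m S. gaussian_law M m S)"

text \<open>The operator of the block matrix with rows \<open>A, B\<close> and \<open>C, D\<close>.\<close>

definition block_op ::
  "real^'n^'n \<Rightarrow> real^'n^'n \<Rightarrow> real^'n^'n \<Rightarrow> real^'n^'n \<Rightarrow> (real^'n) \<times> (real^'n) \<Rightarrow> (real^'n) \<times> (real^'n)" where
  "block_op A B C D = (\<lambda>(u, v). (A *v u + B *v v, C *v u + D *v v))"

section \<open>Couplings and bi-causal couplings\<close>

definition Cpl :: "'a measure \<Rightarrow> 'b measure \<Rightarrow> ('a \<times> 'b) measure set" where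
  "Cpl \<mu> \<nu> = {\<pi>. prob_space \<pi> \<and> sets \<pi> = sets (\<mu> \<Otimes>\<^sub>M \<nu>) \<and> distr \<pi> \<mu> fst = \<mu> \<and> distr \<pi> \<nu> snd = \<nu>}"

text \<open>\<open>\<kappa>\<close> is a regular conditional law under \<open>M\<close> of \<open>Y\<close> (valued in \<open>F\<close>) given \<open>X\<close> (valued in \<open>E\<close>).\<close>

definition reg_cond_law ::
  "'w measure \<Rightarrow> 'e measure \<Rightarrow> ('w \<Rightarrow> 'e) \<Rightarrow> 'f measure \<Rightarrow> ('w \<Rightarrow> 'f) \<Rightarrow> ('e \<Rightarrow> 'f measure) \<Rightarrow> bool" where
  "reg_cond_law M E X F Y \<kappa> \<longleftrightarrow>
     \<kappa> \<in> E \<rightarrow>\<^sub>M prob_algebra F \<and>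
     (\<forall>A\<in>sets E. \<forall>B\<in>sets F.
        emeasure M {w \<in> space M. X w \<in> A \<and> Y w \<in> B} =
        (\<integral>\<^sup>+w. indicator A (X w) * emeasure (\<kappa> (X w)) B \<partial>M))"

definition path_space :: "'n set \<Rightarrow> ('n \<Rightarrow> real) measure" where
  "path_space J = (\<Pi>\<^sub>M i\<in>J. borel)"

definition past :: "'n::{finite,linorder} \<Rightarrow> 'n path \<Rightarrow> 'n \<Rightarrow> real" where
  "past t x = restrict (($) x) {..t}"

definition future :: "'n::{finite,linorder} \<Rightarrow> 'n path \<Rightarrow> 'n \<Rightarrow> real" where
  "future t x = restrict (($) x) {t<..}"

definition cond_path_law ::
  "'n::{finite,linorder} \<Rightarrow> 'n path measure \<Rightarrow> (('n \<Rightarrow> real) \<Rightarrow> ('n \<Rightarrow> real) measure) \<Rightarrow> bool" where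
  "cond_path_law t \<mu> \<kappa> \<longleftrightarrow>
     reg_cond_law \<mu> (path_space {..t}) (past t) (path_space {t<..}) (future t) \<kappa>"

definition cond_pair_law ::
  "'n::{finite,linorder} \<Rightarrow> ('n path \<times> 'n path) measure \<Rightarrow>
   (('n \<Rightarrow> real) \<times> ('n \<Rightarrow> real) \<Rightarrow> (('n \<Rightarrow> real) \<times> ('n \<Rightarrow> real)) measure) \<Rightarrow> bool" where
  "cond_pair_law t \<pi> \<kappa> \<longleftrightarrow>
     reg_cond_law \<pi>
       (path_space {..t} \<Otimes>\<^sub>M path_space {..t}) (map_prod (past t) (past t))
       (path_space {t<..} \<Otimes>\<^sub>M path_space {t<..}) (map_prod (future t) (future t)) \<kappa>"

text \<open>
  Regular conditional laws exist and are unique up to null sets here, so quantifying existentially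
  over their versions and asking for the coupling property almost everywhere does not depend on
  any choice. The guard \<open>\<exists>s. t < s\<close> says that \<open>t\<close> is not the terminal time.
\<close>

definition Cpl_bc ::
  "'n::{finite,linorder} path measure \<Rightarrow> 'n path measure \<Rightarrow> ('n path \<times> 'n path) measure set" where
  "Cpl_bc \<mu> \<nu> = {\<pi> \<in> Cpl \<mu> \<nu>. \<forall>t. (\<exists>s. t < s) \<longrightarrow>
     (\<exists>\<kappa>\<^sub>\<mu> \<kappa>\<^sub>\<nu> \<kappa>\<^sub>\<pi>. cond_path_law t \<mu> \<kappa>\<^sub>\<mu> \<and> cond_path_law t \<nu> \<kappa>\<^sub>\<nu> \<and> cond_pair_law t \<pi> \<kappa>\<^sub>\<pi> \<and>
       (AE (x, y) in \<pi>. \<kappa>\<^sub>\<pi> (past t x, past t y) \<in> Cpl (\<kappa>\<^sub>\<mu> (past t x)) (\<kappa>\<^sub>\<nu> (past t y))))}"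

section \<open>The entropic adapted Wasserstein distance\<close>

text \<open>
  The library's \<open>KL_divergence\<close> is a Bochner integral, hence real-valued and \<open>0\<close> when the integral
  diverges. Here the integral of the log-density is the extended one; its negative part is
  finite for probability measures.
\<close>

definition KL :: "'a measure \<Rightarrow> 'a measure \<Rightarrow> ereal" where
  "KL \<mu> \<nu> =
     (if absolutely_continuous \<nu> \<mu>
      then enn2ereal (\<integral>\<^sup>+x. ennreal (ln (enn2real (RN_deriv \<nu> \<mu> x))) \<partial>\<mu>)
         - enn2ereal (\<integral>\<^sup>+x. ennreal (- ln (enn2real (RN_deriv \<nu> \<mu> x))) \<partial>\<mu>)
      else \<infinity>)"

text \<open>For \<open>l = 0\<close> the entropic term is absent, since \<open>0 * \<infinity> = 0\<close> in \<^typ>\<open>ereal\<close>.\<close>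

definition objective ::
  "real \<Rightarrow> (real^'n) measure \<Rightarrow> (real^'n) measure \<Rightarrow> ((real^'n) \<times> (real^'n)) measure \<Rightarrow> ereal" where
  "objective l \<mu> \<nu> \<pi> =
     enn2ereal (\<integral>\<^sup>+(x, y). ennreal ((norm (x - y))\<^sup>2) \<partial>\<pi>) + ereal l * KL \<pi> (\<mu> \<Otimes>\<^sub>M \<nu>)"

text \<open>The squared distance.\<close>

definition AW2_sq :: "real \<Rightarrow> 'n::{finite,linorder} path measure \<Rightarrow> 'n path measure \<Rightarrow> ereal" where
  "AW2_sq l \<mu> \<nu> = (INF \<pi> \<in> Cpl_bc \<mu> \<nu>. objective l \<mu> \<nu> \<pi>)"

definition optimizer ::
  "real \<Rightarrow> 'n::{finite,linorder} path measure \<Rightarrow> 'n path measure \<Rightarrow> ('n path \<times> 'n path) measure \<Rightarrow> bool" where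
  "optimizer l \<mu> \<nu> \<pi> \<longleftrightarrow> \<pi> \<in> Cpl_bc \<mu> \<nu> \<and> objective l \<mu> \<nu> \<pi> = AW2_sq l \<mu> \<nu>"

definition unique_optimizer ::
  "real \<Rightarrow> 'n::{finite,linorder} path measure \<Rightarrow> 'n path measure \<Rightarrow> ('n path \<times> 'n path) measure \<Rightarrow> bool" where
  "unique_optimizer l \<mu> \<nu> \<pi> \<longleftrightarrow> optimizer l \<mu> \<nu> \<pi> \<and> (\<forall>\<pi>'. optimizer l \<mu> \<nu> \<pi>' \<longrightarrow> \<pi>' = \<pi>)"

section \<open>The matrices of the theorem\<close>

definition cholesky :: "'n::{finite,linorder} mat \<Rightarrow> 'n mat \<Rightarrow> bool" where
  "cholesky A L \<longleftrightarrow> (\<forall>i j. i < j \<longrightarrow> L $ i $ j = 0) \<and> (\<forall>i. L $ i $ i > 0) \<and> A = L ** transpose L"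

definition f_ent :: "real \<Rightarrow> real \<Rightarrow> real" where
  "f_ent l x = (if x = 0 then 0
     else sgn x * (sqrt ((l / (4 * \<bar>x\<bar>))\<^sup>2 + 1) - l / (4 * \<bar>x\<bar>)))"

definition N_mat :: "real^'n^'n \<Rightarrow> real^'n^'n \<Rightarrow> real^'n^'n" where
  "N_mat L M = (\<chi> i j. if i = j then (transpose M ** L) $ i $ i else 0)"

definition P_mat :: "real \<Rightarrow> real^'n^'n \<Rightarrow> real^'n^'n \<Rightarrow> real^'n^'n" where
  "P_mat l L M = map_matrix (f_ent l) (N_mat L M)"

definition diag_contraction :: "real^'n^'n \<Rightarrow> bool" where
  "diag_contraction P \<longleftrightarrow> (\<forall>i j. i \<noteq> j \<longrightarrow> P $ i $ j = 0) \<and> (\<forall>t. P $ t $ t \<in> {-1..1})"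

definition pi_P ::
  "real^'n \<Rightarrow> real^'n \<Rightarrow> real^'n^'n \<Rightarrow> real^'n^'n \<Rightarrow> real^'n^'n \<Rightarrow> ((real^'n) \<times> (real^'n)) measure" where
  "pi_P a b L M P =
     gaussian (a, b) (block_op (L ** transpose L) (L ** P ** transpose M)
                               (M ** transpose P ** transpose L) (M ** transpose M))"

lemma f_ent_0: "f_ent 0 = sgn"
  by (auto simp: f_ent_def fun_eq_iff)

lemma diag_contraction_P_mat:
  assumes "l \<ge> 0"
  shows "diag_contraction (P_mat l L M)"
proof -
  have "\<bar>f_ent l x\<bar> \<le> 1" for x
  proof -
    define c where "c = l / (4 * \<bar>x\<bar>)"
    have "c \<ge> 0"
      using assms by (simp add: c_def)
    have "sqrt (c\<^sup>2 + 1) \<le> c + 1"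
      using \<open>c \<ge> 0\<close> by (intro real_le_lsqrt) (auto simp: power2_eq_square algebra_simps)
    moreover have "c \<le> sqrt (c\<^sup>2 + 1)"
      by (rule real_le_rsqrt) simp
    ultimately show ?thesis
      by (auto simp: f_ent_def abs_mult simp flip: c_def)
  qed
  then show ?thesis
    by (auto simp: diag_contraction_def P_mat_def N_mat_def f_ent_def[of _ 0] abs_le_iff minus_le_iff)
qed

end

theory Submission
  imports Defs
begin

text \<open>
  Write \<open>x = a + L \<xi>\<close> and \<open>y = b + M \<eta>\<close>. Under \<open>\<mu>\<close> and \<open>\<nu>\<close> the innovations \<open>\<xi>\<close> and \<open>\<eta>\<close> are standard
  Gaussian vectors, and since \<open>L\<close> and \<open>M\<close> are lower triangular with nonzero diagonal, a path and its
  innovations determine each other up to any time. Under a bi-causal coupling the innovation \<open>\<eta>\<^sub>t\<close> is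
  independent of \<open>(x\<^sub>1, ..., x\<^sub>s, y\<^sub>1, ..., y\<^sub>s)\<close> for \<open>s < t\<close>, and the same holds for \<open>\<xi>\<^sub>t\<close>
  (\<open>bicausal_innovations_independent\<close>). So \<open>\<xi>\<^sub>s\<close> and \<open>\<eta>\<^sub>t\<close> are uncorrelated for \<open>s \<noteq> t\<close>, and the
  transport cost only sees the correlations \<open>r\<^sub>t\<close> of \<open>\<xi>\<^sub>t\<close> and \<open>\<eta>\<^sub>t\<close>: it equals
  \<open>K - 2 (\<Sum>t. N\<^sub>t\<^sub>t r\<^sub>t)\<close> with \<open>K\<close> depending on the marginals alone (\<open>transport_cost\<close>).

  For \<open>\<lambda> = 0\<close> this is linear in \<open>r\<close>, which ranges in \<open>[-1, 1]\<close> in each coordinate, so a coupling is optimal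
  if and only if \<open>r\<^sub>t\<close> is the sign of \<open>N\<^sub>t\<^sub>t\<close> whenever \<open>N\<^sub>t\<^sub>t \<noteq> 0\<close> (\<open>transport_optimizer_iff\<close>). If no \<open>N\<^sub>t\<^sub>t\<close>
  vanishes, then \<open>\<eta>\<^sub>t = r\<^sub>t \<xi>\<^sub>t\<close> almost surely and the optimizer is unique; otherwise some \<open>r\<^sub>t\<close> is free.
  A Gaussian bi-causal coupling is determined by \<open>r\<close>, because \<open>r\<close> gives its whole covariance
  (\<open>gaussian_bicausal_eq_pi_P\<close>).

  For \<open>\<lambda> > 0\<close> let \<open>\<rho>\<^sub>t = f\<^sub>\<lambda>(N\<^sub>t\<^sub>t)\<close>, so \<open>\<bar>\<rho>\<^sub>t\<bar> < 1\<close> and the candidate has a density \<open>h\<close> with respect to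
  \<open>\<mu> \<Otimes>\<^sub>M \<nu>\<close>, a product over time of Mehler kernels (\<open>pi_P_density\<close>). Its logarithm is quadratic, and under any
  bi-causal coupling it has expectation \<open>(\<Sum>t. \<rho>\<^sub>t / (1 - \<rho>\<^sub>t\<^sup>2) r\<^sub>t)\<close> plus a constant. The definition of
  \<open>f\<^sub>\<lambda>\<close> amounts to \<open>\<lambda> \<rho> / (1 - \<rho>\<^sup>2) = 2 N\<close>, so \<open>\<lambda>\<close> times this expectation cancels the linear part of the
  transport cost: up to a constant the objective is \<open>\<lambda>\<close> times the relative entropy of the coupling with
  respect to the candidate, which is nonnegative and vanishes only at the candidate
  (\<open>gibbs_variational_principle\<close>).

  Two foundations are needed. A probability measure on a Euclidean space is determined by its
  characteristic function (\<open>char_determines_measure\<close>), so that a Gaussian law may be identified with the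
  law of any explicit construction. And the couplings \<open>pi_P\<close> are images of independent noise; drawing the
  future noise afresh gives their conditional laws explicitly, which shows that they are bi-causal
  (\<open>coupled_paths_bicausal\<close>).
\<close>

section \<open>Characteristic functions determine measures\<close>

text \<open>
  Normalising the weight \<open>w\<close> turns \<open>w M1\<close> and \<open>w M2\<close> into probability measures under which the laws
  of the real variable \<open>X\<close> have equal characteristic functions, so the one-dimensional uniqueness
  theorem applies. Weights are what lets this theorem be used for one coordinate at a time.
\<close>

lemma weighted_char_determines_weighted_law:
  fixes X :: "'a \<Rightarrow> real" and w :: "'a \<Rightarrow> real"
  assumes "prob_space M1" "prob_space M2" and sets: "sets M1 = sets M2"
    and X[measurable]: "X \<in> borel_measurable M1"
    and w[measurable]: "w \<in> borel_measurable M1"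
    and w0: "\<And>x. 0 \<le> w x" and wC: "\<And>x. w x \<le> C"
    and char: "\<And>s. (CLINT x|M1. iexp (s * X x) * complex_of_real (w x)) = (CLINT x|M2. iexp (s * X x) * complex_of_real (w x))"
    and B: "B \<in> sets borel"
  shows "(\<integral>x. indicator B (X x) * w x \<partial>M1) = (\<integral>x. indicator B (X x) * w x \<partial>M2)"
proof -
  note [measurable] = B
  interpret p1: prob_space M1 by fact
  interpret p2: prob_space M2 by fact
  note [measurable_cong] = sets[symmetric]
  have X2[measurable]: "X \<in> borel_measurable M2" using X measurable_cong_sets[OF sets refl] by blast
  have w2[measurable]: "w \<in> borel_measurable M2" using w measurable_cong_sets[OF sets refl] by blast
  define c where "c = (\<integral>x. w x \<partial>M1)"
  have i1: "integrable M1 w" by (rule p1.integrable_const_bound[of _ C]) (auto simp: w0 wC)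
  have i2: "integrable M2 w" by (rule p2.integrable_const_bound[of _ C]) (auto simp: w0 wC)
  have c2: "c = (\<integral>x. w x \<partial>M2)"
    using char[of 0] by (simp add: c_def)
  show ?thesis
  proof (cases "c = 0")
    case True
    have "AE x in M1. w x = 0"
      using True integral_nonneg_eq_0_iff_AE[OF i1] by (simp add: c_def w0)
    moreover have "AE x in M2. w x = 0"
      using True integral_nonneg_eq_0_iff_AE[OF i2] c2 by (simp add: w0)
    ultimately have "(\<integral>x. indicator B (X x) * w x \<partial>M1) = 0" "(\<integral>x. indicator B (X x) * w x \<partial>M2) = 0"
      by (auto intro!: integral_eq_zero_AE)
    then show ?thesis by simp
  next
    case False
    have "c \<ge> 0" unfolding c_def by (rule Bochner_Integration.integral_nonneg) (simp add: w0)
    with False have c: "c > 0" by simp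
    define N where "N M = distr (density M (\<lambda>x. ennreal (w x / c))) borel X" for M :: "'a measure"
    have N: "real_distribution (N M) \<and> char (N M) = (\<lambda>s. (CLINT x|M. iexp (s * X x) * complex_of_real (w x)) / c)
      \<and> measure (N M) B = (\<integral>x. indicator B (X x) * w x \<partial>M) / c"
      if XM[measurable]: "X \<in> borel_measurable M" and wM[measurable]: "w \<in> borel_measurable M" 
       and int: "integrable M w" and c': "c = (\<integral>x. w x \<partial>M)" for M
    proof -
      let ?D = "density M (\<lambda>x. ennreal (w x / c))"
      have "emeasure ?D (space ?D) = (\<integral>\<^sup>+x. ennreal (w x / c) \<partial>M)"
        by (simp add: emeasure_density)
      also have "\<dots> = ennreal (\<integral>x. w x / c \<partial>M)"
        using int c w0 by (intro nn_integral_eq_integral) auto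
      also have "\<dots> = 1" using c c' by simp
      finally interpret D: prob_space ?D by (rule prob_spaceI)
      have 1: "real_distribution (N M)"
        unfolding N_def by (rule D.real_distribution_distr) simp
      have 2: "char (N M) s = (CLINT x|M. iexp (s * X x) * complex_of_real (w x)) / c" for s
      proof -
        have "char (N M) s = (CLINT x|?D. iexp (s * X x))"
          unfolding N_def char_def by (subst integral_distr) auto
        also have "\<dots> = (CLINT x|M. (w x / c) *\<^sub>R iexp (s * X x))"
          using c w0 by (subst integral_density) auto
        also have "\<dots> = (CLINT x|M. (iexp (s * X x) * complex_of_real (w x)) / c)"
          by (intro Bochner_Integration.integral_cong) (auto simp: scaleR_conv_of_real)
        finally show ?thesis by simp
      qed
      have "measure (N M) B = (\<integral>x. indicator B x \<partial>N M)" 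
        by (simp add: N_def)
      also have "\<dots> = (\<integral>x. indicator B (X x) \<partial>?D)"
        unfolding N_def by (subst integral_distr) auto
      also have "\<dots> = (\<integral>x. (w x / c) *\<^sub>R indicator B (X x) \<partial>M)"
        using c w0 by (subst integral_density) auto
      also have "\<dots> = (\<integral>x. (indicator B (X x) * w x) / c \<partial>M)"
        by (intro Bochner_Integration.integral_cong) auto
      finally show ?thesis using 1 2 by auto
    qed
    have n1: "real_distribution (N M1) \<and> char (N M1) = (\<lambda>s. (CLINT x|M1. iexp (s * X x) * complex_of_real (w x)) / c)
      \<and> measure (N M1) B = (\<integral>x. indicator B (X x) * w x \<partial>M1) / c"
      by (rule N) (auto simp: i1 c_def)
    have n2: "real_distribution (N M2) \<and> char (N M2) = (\<lambda>s. (CLINT x|M2. iexp (s * X x) * complex_of_real (w x)) / c)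
      \<and> measure (N M2) B = (\<integral>x. indicator B (X x) * w x \<partial>M2) / c"
      by (rule N) (auto simp: i2 c2)
    have "N M1 = N M2"
      using n1 n2 char by (intro Levy_uniqueness) auto
    then have "measure (N M1) B = measure (N M2) B" by simp
    then show ?thesis using n1 n2 c by simp
  qed
qed

text \<open>
  The Fourier factors \<open>iexp (u \<bullet> x)\<close> are traded, one coordinate at a time, for indicators of Borel
  sets of that coordinate. In one such step everything but the coordinate is a complex weight
  \<open>f x * iexp (u \<bullet> x)\<close> with \<open>f\<close> a product of indicators; its real and imaginary parts are differences
  of the nonnegative bounded weights \<open>f (1 + cos (u \<bullet> x))\<close>, \<open>f (1 + sin (u \<bullet> x))\<close> and \<open>f\<close>, to which the
  weighted one-dimensional statement applies. Once all coordinates are treated the two measures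
  agree on boxes.
\<close>

lemma char_determines_measure:
  fixes M1 M2 :: "'a::euclidean_space measure"
  assumes p1: "prob_space M1" and p2: "prob_space M2" and s1: "sets M1 = sets borel" and s2: "sets M2 = sets borel"
    and char: "\<And>u. (CLINT x|M1. iexp (u \<bullet> x)) = (CLINT x|M2. iexp (u \<bullet> x))"
  shows "M1 = M2"
proof -
  interpret p1: prob_space M1 by fact
  interpret p2: prob_space M2 by fact
  note [measurable_cong] = s1 s2
  have "\<forall>B u. (\<forall>b\<in>S. B b \<in> sets borel) \<longrightarrow>
    (CLINT x|M1. iexp (u \<bullet> x) * complex_of_real (\<Prod>b\<in>S. indicator (B b) (x \<bullet> b))) =
    (CLINT x|M2. iexp (u \<bullet> x) * complex_of_real (\<Prod>b\<in>S. indicator (B b) (x \<bullet> b)))"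
    if "finite S" "S \<subseteq> Basis" for S :: "'a set"
    using that
  proof (induction S rule: finite_induct)
    case empty
    then show ?case using char by simp
  next
    case (insert b S)
    show ?case
    proof (intro allI impI)
      fix B :: "'a \<Rightarrow> real set" and u
      assume B: "\<forall>b\<in>insert b S. B b \<in> sets borel"
      define f :: "'a \<Rightarrow> real" where "f x = (\<Prod>b\<in>S. indicator (B b) (x \<bullet> b))" for x
      have IH: "(CLINT x|M1. iexp (v \<bullet> x) * complex_of_real (f x)) = (CLINT x|M2. iexp (v \<bullet> x) * complex_of_real (f x))" for v
        using insert B unfolding f_def by blast
      have [measurable]: "B b \<in> sets borel" using B by auto
      have fm[measurable]: "f \<in> borel_measurable borel"
        unfolding f_def using B by (intro borel_measurable_prod borel_measurable_indicator' measurable_sets_borel) (auto intro: measurable_sets_borel)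
      have f01: "0 \<le> f x" "f x \<le> 1" for x
        unfolding f_def by (auto intro!: prod_nonneg prod_le_1)
      have int: "integrable M (\<lambda>x. iexp (v \<bullet> x) * complex_of_real (f x))" 
        if "prob_space M" and [measurable_cong]: "sets M = sets borel" for M v
      proof -
        interpret prob_space M by fact
        show ?thesis
          by (rule integrable_const_bound[of _ 1]) (auto simp: norm_mult f01)
      qed
      have int': "integrable M (\<lambda>x. indicator (B b) (x \<bullet> b) * (f x * g x))" 
        if "prob_space M" and [measurable_cong]: "sets M = sets borel" and [measurable]: "g \<in> borel_measurable borel" and g: "\<And>x. \<bar>g x\<bar> \<le> 2" for M g
      proof -
        interpret prob_space M by fact
        have "\<bar>f x * g x\<bar> \<le> 1 * 2" for x
          unfolding abs_mult using f01[of x] g[of x] by (intro mult_mono) auto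
        then show ?thesis
          by (intro integrable_const_bound[of _ 2]) (auto simp: indicator_def)
      qed
      \<comment> \<open>By Euler's formula the transforms of the weights are combinations of the transforms of \<open>f\<close> at \<open>s b\<close> and \<open>s b \<plusminus> u\<close>, which the induction hypothesis covers.\<close>
      have split: "(CLINT x|M. iexp (s * (x \<bullet> b)) * complex_of_real (f x * (1 + cos (u \<bullet> x)))) =
          (CLINT x|M. iexp ((s *\<^sub>R b) \<bullet> x) * complex_of_real (f x)) +
          ((CLINT x|M. iexp ((s *\<^sub>R b + u) \<bullet> x) * complex_of_real (f x)) +
          (CLINT x|M. iexp ((s *\<^sub>R b - u) \<bullet> x) * complex_of_real (f x))) / 2" (is ?C)
        "(CLINT x|M. iexp (s * (x \<bullet> b)) * complex_of_real (f x * (1 + sin (u \<bullet> x)))) =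
          (CLINT x|M. iexp ((s *\<^sub>R b) \<bullet> x) * complex_of_real (f x)) +
          ((CLINT x|M. iexp ((s *\<^sub>R b + u) \<bullet> x) * complex_of_real (f x)) -
          (CLINT x|M. iexp ((s *\<^sub>R b - u) \<bullet> x) * complex_of_real (f x))) / (2 * \<i>)" (is ?S)
        if M: "prob_space M" "sets M = sets borel" for M s
      proof -
        note i = int[OF M]
        have ex: "iexp ((s *\<^sub>R b + u) \<bullet> x) = iexp (s * (x \<bullet> b)) * iexp (u \<bullet> x)"
          "iexp ((s *\<^sub>R b - u) \<bullet> x) = iexp (s * (x \<bullet> b)) * iexp (- (u \<bullet> x))"
          "iexp ((s *\<^sub>R b) \<bullet> x) = iexp (s * (x \<bullet> b))" for x
          by (simp_all add: inner_simps ring_distribs inner_commute exp_add[symmetric] exp_diff exp_minus divide_inverse)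
        have ce: "complex_of_real (cos y) = (iexp y + iexp (-y)) / 2" "complex_of_real (sin y) = (iexp y - iexp (-y)) / (2 * \<i>)" for y
          by (simp_all add: cos_of_real[symmetric] sin_of_real[symmetric] cos_exp_eq sin_exp_eq)
        show ?C
          unfolding Bochner_Integration.integral_add[OF i i, symmetric] integral_divide_zero[symmetric]
          apply (subst Bochner_Integration.integral_add[symmetric])
          apply (rule i, intro integrable_divide_zero Bochner_Integration.integrable_add i impI)
          apply (intro Bochner_Integration.integral_cong refl)
          apply (simp only: ex ce of_real_mult of_real_add of_real_1)
          apply (simp add: field_simps)
          done
        show ?S
          unfolding Bochner_Integration.integral_diff[OF i i, symmetric] integral_divide_zero[symmetric]
          apply (subst Bochner_Integration.integral_add[symmetric])
          apply (rule i, intro integrable_divide_zero Bochner_Integration.integrable_diff i impI)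
          apply (intro Bochner_Integration.integral_cong refl)
          apply (simp only: ex ce of_real_mult of_real_add of_real_1)
          apply (simp add: field_simps)
          done
      qed
      have w2: "f x * g \<le> 2" if "g \<le> 2" "0 \<le> g" for x g
        using f01[of x] that mult_mono[of "f x" 1 g 2] by auto
      have cs: "cos (u \<bullet> x) \<le> 1" "- 1 \<le> cos (u \<bullet> x)" "sin (u \<bullet> x) \<le> 1" "- 1 \<le> sin (u \<bullet> x)"
         "0 \<le> 1 + cos (u \<bullet> x)" "0 \<le> 1 + sin (u \<bullet> x)" for x 
        using cos_ge_minus_one[of "u \<bullet> x"] sin_ge_minus_one[of "u \<bullet> x"] cos_le_one[of "u \<bullet> x"] sin_le_one[of "u \<bullet> x"] by linarith+
      have e0: "(\<integral>x. indicator (B b) (x \<bullet> b) * f x \<partial>M1) = (\<integral>x. indicator (B b) (x \<bullet> b) * f x \<partial>M2)"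
        apply (rule weighted_char_determines_weighted_law[of M1 M2 _ _ 1])
        using IH[of "_ *\<^sub>R b"] by (auto simp: assms f01 inner_commute)
      have ec: "(\<integral>x. indicator (B b) (x \<bullet> b) * (f x * (1 + cos (u \<bullet> x))) \<partial>M1) = (\<integral>x. indicator (B b) (x \<bullet> b) * (f x * (1 + cos (u \<bullet> x))) \<partial>M2)"
        apply (rule weighted_char_determines_weighted_law[of M1 M2 _ _ 2])
        by (auto simp only: split[OF p1 s1] split[OF p2 s2] IH) (auto simp: assms f01 cs intro!: w2 mult_nonneg_nonneg)
      have es: "(\<integral>x. indicator (B b) (x \<bullet> b) * (f x * (1 + sin (u \<bullet> x))) \<partial>M1) = (\<integral>x. indicator (B b) (x \<bullet> b) * (f x * (1 + sin (u \<bullet> x))) \<partial>M2)"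
        apply (rule weighted_char_determines_weighted_law[of M1 M2 _ _ 2])
        by (auto simp only: split[OF p1 s1] split[OF p2 s2] IH) (auto simp: assms f01 cs intro!: w2 mult_nonneg_nonneg)
      have fin: "(CLINT x|M. iexp (u \<bullet> x) * complex_of_real (\<Prod>b\<in>insert b S. indicator (B b) (x \<bullet> b))) = 
         complex_of_real ((\<integral>x. indicator (B b) (x \<bullet> b) * (f x * (1 + cos (u \<bullet> x))) \<partial>M) - (\<integral>x. indicator (B b) (x \<bullet> b) * f x \<partial>M)) +
         \<i> * complex_of_real ((\<integral>x. indicator (B b) (x \<bullet> b) * (f x * (1 + sin (u \<bullet> x))) \<partial>M) - (\<integral>x. indicator (B b) (x \<bullet> b) * f x \<partial>M))"
         if M: "prob_space M" "sets M = sets borel" for M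
      proof -
        note [measurable_cong] = M(2)
        have i0: "integrable M (\<lambda>x. indicator (B b) (x \<bullet> b) * f x)" using int'[OF M, of "\<lambda>_. 1"] by simp
        have i1: "integrable M (\<lambda>x. indicator (B b) (x \<bullet> b) * (f x * (1 + cos (u \<bullet> x))))"
          using cs by (intro int'[OF M]) (auto simp: abs_le_iff)
        have i2: "integrable M (\<lambda>x. indicator (B b) (x \<bullet> b) * (f x * (1 + sin (u \<bullet> x))))"
          using cs by (intro int'[OF M]) (auto simp: abs_le_iff)
        show ?thesis
          unfolding Bochner_Integration.integral_diff[OF i1 i0, symmetric] Bochner_Integration.integral_diff[OF i2 i0, symmetric]
            integral_complex_of_real[symmetric]
          apply (subst integral_mult_right_zero[symmetric])
          apply (subst Bochner_Integration.integral_add[symmetric])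
          apply (intro integrable_of_real Bochner_Integration.integrable_diff i1 i0)
          apply (intro integrable_mult_right impI integrable_of_real Bochner_Integration.integrable_diff i2 i0)
          apply (intro Bochner_Integration.integral_cong refl)
          using insert.hyps apply (simp add: f_def algebra_simps  flip: cis_conv_exp)
          apply (simp add: complex_eq_iff algebra_simps)
          done
      qed
      show "(CLINT x|M1. iexp (u \<bullet> x) * complex_of_real (\<Prod>b\<in>insert b S. indicator (B b) (x \<bullet> b))) =
        (CLINT x|M2. iexp (u \<bullet> x) * complex_of_real (\<Prod>b\<in>insert b S. indicator (B b) (x \<bullet> b)))"
        unfolding fin[OF p1 s1] fin[OF p2 s2] e0 ec es ..
    qed
  qed
  note main = this[OF finite_Basis order_refl, rule_format, where u = 0]
  have box: "measure M1 (box l u) = measure M2 (box l u)" for l u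
  proof -
    have ind: "(indicator (box l u) x :: real) = (\<Prod>b\<in>Basis. indicator {l \<bullet> b <..< u \<bullet> b} (x \<bullet> b))" for x
    proof (cases "x \<in> box l u")
      case False
      then obtain b where "b \<in> Basis" "x \<bullet> b \<notin> {l \<bullet> b <..< u \<bullet> b}" by (auto simp: box_def)
      with False show ?thesis by (auto intro!: prod_zero[symmetric] simp: indicator_def)
    qed (auto simp: box_def)
    have "complex_of_real (measure M (box l u)) = (CLINT x|M. complex_of_real (\<Prod>b\<in>Basis. indicator {l \<bullet> b <..< u \<bullet> b} (x \<bullet> b)))"
      if "sets M = sets borel" for M 
      unfolding ind[symmetric] integral_of_real using that by (simp add: sets_eq_imp_space_eq[OF that])
    note this[OF s1] this[OF s2]
    moreover have "(CLINT x|M1. complex_of_real (\<Prod>b\<in>Basis. indicator {l \<bullet> b <..< u \<bullet> b} (x \<bullet> b))) =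
        (CLINT x|M2. complex_of_real (\<Prod>b\<in>Basis. indicator {l \<bullet> b <..< u \<bullet> b} (x \<bullet> b)))"
      using main[of "\<lambda>b. {l \<bullet> b <..< u \<bullet> b}"] by simp
    ultimately show ?thesis by (metis of_real_eq_iff)
  qed
  show ?thesis
  proof (rule measure_eqI_generator_eq)
    let ?E = "range (\<lambda>(a, b). box a b::'a set)"
    show "Int_stable ?E"
      by (auto simp: Int_stable_def box_Int_box)
    show "?E \<subseteq> Pow UNIV" "sets M1 = sigma_sets UNIV ?E" "sets M2 = sigma_sets UNIV ?E"
      by (simp_all add: borel_eq_box s1 s2)
    let ?A = "\<lambda>n::nat. box (- (real n *\<^sub>R One)) (real n *\<^sub>R One) :: 'a set"
    show "range ?A \<subseteq> ?E" "(\<Union>i. ?A i) = UNIV"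
      unfolding UN_box_eq_UNIV by auto
    show "emeasure M1 (?A i) \<noteq> \<infinity>" for i by auto
    show "emeasure M1 X = emeasure M2 X" if "X \<in> ?E" for X
      using that by (auto simp: p1.emeasure_eq_measure p2.emeasure_eq_measure box)
  qed
qed

lemma gaussian_law_unique:
  assumes "gaussian_law M1 m S" "gaussian_law M2 m S"
  shows "M1 = M2"
  using assms unfolding gaussian_law_def by (intro char_determines_measure) auto

text \<open>
  This is how the definite description behind \<open>gaussian\<close> is evaluated: every measure with the
  prescribed characteristic function is that Gaussian measure.
\<close>

lemma gaussian_eqI: "gaussian_law M m S \<Longrightarrow> gaussian m S = M"
  unfolding gaussian_def by (rule the_equality) (auto intro: gaussian_law_unique)

section \<open>Gaussian laws as images of a noise space\<close>

interpretation std_normal: prob_space std_normal_distribution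
  using real_dist_normal_dist by (rule real_distribution.axioms)

abbreviation std_normal_pair :: "(real \<times> real) measure" where
  "std_normal_pair \<equiv> std_normal_distribution \<Otimes>\<^sub>M std_normal_distribution"

interpretation std_normal_pair: pair_prob_space std_normal_distribution std_normal_distribution ..

lemma sets_std_normal_pair [measurable_cong]: "sets std_normal_pair = sets (borel \<Otimes>\<^sub>M borel)"
  by (rule sets_pair_measure_cong) auto

lemma space_std_normal_pair [simp]: "space std_normal_pair = UNIV"
  by (simp add: space_pair_measure)

text \<open>
  At each time two independent standard normals are drawn: the first one is the innovation of the
  first path, the second one is the part of the innovation of the second path that is independent of
  it. Keeping both at the same index makes past and future of the pair of paths functions of
  independent groups of coordinates.
\<close>

definition noise :: "('n::finite \<Rightarrow> real \<times> real) measure" where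
  "noise = (\<Pi>\<^sub>M t\<in>UNIV. std_normal_pair)"

interpretation noise_factors: product_prob_space "\<lambda>t::'n::finite. std_normal_pair" UNIV ..

interpretation noise: prob_space "noise :: ('n::finite \<Rightarrow> real \<times> real) measure"
  unfolding noise_def by (rule noise_factors.prob_space_axioms)

lemma space_noise [simp]: "space (noise :: ('n::finite \<Rightarrow> real \<times> real) measure) = UNIV"
  by (simp add: noise_def space_PiM)

lemma measurable_noise_component [measurable]:
  "(\<lambda>\<omega>. \<omega> t) \<in> noise \<rightarrow>\<^sub>M std_normal_pair"
  unfolding noise_def by measurable

lemma measurable_noise_fst [measurable]: "(\<lambda>\<omega>. fst (\<omega> t)) \<in> borel_measurable noise"
  by (rule measurable_compose[OF measurable_noise_component]) measurable

lemma measurable_noise_snd [measurable]: "(\<lambda>\<omega>. snd (\<omega> t)) \<in> borel_measurable noise"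
  by (rule measurable_compose[OF measurable_noise_component]) measurable

lemma char_noise:
  "(CLINT \<omega>|noise. iexp (\<Sum>t\<in>(UNIV::'n::finite set). \<alpha> t * fst (\<omega> t) + \<beta> t * snd (\<omega> t))) =
    complex_of_real (exp (- (\<Sum>t\<in>UNIV. (\<alpha> t)\<^sup>2 + (\<beta> t)\<^sup>2) / 2))"
proof -
  have one: "(CLINT z|std_normal_pair. iexp (x * fst z + y * snd z)) = complex_of_real (exp (- (x\<^sup>2 + y\<^sup>2) / 2))" for x y
  proof -
    have "integrable std_normal_pair (\<lambda>z. iexp (x * fst z + y * snd z))"
      by (rule std_normal_pair.integrable_iexp) measurable
    from std_normal_pair.integral_fst'[OF this, symmetric]
    have "(CLINT z|std_normal_pair. iexp (x * fst z + y * snd z)) =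
        (CLINT p|std_normal_distribution. CLINT q|std_normal_distribution. iexp (x * p) * iexp (y * q))"
      by (simp only: fst_conv snd_conv of_real_add ring_distribs exp_add)
    also have "\<dots> = char std_normal_distribution x * char std_normal_distribution y"
      by (simp add: char_def)
    finally show ?thesis
      by (simp add: char_std_normal_distribution exp_of_real[symmetric] exp_add[symmetric] diff_divide_distrib)
  qed
  have "(CLINT \<omega>|noise. iexp (\<Sum>t\<in>(UNIV::'n set). \<alpha> t * fst (\<omega> t) + \<beta> t * snd (\<omega> t))) =
    (CLINT \<omega>|noise. (\<Prod>t\<in>(UNIV::'n set). iexp (\<alpha> t * fst (\<omega> t) + \<beta> t * snd (\<omega> t))))"
    by (simp add: exp_sum sum_distrib_left)
  also have "\<dots> = (\<Prod>t\<in>(UNIV::'n set). CLINT z|std_normal_pair. iexp (\<alpha> t * fst z + \<beta> t * snd z))"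
    unfolding noise_def
    by (rule noise_factors.product_integral_prod) (auto intro!: std_normal_pair.integrable_iexp)
  also have "\<dots> = complex_of_real (\<Prod>t\<in>UNIV. exp (- ((\<alpha> t)\<^sup>2 + (\<beta> t)\<^sup>2) / 2))"
    unfolding one of_real_prod ..
  also have "(\<Prod>t\<in>UNIV. exp (- ((\<alpha> t)\<^sup>2 + (\<beta> t)\<^sup>2) / 2)) = exp (- (\<Sum>t\<in>UNIV. (\<alpha> t)\<^sup>2 + (\<beta> t)\<^sup>2) / 2)"
    by (simp add: exp_sum[symmetric] sum_divide_distrib[symmetric] sum_negf[symmetric] del: sum_negf)
  finally show ?thesis .
qed

text \<open>
  The innovation of a path whose correlation at time \<open>t\<close> with the first noise coordinate is \<open>r t\<close>;
  constant \<open>1\<close> returns the first noise coordinate and constant \<open>0\<close> the second one.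
\<close>

definition innov :: "('n::finite \<Rightarrow> real) \<Rightarrow> ('n \<Rightarrow> real \<times> real) \<Rightarrow> real^'n" where
  "innov r \<omega> = (\<chi> t. r t * fst (\<omega> t) + sqrt (1 - (r t)\<^sup>2) * snd (\<omega> t))"

lemma innov_nth: "innov r \<omega> $ t = r t * fst (\<omega> t) + sqrt (1 - (r t)\<^sup>2) * snd (\<omega> t)"
  by (simp add: innov_def)

lemma borel_measurable_vec_lambda:
  fixes f :: "'a \<Rightarrow> 'n::finite \<Rightarrow> real"
  assumes [measurable]: "\<And>t. (\<lambda>x. f x t) \<in> borel_measurable M"
  shows "(\<lambda>x. \<chi> t. f x t) \<in> borel_measurable M"
proof -
  have "(\<lambda>x. (\<chi> t. f x t) \<bullet> i) \<in> borel_measurable M" if i: "i \<in> Basis" for i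
  proof -
    from i obtain t where "i = axis t 1" by (auto simp: Basis_vec_def)
    then show ?thesis by (simp add: inner_axis)
  qed
  then show ?thesis using borel_measurable_euclidean_space by blast
qed

lemma borel_measurable_vec_nth [measurable]: "(\<lambda>x::real^'n. x $ t) \<in> borel_measurable borel"
  by (intro borel_measurable_continuous_onI continuous_intros)

lemma borel_measurable_matrix_vector_mult [measurable]:
  fixes C :: "real^'n^'m"
  shows "(\<lambda>x. C *v x) \<in> borel_measurable borel"
  by (intro borel_measurable_continuous_onI linear_continuous_on matrix_vector_mul_bounded_linear)

lemma measurable_innov [measurable]: "innov r \<in> borel_measurable noise"
  unfolding innov_def[abs_def] by (rule borel_measurable_vec_lambda) measurable

lemma inner_matrix_vector_mult:
  fixes C :: "real^'n^'m"
  shows "u \<bullet> (C *v x) = (u v* C) \<bullet> x"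
  by (simp add: dot_lmul_matrix)

text \<open>
  The exponent is linear in the noise, so the transform is Gaussian. The two noise coordinates enter
  with \<open>(v v* M) $ t\<close> multiplied by \<open>r t\<close> and \<open>sqrt (1 - (r t)\<^sup>2)\<close>, whose squares add up to \<open>1\<close>, so that
  \<open>r\<close> only shows in the mixed terms.
\<close>

lemma char_innov_pair:
  fixes u v :: "real^'n"
  assumes r: "\<And>t. \<bar>r t\<bar> \<le> 1"
  shows "(CLINT \<omega>|noise. iexp (u \<bullet> (a + L *v innov (\<lambda>_. 1) \<omega>) + v \<bullet> (b + M *v innov r \<omega>))) =
    exp (\<i> * complex_of_real (u \<bullet> a + v \<bullet> b) -
      complex_of_real (\<Sum>t\<in>UNIV. ((u v* L) $ t)\<^sup>2 + 2 * r t * (u v* L) $ t * (v v* M) $ t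
        + ((v v* M) $ t)\<^sup>2) / 2)" (is "?L = exp (\<i> * complex_of_real ?m - complex_of_real ?q / 2)")
proof -
  define x y where "x t = (u v* L) $ t" "y t = (v v* M) $ t" for t
  have r2: "(r t)\<^sup>2 \<le> 1" for t using r by (simp add: abs_square_le_1)
  have e: "u \<bullet> (a + L *v innov (\<lambda>_. 1) \<omega>) + v \<bullet> (b + M *v innov r \<omega>) =
     ?m + (\<Sum>t\<in>UNIV. (x t + y t * r t) * fst (\<omega> t) + (y t * sqrt (1 - (r t)\<^sup>2)) * snd (\<omega> t))" for \<omega>
    unfolding inner_add_right inner_matrix_vector_mult
    by (simp add: inner_vec_def innov_nth x_y_def sum.distrib algebra_simps)
  have "?L = (CLINT \<omega>|noise. exp (\<i> * complex_of_real ?m) * 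
    iexp (\<Sum>t\<in>UNIV. (x t + y t * r t) * fst (\<omega> t) + (y t * sqrt (1 - (r t)\<^sup>2)) * snd (\<omega> t)))"
    unfolding e by (simp only: of_real_add ring_distribs exp_add)
  also have "\<dots> = exp (\<i> * complex_of_real ?m) * 
     complex_of_real (exp (- (\<Sum>t\<in>UNIV. (x t + y t * r t)\<^sup>2 + (y t * sqrt (1 - (r t)\<^sup>2))\<^sup>2) / 2))"
    by (simp only: integral_mult_right_zero char_noise)
  also have "(\<Sum>t\<in>UNIV. (x t + y t * r t)\<^sup>2 + (y t * sqrt (1 - (r t)\<^sup>2))\<^sup>2) = ?q"
    using r2 by (intro sum.cong) (auto simp: x_y_def power_mult_distrib, auto simp: power2_eq_square algebra_simps)
  finally show ?thesis
    by (simp only: exp_of_real[symmetric] exp_add[symmetric] of_real_minus of_real_divide of_real_numeral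
        diff_conv_add_uminus minus_divide_left)
qed

lemma quad_form_gram:
  fixes C :: "real^'n^'n"
  shows "u \<bullet> ((C ** transpose C) *v u) = (\<Sum>t\<in>UNIV. ((u v* C) $ t)\<^sup>2)"
  unfolding matrix_vector_mul_assoc[symmetric] inner_matrix_vector_mult
    transpose_matrix_vector unfolding inner_vec_def
  by (simp add: power2_eq_square)

lemma quad_form_block_op:
  fixes L M P :: "real^'n^'n"
  assumes "\<And>i j. i \<noteq> j \<Longrightarrow> P $ i $ j = 0"
  shows "(u, v) \<bullet> block_op (L ** transpose L) (L ** P ** transpose M) (M ** transpose P ** transpose L) (M ** transpose M) (u, v) =
    (\<Sum>t\<in>UNIV. ((u v* L) $ t)\<^sup>2 + 2 * P $ t $ t * (u v* L) $ t * (v v* M) $ t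
        + ((v v* M) $ t)\<^sup>2)"
proof -
  have P: "(P *v w) $ t = P $ t $ t * w $ t" "(w v* P) $ t = P $ t $ t * w $ t" for w t
    unfolding matrix_vector_mult_def vector_matrix_mult_def vec_lambda_beta
    using assms by (subst sum.remove[of _ t]; simp add: sum.neutral)+
  have "u \<bullet> ((L ** P ** transpose M) *v v) = (\<Sum>t\<in>UNIV. P $ t $ t * (u v* L) $ t * (v v* M) $ t)"
    "v \<bullet> ((M ** transpose P ** transpose L) *v u) = (\<Sum>t\<in>UNIV. P $ t $ t * (u v* L) $ t * (v v* M) $ t)"
    unfolding matrix_vector_mul_assoc[symmetric] inner_matrix_vector_mult
      transpose_matrix_vector unfolding inner_vec_def
    by (auto simp add: P vector_transpose_matrix intro!: sum.cong)
  then show ?thesis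
    by (simp add: block_op_def inner_add_right quad_form_gram sum.distrib sum_distrib_left algebra_simps)
qed

lemma linear_block_op: "linear (block_op A B C D)"
  by (rule linearI) (auto simp: block_op_def matrix_vector_right_distrib matrix_vector_mult_scaleR scaleR_right_distrib split: prod.splits)

lemma block_op_symmetric:
  "x \<bullet> block_op (L ** transpose L) (L ** P ** transpose M) (M ** transpose P ** transpose L) (M ** transpose M) y =
   block_op (L ** transpose L) (L ** P ** transpose M) (M ** transpose P ** transpose L) (M ** transpose M) x \<bullet> y"
  by (cases x; cases y)
    (simp only: block_op_def inner_add_right inner_add_left inner_matrix_vector_mult matrix_transpose_mul matrix_mul_assoc
      transpose_transpose transpose_matrix_vector[symmetric] prod.case inner_Pair add_ac)

definition coupled_paths :: "real^'n \<Rightarrow> real^'n \<Rightarrow> real^'n^'n \<Rightarrow> real^'n^'n \<Rightarrow> ('n \<Rightarrow> real) \<Rightarrow> ('n \<Rightarrow> real \<times> real) \<Rightarrow> (real^'n) \<times> (real^'n)" where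
  "coupled_paths a b L M r \<omega> = (a + L *v innov (\<lambda>_. 1) \<omega>, b + M *v innov r \<omega>)"

lemma measurable_coupled_paths [measurable]: "coupled_paths a b L M r \<in> borel_measurable noise"
  unfolding coupled_paths_def[abs_def] by measurable

text \<open>
  The law does not depend on \<open>r\<close>, since \<open>innov r\<close> is a standard Gaussian vector. Hence all the
  couplings built from the noise share their marginals.
\<close>

lemma gaussian_law_path:
  fixes C :: "real^'n^'n"
  assumes r: "\<And>t. \<bar>r t\<bar> \<le> 1"
  shows "gaussian_law (distr noise borel (\<lambda>\<omega>. m + C *v innov r \<omega>)) m ((*v) (C ** transpose C))"
  unfolding gaussian_law_def
proof (intro conjI allI)
  show "prob_space (distr noise borel (\<lambda>\<omega>. m + C *v innov r \<omega>))"
    by (rule noise.prob_space_distr) measurable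
  fix u v :: "real^'n"
  show "u \<bullet> ((C ** transpose C) *v v) = ((C ** transpose C) *v u) \<bullet> v"
    by (simp only: inner_matrix_vector_mult matrix_transpose_mul transpose_transpose transpose_matrix_vector[symmetric])
  have "(CLINT x|distr noise borel (\<lambda>\<omega>. m + C *v innov r \<omega>). iexp (u \<bullet> x)) = (CLINT \<omega>|noise. iexp (u \<bullet> (m + C *v innov r \<omega>)))"
    by (subst integral_distr) auto
  also have "\<dots> = exp (\<i> * complex_of_real (u \<bullet> m) - complex_of_real (u \<bullet> (C ** transpose C *v u)) / 2)"
    using char_innov_pair[of r 0 0 C u m C] r by (simp add: quad_form_gram)
  finally show "(CLINT x|distr noise borel (\<lambda>\<omega>. m + C *v innov r \<omega>). iexp (u \<bullet> x)) =
    exp (\<i> * complex_of_real (u \<bullet> m) - complex_of_real (u \<bullet> (C ** transpose C *v u)) / 2)" .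
qed (auto simp: matrix_vector_mul_linear)

lemma gaussian_law_coupled_paths:
  fixes L M P :: "real^'n^'n"
  assumes P: "diag_contraction P"
  shows "gaussian_law (distr noise borel (coupled_paths a b L M (\<lambda>t. P $ t $ t))) (a, b)
    (block_op (L ** transpose L) (L ** P ** transpose M) (M ** transpose P ** transpose L) (M ** transpose M))"
  unfolding gaussian_law_def
proof (intro conjI allI)
  let ?D = "distr noise borel (coupled_paths a b L M (\<lambda>t. P $ t $ t))"
  show "prob_space ?D"
    by (rule noise.prob_space_distr) measurable
  fix w :: "(real^'n) \<times> (real^'n)"
  obtain u v where w: "w = (u, v)" by (cases w)
  have "(CLINT x|?D. iexp (w \<bullet> x)) = 
    (CLINT \<omega>|noise. iexp (u \<bullet> (a + L *v innov (\<lambda>_. 1) \<omega>) + v \<bullet> (b + M *v innov (\<lambda>t. P $ t $ t) \<omega>)))"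
    by (subst integral_distr) (auto simp: coupled_paths_def w)
  also have "\<dots> = exp (\<i> * complex_of_real (w \<bullet> (a, b)) -
    complex_of_real (w \<bullet> block_op (L ** transpose L) (L ** P ** transpose M) (M ** transpose P ** transpose L) (M ** transpose M) w) / 2)"
    using P by (subst char_innov_pair) (auto simp: diag_contraction_def abs_le_iff minus_le_iff w quad_form_block_op)
  finally show "(CLINT x|?D. iexp (w \<bullet> x)) = exp (\<i> * complex_of_real (w \<bullet> (a, b)) -
    complex_of_real (w \<bullet> block_op (L ** transpose L) (L ** P ** transpose M) (M ** transpose P ** transpose L) (M ** transpose M) w) / 2)" .
qed (auto simp: linear_block_op block_op_symmetric)

text \<open>
  The representation through which the properties of \<open>pi_P\<close> are obtained; it also covers singular
  covariances, which occur as soon as some diagonal entry of \<open>P\<close> is \<open>1\<close> or \<open>-1\<close>.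
\<close>

lemma pi_P_eq_distr_noise:
  assumes "diag_contraction P"
  shows "pi_P a b L M P = distr noise borel (coupled_paths a b L M (\<lambda>t. P $ t $ t))"
  unfolding pi_P_def by (rule gaussian_eqI gaussian_law_coupled_paths assms)+

section \<open>Bi-causality of the Gaussian couplings\<close>

lemma measurable_override_on_noise [measurable]:
  "(\<lambda>z. override_on (snd z) (fst z) J) \<in> noise \<Otimes>\<^sub>M noise \<rightarrow>\<^sub>M (noise :: ('n::finite \<Rightarrow> real \<times> real) measure)"
  unfolding noise_def override_on_def
  by (rule measurable_PiM_single') (auto simp: space_PiM)

text \<open>
  Because the coordinates of the noise are independent, replacing those outside \<open>J\<close> by the ones of an
  independent copy does not change the law. With \<open>J\<close> the past this expresses the independence of past
  and future without splitting the product space.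
\<close>

lemma distr_noise_override_on:
  "distr (noise \<Otimes>\<^sub>M noise) noise (\<lambda>z. override_on (snd z) (fst z) J) = (noise :: ('n::finite \<Rightarrow> real \<times> real) measure)"
    (is "?D = _")
proof -
  have "?D = (\<Pi>\<^sub>M t\<in>UNIV. std_normal_pair)"
  proof (rule noise_factors.PiM_eqI)
    fix A :: "'n \<Rightarrow> (real \<times> real) set"
    assume A: "\<And>i. i \<in> UNIV \<Longrightarrow> A i \<in> sets std_normal_pair"
    define A1 A2 where "A1 t = (if t \<in> J then A t else UNIV)" "A2 t = (if t \<in> J then UNIV else A t)" for t
    have UN: "UNIV \<in> sets std_normal_pair" by (metis sets.top space_std_normal_pair)
    have A12: "A1 t \<in> sets std_normal_pair" "A2 t \<in> sets std_normal_pair" for t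
      using A UN by (auto simp: A1_A2_def)
    have em: "emeasure noise (Pi\<^sub>E UNIV B) = (\<Prod>t\<in>UNIV. emeasure std_normal_pair (B t))" "Pi\<^sub>E UNIV B \<in> sets noise"
      if "\<And>t. B t \<in> sets std_normal_pair" for B :: "'n \<Rightarrow> (real \<times> real) set"
      unfolding noise_def using that by (auto intro: noise_factors.emeasure_PiM)
    have "emeasure ?D (Pi\<^sub>E UNIV A) = emeasure (noise \<Otimes>\<^sub>M noise) (Pi\<^sub>E UNIV A1 \<times> Pi\<^sub>E UNIV A2)"
    proof (subst emeasure_distr)
      show "Pi\<^sub>E UNIV A \<in> sets noise" using A by (intro em) auto
      have "(\<lambda>z. override_on (snd z) (fst z) J) -` Pi\<^sub>E UNIV A = Pi\<^sub>E UNIV A1 \<times> Pi\<^sub>E UNIV A2"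
        by (auto simp: A1_A2_def override_on_def PiE_iff split: if_splits)
      then show "emeasure (noise \<Otimes>\<^sub>M noise) ((\<lambda>z. override_on (snd z) (fst z) J) -` Pi\<^sub>E UNIV A \<inter> space (noise \<Otimes>\<^sub>M noise)) =
          emeasure (noise \<Otimes>\<^sub>M noise) (Pi\<^sub>E UNIV A1 \<times> Pi\<^sub>E UNIV A2)"
        by (simp add: space_pair_measure)
    qed measurable
    also have "\<dots> = (\<Prod>t\<in>UNIV. emeasure std_normal_pair (A1 t) * emeasure std_normal_pair (A2 t))"
      using A12 by (simp add: noise.emeasure_pair_measure_Times em prod.distrib)
    also have "\<dots> = (\<Prod>t\<in>UNIV. emeasure std_normal_pair (A t))"
      using std_normal_pair.emeasure_space_1 by (intro prod.cong) (auto simp: A1_A2_def)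
    finally show "emeasure ?D (Pi\<^sub>E UNIV A) = (\<Prod>t\<in>UNIV. emeasure std_normal_pair (A t))" .
  qed (auto simp: noise_def)
  then show ?thesis by (simp add: noise_def)
qed

lemma nn_integral_noise_resample:
  fixes f :: "('n::finite \<Rightarrow> real \<times> real) \<Rightarrow> ennreal"
  assumes [measurable]: "f \<in> borel_measurable noise"
  shows "(\<integral>\<^sup>+\<omega>. f \<omega> \<partial>noise) = (\<integral>\<^sup>+\<omega>. \<integral>\<^sup>+\<omega>'. f (override_on \<omega>' \<omega> J) \<partial>noise \<partial>noise)"
proof -
  have "(\<integral>\<^sup>+\<omega>. f \<omega> \<partial>noise) = (\<integral>\<^sup>+z. f (override_on (snd z) (fst z) J) \<partial>(noise \<Otimes>\<^sub>M noise))"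
    by (subst distr_noise_override_on[of J, symmetric], subst nn_integral_distr) measurable
  also have "\<dots> = (\<integral>\<^sup>+\<omega>. \<integral>\<^sup>+\<omega>'. f (override_on \<omega>' \<omega> J) \<partial>noise \<partial>noise)"
    by (subst noise.nn_integral_fst[symmetric]) auto
  finally show ?thesis .
qed

text \<open>
  If the conditioning variable \<open>X\<close> only sees the coordinates in \<open>J\<close>, and \<open>Y\<close> depends on these
  only through the value of \<open>X\<close>, then the conditional law of \<open>Y\<close> is obtained by freezing \<open>X\<close> and
  drawing fresh noise.
\<close>

lemma reg_cond_law_noise:
  fixes X :: "('n::finite \<Rightarrow> real \<times> real) \<Rightarrow> 'e"
  assumes X [measurable]: "X \<in> noise \<rightarrow>\<^sub>M E" and Y [measurable]: "Y \<in> noise \<rightarrow>\<^sub>M F"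
    and G [measurable]: "(\<lambda>(e, \<omega>). G e \<omega>) \<in> E \<Otimes>\<^sub>M noise \<rightarrow>\<^sub>M F"
    and X_past: "\<And>\<omega> \<omega>'. X (override_on \<omega>' \<omega> J) = X \<omega>"
    and Y_eq: "\<And>\<omega> \<omega>'. Y (override_on \<omega>' \<omega> J) = G (X \<omega>) \<omega>'"
  shows "reg_cond_law noise E X F Y (\<lambda>e. distr noise F (G e))"
  unfolding reg_cond_law_def
proof (intro conjI ballI)
  have Ge: "G e \<in> noise \<rightarrow>\<^sub>M F" if "e \<in> space E" for e
    using measurable_compose[OF measurable_Pair1'[OF that] G] by simp
  have "(\<lambda>e. distr noise F (G e)) \<in> E \<rightarrow>\<^sub>M subprob_algebra F"
    using G by (rule measurable_distr2)
      (auto simp: space_subprob_algebra intro!: measurable_const prob_space_imp_subprob_space noise.prob_space_axioms)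
  then show "(\<lambda>e. distr noise F (G e)) \<in> E \<rightarrow>\<^sub>M prob_algebra F"
    by (rule measurable_prob_algebraI[rotated]) (intro noise.prob_space_distr Ge)
  fix A B assume [measurable]: "A \<in> sets E" "B \<in> sets F"
  have XE: "X \<omega> \<in> space E" for \<omega> using measurable_space[OF X] by simp
  have "emeasure noise {w \<in> space noise. X w \<in> A \<and> Y w \<in> B} = (\<integral>\<^sup>+\<omega>. indicator A (X \<omega>) * indicator B (Y \<omega>) \<partial>noise)"
  proof (subst nn_integral_indicator[symmetric])
    show "{w \<in> space noise. X w \<in> A \<and> Y w \<in> B} \<in> sets noise" by measurable
  qed (auto intro!: nn_integral_cong simp: indicator_def)
  also have "\<dots> = (\<integral>\<^sup>+\<omega>. \<integral>\<^sup>+\<omega>'. indicator A (X \<omega>) * indicator B (G (X \<omega>) \<omega>') \<partial>noise \<partial>noise)"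
    by (subst nn_integral_noise_resample[where J = J]) (auto simp: X_past Y_eq)
  also have "\<dots> = (\<integral>\<^sup>+\<omega>. indicator A (X \<omega>) * emeasure (distr noise F (G (X \<omega>))) B \<partial>noise)"
  proof (intro nn_integral_cong)
    fix \<omega>
    note [measurable] = Ge[OF XE[of \<omega>]]
    have "(\<integral>\<^sup>+\<omega>'. indicator B (G (X \<omega>) \<omega>') \<partial>noise) = emeasure (distr noise F (G (X \<omega>))) B"
      by (simp add: nn_integral_distr flip: nn_integral_indicator)
    then show "(\<integral>\<^sup>+\<omega>'. indicator A (X \<omega>) * indicator B (G (X \<omega>) \<omega>') \<partial>noise) =
        indicator A (X \<omega>) * emeasure (distr noise F (G (X \<omega>))) B"
      by (subst nn_integral_cmult) auto
  qed
  finally show "emeasure noise {w \<in> space noise. X w \<in> A \<and> Y w \<in> B} =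
      (\<integral>\<^sup>+\<omega>. indicator A (X \<omega>) * emeasure (distr noise F (G (X \<omega>))) B \<partial>noise)" .
qed

lemma reg_cond_law_distr:
  assumes \<Phi> [measurable]: "\<Phi> \<in> M \<rightarrow>\<^sub>M N" and [measurable]: "X \<in> N \<rightarrow>\<^sub>M E" "Y \<in> N \<rightarrow>\<^sub>M F"
    and rcl: "reg_cond_law M E (\<lambda>w. X (\<Phi> w)) F (\<lambda>w. Y (\<Phi> w)) \<kappa>"
  shows "reg_cond_law (distr M N \<Phi>) E X F Y \<kappa>"
  unfolding reg_cond_law_def
proof (intro conjI ballI)
  show \<kappa>: "\<kappa> \<in> E \<rightarrow>\<^sub>M prob_algebra F" using rcl by (simp add: reg_cond_law_def)
  fix A B assume [measurable]: "A \<in> sets E" "B \<in> sets F"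
  note [measurable] = measurable_prob_algebraD[OF \<kappa>]
  have "emeasure (distr M N \<Phi>) {w \<in> space (distr M N \<Phi>). X w \<in> A \<and> Y w \<in> B} =
      emeasure M {w \<in> space M. X (\<Phi> w) \<in> A \<and> Y (\<Phi> w) \<in> B}"
    using measurable_space[OF \<Phi>] by (subst emeasure_distr) (auto intro!: arg_cong2[of _ _ _ _ emeasure])
  also have "\<dots> = (\<integral>\<^sup>+w. indicator A (X (\<Phi> w)) * emeasure (\<kappa> (X (\<Phi> w))) B \<partial>M)"
    using rcl by (simp add: reg_cond_law_def)
  also have "\<dots> = (\<integral>\<^sup>+w. indicator A (X w) * emeasure (\<kappa> (X w)) B \<partial>distr M N \<Phi>)"
    by (subst nn_integral_distr) auto
  finally show "emeasure (distr M N \<Phi>) {w \<in> space (distr M N \<Phi>). X w \<in> A \<and> Y w \<in> B} =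
      (\<integral>\<^sup>+w. indicator A (X w) * emeasure (\<kappa> (X w)) B \<partial>distr M N \<Phi>)" .
qed

text \<open>
  Besides the shape this asks for a nonzero diagonal, that is, for invertibility: then \<open>C *v x\<close> and \<open>x\<close>
  carry the same information up to any given time.
\<close>

definition lower_triangular :: "'n::{finite,linorder} mat \<Rightarrow> bool" where
  "lower_triangular C \<longleftrightarrow> (\<forall>i j. i < j \<longrightarrow> C $ i $ j = 0) \<and> (\<forall>i. C $ i $ i \<noteq> 0)"

lemma lower_triangular_cong:
  assumes "lower_triangular C" "\<And>j. j \<le> s \<Longrightarrow> x $ j = y $ j"
  shows "(C *v x) $ s = (C *v y) $ s"
  unfolding matrix_vector_mult_def vec_lambda_beta
  using assms by (intro sum.cong) (auto simp: lower_triangular_def not_le[symmetric])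

text \<open>
  Forward substitution: row \<open>s\<close> expresses \<open>x $ s\<close> through \<open>(C *v x) $ s\<close> and the earlier coordinates.
\<close>

lemma lower_triangular_determines:
  fixes C :: "'n::{finite,linorder} mat"
  assumes C: "lower_triangular C" and eq: "\<And>j. j \<le> t \<Longrightarrow> (C *v x) $ j = (C *v y) $ j" and "s \<le> t"
  shows "x $ s = y $ s"
  using \<open>s \<le> t\<close>
\<comment> \<open>A finite linear order is well-founded: the number of predecessors decreases.\<close>
proof (induction "card {..<s}" arbitrary: s rule: less_induct)
  case less
  have IH: "x $ j = y $ j" if "j < s" for j
  proof (rule less.hyps)
    have "{..<j} \<subset> {..<s}" using that by auto
    then show "card {..<j} < card {..<s}" by (intro psubset_card_mono) auto
    show "j \<le> t" using that less.prems by auto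
  qed
  have split: "(C *v z) $ s = C $ s $ s * z $ s + (\<Sum>j\<in>{..<s}. C $ s $ j * z $ j)" for z
  proof -
    have "(C *v z) $ s = (\<Sum>j\<in>insert s {..<s}. C $ s $ j * z $ j)"
      unfolding matrix_vector_mult_def vec_lambda_beta
      using C by (intro sum.mono_neutral_right) (auto simp: lower_triangular_def not_less)
    then show ?thesis by simp
  qed
  have "(\<Sum>j\<in>{..<s}. C $ s $ j * x $ j) = (\<Sum>j\<in>{..<s}. C $ s $ j * y $ j)"
    by (intro sum.cong) (auto simp: IH)
  then have "C $ s $ s * x $ s = C $ s $ s * y $ s"
    using eq[OF less.prems] unfolding split by simp
  then show ?case using C by (simp add: lower_triangular_def)
qed

lemma measurable_past [measurable]: "past t \<in> borel \<rightarrow>\<^sub>M path_space {..t}"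
  unfolding past_def path_space_def by (rule measurable_restrict) measurable

lemma measurable_future [measurable]: "future t \<in> borel \<rightarrow>\<^sub>M path_space {t<..}"
  unfolding future_def path_space_def by (rule measurable_restrict) measurable

lemma measurable_map_prod [measurable (raw)]:
  assumes [measurable]: "f \<in> A \<rightarrow>\<^sub>M B" "g \<in> C \<rightarrow>\<^sub>M D"
  shows "map_prod f g \<in> A \<Otimes>\<^sub>M C \<rightarrow>\<^sub>M B \<Otimes>\<^sub>M D"
  unfolding map_prod_def by measurable

definition glue :: "'n::{finite,linorder} \<Rightarrow> 'n path \<Rightarrow> 'n path \<Rightarrow> 'n path" where
  "glue t z z' = (\<chi> s. if s \<le> t then z $ s else z' $ s)"

lemma measurable_glue [measurable (raw)]:
  assumes [measurable]: "f \<in> borel_measurable N" "g \<in> borel_measurable N"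
  shows "(\<lambda>x. glue t (f x) (g x)) \<in> borel_measurable N"
  unfolding glue_def by (rule borel_measurable_vec_lambda) measurable

text \<open>
  The future of the path \<open>m + C *v z\<close> when its past is prescribed to be \<open>p\<close>. The past noise is recovered
  from \<open>p\<close> by applying the inverse of \<open>C\<close> to \<open>p\<close> padded with zeros; by triangularity the padding does
  not affect the coordinates up to \<open>t\<close>, and \<open>glue\<close> discards the others.
\<close>

definition continuation :: "'n::{finite,linorder} \<Rightarrow> 'n path \<Rightarrow> 'n mat \<Rightarrow> ('n \<Rightarrow> real) \<Rightarrow> 'n path \<Rightarrow> ('n \<Rightarrow> real)" where
  "continuation t m C p z =
    future t (m + C *v glue t (matrix_inv C *v ((\<chi> s. if s \<le> t then p s else 0) - m)) z)"

lemma measurable_path_space_component: "s \<in> J \<Longrightarrow> (\<lambda>p. p s) \<in> borel_measurable (path_space J)"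
  unfolding path_space_def by simp

lemma measurable_continuation:
  "(\<lambda>(p, z). continuation t m C p z) \<in> path_space {..t} \<Otimes>\<^sub>M borel \<rightarrow>\<^sub>M path_space {t<..}"
proof -
  have [measurable]: "(\<lambda>x. \<chi> s. if s \<le> t then fst x s else 0) \<in> borel_measurable (path_space {..t} \<Otimes>\<^sub>M borel)"
  proof (rule borel_measurable_vec_lambda)
    fix s show "(\<lambda>x. if s \<le> t then fst x s else 0) \<in> borel_measurable (path_space {..t} \<Otimes>\<^sub>M borel)"
      by (cases "s \<le> t") (auto intro: measurable_compose[OF measurable_fst measurable_path_space_component])
  qed
  show ?thesis
    unfolding continuation_def case_prod_beta
    apply measurable
    done
qed

lemma innov_override_on:
  "innov r (override_on \<omega>' \<omega> {..t}) = glue t (innov r \<omega>) (innov r \<omega>')"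
  by (auto simp: vec_eq_iff glue_def innov_nth override_on_def)

lemma past_glue:
  assumes "lower_triangular C"
  shows "past t (m + C *v glue t z z') = past t (m + C *v z)"
proof -
  have "(C *v glue t z z') $ s = (C *v z) $ s" if "s \<le> t" for s
    using that by (intro lower_triangular_cong assms) (auto simp: glue_def)
  then show ?thesis by (auto simp: past_def restrict_def)
qed

lemma future_glue:
  assumes "lower_triangular C" "C ** matrix_inv C = mat 1"
  shows "future t (m + C *v glue t z z') = continuation t m C (past t (m + C *v z)) z'"
proof -
  have "(matrix_inv C *v ((\<chi> s. if s \<le> t then past t (m + C *v z) s else 0) - m)) $ s = z $ s" if "s \<le> t" for s
  proof (rule lower_triangular_determines[OF assms(1) _ that])
    fix j assume "j \<le> t"
    then show "(C *v (matrix_inv C *v ((\<chi> s. if s \<le> t then past t (m + C *v z) s else 0) - m))) $ j = (C *v z) $ j"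
      by (simp add: matrix_vector_mul_assoc assms(2) past_def)
  qed
  then have "glue t (matrix_inv C *v ((\<chi> s. if s \<le> t then past t (m + C *v z) s else 0) - m)) z' = glue t z z'"
    by (auto simp: glue_def vec_eq_iff)
  then show ?thesis by (simp add: continuation_def)
qed

text \<open>
  For a past pair \<open>(p, q)\<close> the conditional law of the futures is the joint law of the two
  continuations driven by the same fresh noise. Its marginals are the laws of the single
  continuations, which depend on \<open>p\<close> alone and on \<open>q\<close> alone, and these are the conditional laws of the
  marginals; this is bi-causality.
\<close>

lemma coupled_paths_bicausal:
  assumes L: "lower_triangular L" "L ** matrix_inv L = mat 1" and M: "lower_triangular M" "M ** matrix_inv M = mat 1"
  shows "distr noise borel (coupled_paths a b L M r) \<in>
    Cpl_bc (distr noise borel (\<lambda>\<omega>. a + L *v innov (\<lambda>_. 1) \<omega>)) (distr noise borel (\<lambda>\<omega>. b + M *v innov r \<omega>))"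
    (is "?\<pi> \<in> Cpl_bc ?\<mu> ?\<nu>")
  unfolding Cpl_bc_def
proof (intro CollectI conjI allI impI)
  have [measurable]: "coupled_paths a b L M r \<in> noise \<rightarrow>\<^sub>M borel \<Otimes>\<^sub>M borel"
    unfolding borel_prod by measurable
  have sets: "sets (?\<mu> \<Otimes>\<^sub>M ?\<nu>) = sets borel"
    unfolding borel_prod[symmetric] by (rule sets_pair_measure_cong) auto
  have pi: "?\<pi> = distr noise (borel \<Otimes>\<^sub>M borel) (coupled_paths a b L M r)"
    by (simp add: borel_prod)
  have "distr ?\<pi> ?\<mu> fst = ?\<mu>" "distr ?\<pi> ?\<nu> snd = ?\<nu>"
    unfolding pi by (subst distr_distr; auto simp: coupled_paths_def intro!: distr_cong)+
  then show "?\<pi> \<in> Cpl ?\<mu> ?\<nu>"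
    unfolding Cpl_def using sets by (auto intro!: noise.prob_space_distr)
  fix t :: 'a
  define k1 where "k1 p = distr noise (path_space {t<..}) (\<lambda>\<omega>. continuation t a L p (innov (\<lambda>_. 1) \<omega>))" for p
  define k2 where "k2 p = distr noise (path_space {t<..}) (\<lambda>\<omega>. continuation t b M p (innov r \<omega>))" for p
  define k where "k p = distr noise (path_space {t<..} \<Otimes>\<^sub>M path_space {t<..})
    (\<lambda>\<omega>. (continuation t a L (fst p) (innov (\<lambda>_. 1) \<omega>), continuation t b M (snd p) (innov r \<omega>)))" for p
  have mc: "(\<lambda>(p, \<omega>). continuation t m C p (innov \<rho> \<omega>)) \<in> path_space {..t} \<Otimes>\<^sub>M noise \<rightarrow>\<^sub>M path_space {t<..}" for m C \<rho>
    using measurable_compose[OF _ measurable_continuation, of "\<lambda>(p, \<omega>). (p, innov \<rho> \<omega>)" "path_space {..t} \<Otimes>\<^sub>M noise" t m C]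
    by (simp add: case_prod_beta)
  have mc': "(\<lambda>\<omega>. continuation t m C p (innov \<rho> \<omega>)) \<in> noise \<rightarrow>\<^sub>M path_space {t<..}" if "p \<in> space (path_space {..t})" for m C \<rho> p
    using measurable_compose[OF measurable_Pair1'[OF that] mc[of m C \<rho>]] by simp
  have single: "cond_path_law t (distr noise borel (\<lambda>\<omega>. m + C *v innov \<rho> \<omega>))
      (\<lambda>p. distr noise (path_space {t<..}) (\<lambda>\<omega>. continuation t m C p (innov \<rho> \<omega>)))"
    if "lower_triangular C" "C ** matrix_inv C = mat 1" for m C \<rho>
    unfolding cond_path_law_def
    by (intro reg_cond_law_distr reg_cond_law_noise[where J = "{..t}"] mc)
       (auto simp: innov_override_on past_glue future_glue that)
  have 1: "cond_path_law t ?\<mu> k1" and 2: "cond_path_law t ?\<nu> k2"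
    unfolding k1_def[abs_def] k2_def[abs_def] by (intro single L M)+
  have 3: "cond_pair_law t ?\<pi> k"
    unfolding cond_pair_law_def k_def[abs_def]
  proof (intro reg_cond_law_distr reg_cond_law_noise[where J = "{..t}"])
    show "(\<lambda>(e, \<omega>). (continuation t a L (fst e) (innov (\<lambda>_. 1) \<omega>), continuation t b M (snd e) (innov r \<omega>)))
      \<in> (path_space {..t} \<Otimes>\<^sub>M path_space {..t}) \<Otimes>\<^sub>M noise \<rightarrow>\<^sub>M path_space {t<..} \<Otimes>\<^sub>M path_space {t<..}"
      unfolding case_prod_beta
      using measurable_compose[OF _ mc, of "\<lambda>(e, \<omega>). (fst e, \<omega>)" "(path_space {..t} \<Otimes>\<^sub>M path_space {..t}) \<Otimes>\<^sub>M noise" a L "\<lambda>_. 1"]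
        measurable_compose[OF _ mc, of "\<lambda>(e, \<omega>). (snd e, \<omega>)" "(path_space {..t} \<Otimes>\<^sub>M path_space {..t}) \<Otimes>\<^sub>M noise" b M r]
      by (intro measurable_Pair) (simp_all add: case_prod_beta)
  qed (auto simp: coupled_paths_def innov_override_on past_glue future_glue L M borel_prod[symmetric])
  have "AE (x, y) in ?\<pi>. k (past t x, past t y) \<in> Cpl (k1 (past t x)) (k2 (past t y))"
  proof (intro AE_I2, clarify)
    fix x y :: "'a path"
    have x: "past t x \<in> space (path_space {..t})" "past t y \<in> space (path_space {..t})" 
      using measurable_space[OF measurable_past] by auto
    note [measurable] = mc'[OF x(1)] mc'[OF x(2)]
    have "sets (k1 (past t x) \<Otimes>\<^sub>M k2 (past t y)) = sets (path_space {t<..} \<Otimes>\<^sub>M path_space {t<..})"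
      by (rule sets_pair_measure_cong) (auto simp: k1_def k2_def)
    then show "k (past t x, past t y) \<in> Cpl (k1 (past t x)) (k2 (past t y))"
      unfolding Cpl_def k_def k1_def k2_def
      by (auto intro!: noise.prob_space_distr simp: distr_distr o_def cong: distr_cong)
  qed
  with 1 2 3 show "\<exists>\<kappa>\<^sub>\<mu> \<kappa>\<^sub>\<nu> \<kappa>\<^sub>\<pi>. cond_path_law t ?\<mu> \<kappa>\<^sub>\<mu> \<and> cond_path_law t ?\<nu> \<kappa>\<^sub>\<nu> \<and> cond_pair_law t ?\<pi> \<kappa>\<^sub>\<pi> \<and>
      (AE (x, y) in ?\<pi>. \<kappa>\<^sub>\<pi> (past t x, past t y) \<in> Cpl (\<kappa>\<^sub>\<mu> (past t x)) (\<kappa>\<^sub>\<nu> (past t y)))"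
    by blast
qed

section \<open>Innovations of a bi-causal coupling at distinct times are independent\<close>

text \<open>
  The defining identity of a conditional law on rectangles extends to all measurable sets of pairs:
  both sides are measures, the right-hand one being the composition of \<open>M\<close> with a kernel.
\<close>

lemma reg_cond_law_emeasure:
  assumes "prob_space M" and rcl: "reg_cond_law M E X F Y \<kappa>"
    and X [measurable]: "X \<in> M \<rightarrow>\<^sub>M E" and Y [measurable]: "Y \<in> M \<rightarrow>\<^sub>M F" and D: "D \<in> sets (E \<Otimes>\<^sub>M F)"
  shows "emeasure M {w \<in> space M. (X w, Y w) \<in> D} = (\<integral>\<^sup>+w. emeasure (\<kappa> (X w)) {y \<in> space F. (X w, y) \<in> D} \<partial>M)"
proof -
  interpret prob_space M by fact
  have \<kappa>: "\<kappa> \<in> E \<rightarrow>\<^sub>M prob_algebra F" using rcl by (simp add: reg_cond_law_def)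
  then have \<kappa>s [measurable]: "\<kappa> \<in> E \<rightarrow>\<^sub>M subprob_algebra F" by (rule measurable_prob_algebraD)
  have \<kappa>X: "sets (\<kappa> (X w)) = sets F" "space (\<kappa> (X w)) = space F" if "w \<in> space M" for w
    using sets_kernel[OF \<kappa>s measurable_space[OF X that]] by (auto dest: sets_eq_imp_space_eq)
  define N1 where "N1 = distr M (E \<Otimes>\<^sub>M F) (\<lambda>w. (X w, Y w))"
  define K where "K w = distr (\<kappa> (X w)) (E \<Otimes>\<^sub>M F) (\<lambda>y. (X w, y))" for w
  have K: "K \<in> M \<rightarrow>\<^sub>M subprob_algebra (E \<Otimes>\<^sub>M F)"
    unfolding K_def[abs_def] by (rule measurable_distr2[where M = F]) measurable
  define N2 where "N2 = M \<bind> K"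
  have sets_N2: "sets N2 = sets (E \<Otimes>\<^sub>M F)"
    unfolding N2_def by (rule sets_bind[OF sets_kernel[OF K]]) (auto simp: not_empty)
  have em2: "emeasure N2 A = (\<integral>\<^sup>+w. emeasure (\<kappa> (X w)) {y \<in> space F. (X w, y) \<in> A} \<partial>M)" if A [measurable]: "A \<in> sets (E \<Otimes>\<^sub>M F)" for A
  proof -
    have "emeasure N2 A = (\<integral>\<^sup>+w. emeasure (K w) A \<partial>M)"
      unfolding N2_def by (rule emeasure_bind[OF not_empty K A])
    also have "\<dots> = (\<integral>\<^sup>+w. emeasure (\<kappa> (X w)) {y \<in> space F. (X w, y) \<in> A} \<partial>M)"
    proof (intro nn_integral_cong)
      fix w assume w: "w \<in> space M"
      have m: "(\<lambda>y. (X w, y)) \<in> \<kappa> (X w) \<rightarrow>\<^sub>M E \<Otimes>\<^sub>M F"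
        using measurable_Pair1'[OF measurable_space[OF X w], of F] \<kappa>X(1)[OF w] measurable_cong_sets by blast
      have "(\<lambda>y. (X w, y)) -` A \<inter> space (\<kappa> (X w)) = {y \<in> space F. (X w, y) \<in> A}"
        using sets.sets_into_space[OF A] by (auto simp: \<kappa>X[OF w] space_pair_measure)
      then show "emeasure (K w) A = emeasure (\<kappa> (X w)) {y \<in> space F. (X w, y) \<in> A}"
        unfolding K_def by (simp add: emeasure_distr[OF m A])
    qed
    finally show ?thesis .
  qed
  have "N1 = N2"
  proof (rule measure_eqI_generator_eq)
    let ?G = "{a \<times> b |a b. a \<in> sets E \<and> b \<in> sets F}"
    show "Int_stable ?G" by (rule Int_stable_pair_measure_generator)
    show "?G \<subseteq> Pow (space E \<times> space F)" by (rule pair_measure_closed)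
    show "sets N1 = sigma_sets (space E \<times> space F) ?G" "sets N2 = sigma_sets (space E \<times> space F) ?G"
      by (auto simp: N1_def sets_N2 sets_pair_measure)
    show "range (\<lambda>_::nat. space E \<times> space F) \<subseteq> ?G" "(\<Union>i::nat. space E \<times> space F) = space E \<times> space F"
      by auto
    show "emeasure N1 (space E \<times> space F) \<noteq> \<infinity>"
      by (auto simp: N1_def emeasure_distr)
    fix Z assume "Z \<in> ?G"
    then obtain A B where Z: "Z = A \<times> B" and [measurable]: "A \<in> sets E" "B \<in> sets F" by auto
    have "emeasure N1 Z = emeasure M {w \<in> space M. X w \<in> A \<and> Y w \<in> B}"
      unfolding N1_def Z by (subst emeasure_distr) (auto intro!: arg_cong2[of _ _ _ _ emeasure])
    also have "\<dots> = (\<integral>\<^sup>+w. indicator A (X w) * emeasure (\<kappa> (X w)) B \<partial>M)"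
      using rcl by (simp add: reg_cond_law_def)
    also have "\<dots> = emeasure N2 Z"
      unfolding Z using sets.sets_into_space[of B F]
      by (subst em2) (auto intro!: nn_integral_cong arg_cong2[of _ _ _ _ emeasure] simp: indicator_def)
    finally show "emeasure N1 Z = emeasure N2 Z" .
  qed
  then have "emeasure N1 D = (\<integral>\<^sup>+w. emeasure (\<kappa> (X w)) {y \<in> space F. (X w, y) \<in> D} \<partial>M)"
    by (simp add: em2 D)
  moreover have "emeasure N1 D = emeasure M {w \<in> space M. (X w, Y w) \<in> D}"
    unfolding N1_def using D by (subst emeasure_distr) (auto intro!: arg_cong2[of _ _ _ _ emeasure])
  ultimately show ?thesis by simp
qed

text \<open>
  The abstract form of what bi-causality gives. Under \<open>\<nu>\<close> the event \<open>h (X', Y') \<in> B\<close> is independent of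
  \<open>X'\<close> and has probability \<open>c\<close>, so almost all conditional laws \<open>\<kappa>'\<close> give it the mass \<open>c\<close>. The
  conditional laws under \<open>\<pi>\<close> project to \<open>\<kappa>'\<close>, so they give it the same mass; hence under \<open>\<pi>\<close> the event
  is independent even of the finer information \<open>X\<close>.
\<close>

lemma marginal_kernel_transfers_independence:
  assumes \<pi>: "prob_space \<pi>" and rcl: "reg_cond_law \<pi> E X F Y \<kappa>"
    and X [measurable]: "X \<in> \<pi> \<rightarrow>\<^sub>M E" and Y [measurable]: "Y \<in> \<pi> \<rightarrow>\<^sub>M F"
    and \<nu>: "prob_space \<nu>" and rcl': "reg_cond_law \<nu> E' X' F' Y' \<kappa>'"
    and X' [measurable]: "X' \<in> \<nu> \<rightarrow>\<^sub>M E'" and Y' [measurable]: "Y' \<in> \<nu> \<rightarrow>\<^sub>M F'"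
    and p [measurable]: "p \<in> \<pi> \<rightarrow>\<^sub>M \<nu>" and marg: "distr \<pi> \<nu> p = \<nu>"
    and e [measurable]: "e \<in> E \<rightarrow>\<^sub>M E'" and f [measurable]: "f \<in> F \<rightarrow>\<^sub>M F'"
    and X'p: "\<And>w. w \<in> space \<pi> \<Longrightarrow> X' (p w) = e (X w)" and Y'p: "\<And>w. w \<in> space \<pi> \<Longrightarrow> Y' (p w) = f (Y w)"
    and kernels: "AE w in \<pi>. distr (\<kappa> (X w)) F' f = \<kappa>' (X' (p w))"
    and h [measurable]: "h \<in> E' \<Otimes>\<^sub>M F' \<rightarrow>\<^sub>M H" and B [measurable]: "B \<in> sets H"
    and indep: "\<And>D. D \<in> sets E' \<Longrightarrow>
      emeasure \<nu> {w \<in> space \<nu>. X' w \<in> D \<and> h (X' w, Y' w) \<in> B} = emeasure \<nu> {w \<in> space \<nu>. X' w \<in> D} * c"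
    and C [measurable]: "C \<in> sets E"
  shows "emeasure \<pi> {w \<in> space \<pi>. X w \<in> C \<and> h (X' (p w), Y' (p w)) \<in> B} = emeasure \<pi> {w \<in> space \<pi>. X w \<in> C} * c"
proof -
  interpret \<pi>: prob_space \<pi> by fact
  interpret \<nu>: prob_space \<nu> by fact
  have \<kappa>s [measurable]: "\<kappa> \<in> E \<rightarrow>\<^sub>M subprob_algebra F" and \<kappa>s' [measurable]: "\<kappa>' \<in> E' \<rightarrow>\<^sub>M subprob_algebra F'"
    using rcl rcl' by (auto simp: reg_cond_law_def intro: measurable_prob_algebraD)
  define g where "g x = emeasure (\<kappa>' x) {y \<in> space F'. h (x, y) \<in> B}" for x
  have g [measurable]: "g \<in> borel_measurable E'"
    unfolding g_def
  proof (rule emeasure_measurable_subprob_algebra2[OF _ \<kappa>s'])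
    have "{z \<in> space (E' \<Otimes>\<^sub>M F'). h z \<in> B} \<in> sets (E' \<Otimes>\<^sub>M F')" by measurable
    also have "{z \<in> space (E' \<Otimes>\<^sub>M F'). h z \<in> B} = (SIGMA x:space E'. {y \<in> space F'. h (x, y) \<in> B})"
      by (auto simp: space_pair_measure)
    finally show "(SIGMA x:space E'. {y \<in> space F'. h (x, y) \<in> B}) \<in> sets (E' \<Otimes>\<^sub>M F')" .
  qed
  interpret d: prob_space "distr \<nu> E' X'" by (rule \<nu>.prob_space_distr) measurable
  \<comment> \<open>Independence under \<open>\<nu>\<close> says that \<open>g\<close> and \<open>c\<close> integrate equally over every set, so \<open>g = c\<close> almost everywhere.\<close>
  have "density (distr \<nu> E' X') g = density (distr \<nu> E' X') (\<lambda>_. c)"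
  proof (rule measure_eqI)
    fix D assume "D \<in> sets (density (distr \<nu> E' X') g)"
    then have D [measurable]: "D \<in> sets E'" by simp
    have "emeasure (density (distr \<nu> E' X') g) D = (\<integral>\<^sup>+w. g (X' w) * indicator D (X' w) \<partial>\<nu>)"
      by (simp add: emeasure_density nn_integral_distr)
    also have "\<dots> = (\<integral>\<^sup>+w. emeasure (\<kappa>' (X' w)) {y \<in> space F'. (X' w, y) \<in> {z \<in> space (E' \<Otimes>\<^sub>M F'). fst z \<in> D \<and> h z \<in> B}} \<partial>\<nu>)"
      using measurable_space[OF X']
      by (intro nn_integral_cong) (auto simp: g_def indicator_def space_pair_measure intro!: arg_cong2[of _ _ _ _ emeasure])
    also have "\<dots> = emeasure \<nu> {w \<in> space \<nu>. (X' w, Y' w) \<in> {z \<in> space (E' \<Otimes>\<^sub>M F'). fst z \<in> D \<and> h z \<in> B}}"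
      by (rule reg_cond_law_emeasure[symmetric, OF \<nu> rcl' X' Y']) measurable
    also have "\<dots> = emeasure \<nu> {w \<in> space \<nu>. X' w \<in> D \<and> h (X' w, Y' w) \<in> B}"
      using measurable_space[OF X'] measurable_space[OF Y']
      by (intro arg_cong2[of _ _ _ _ emeasure]) (auto simp: space_pair_measure)
    also have "\<dots> = emeasure (distr \<nu> E' X') D * c"
      by (subst indep[OF D], subst emeasure_distr) (auto intro!: arg_cong2[of _ _ _ _ emeasure] arg_cong2[of _ _ _ _ times])
    also have "\<dots> = emeasure (density (distr \<nu> E' X') (\<lambda>_. c)) D"
      by (simp add: emeasure_density nn_integral_cmult_indicator mult.commute)
    finally show "emeasure (density (distr \<nu> E' X') g) D = emeasure (density (distr \<nu> E' X') (\<lambda>_. c)) D" .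
  qed simp
  then have "AE x in distr \<nu> E' X'. g x = c"
    by (rule d.density_unique[rotated 2]) measurable
  then have "AE w in \<nu>. g (X' w) = c"
    by (subst (asm) AE_distr_iff) auto
  then have "AE w in distr \<pi> \<nu> p. g (X' w) = c" by (subst marg)
  then have AEc: "AE w in \<pi>. g (X' (p w)) = c"
    by (subst (asm) AE_distr_iff) auto
  have "emeasure \<pi> {w \<in> space \<pi>. X w \<in> C \<and> h (X' (p w), Y' (p w)) \<in> B} =
      emeasure \<pi> {w \<in> space \<pi>. (X w, Y w) \<in> {z \<in> space (E \<Otimes>\<^sub>M F). fst z \<in> C \<and> h (e (fst z), f (snd z)) \<in> B}}"
    using measurable_space[OF X] measurable_space[OF Y] X'p Y'p
    by (intro arg_cong2[of _ _ _ _ emeasure]) (auto simp: space_pair_measure)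
  also have "\<dots> = (\<integral>\<^sup>+w. emeasure (\<kappa> (X w)) {y \<in> space F. (X w, y) \<in> {z \<in> space (E \<Otimes>\<^sub>M F). fst z \<in> C \<and> h (e (fst z), f (snd z)) \<in> B}} \<partial>\<pi>)"
    by (rule reg_cond_law_emeasure[OF \<pi> rcl X Y]) measurable
  also have "\<dots> = (\<integral>\<^sup>+w. c * indicator C (X w) \<partial>\<pi>)"
  proof (rule nn_integral_cong_AE)
    show "AE w in \<pi>. emeasure (\<kappa> (X w)) {y \<in> space F. (X w, y) \<in> {z \<in> space (E \<Otimes>\<^sub>M F). fst z \<in> C \<and> h (e (fst z), f (snd z)) \<in> B}} = c * indicator C (X w)"
      using AEc kernels AE_space
    proof eventually_elim
      case (elim w)
      have sF: "sets (\<kappa> (X w)) = sets F" "space (\<kappa> (X w)) = space F"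
        using sets_kernel[OF \<kappa>s measurable_space[OF X elim(3)]] by (auto dest: sets_eq_imp_space_eq)
      have Xw: "X w \<in> space E" "e (X w) \<in> space E'" using measurable_space[OF X elim(3)] measurable_space[OF e] by auto
      have fk: "f \<in> \<kappa> (X w) \<rightarrow>\<^sub>M F'" using f measurable_cong_sets[OF sF(1) refl] by blast
      have hm: "(\<lambda>y. h (e (X w), y)) \<in> F' \<rightarrow>\<^sub>M H"
        by (rule measurable_compose[OF measurable_Pair1'[OF Xw(2)] h])
      have Bs: "{y \<in> space F'. h (e (X w), y) \<in> B} \<in> sets F'"
        using measurable_sets[OF hm B] by (simp add: vimage_def Int_def conj_commute)
      have "c = emeasure (distr (\<kappa> (X w)) F' f) {y \<in> space F'. h (e (X w), y) \<in> B}"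
        unfolding elim(2) using elim(1) X'p[OF elim(3)] by (simp add: g_def)
      also have "\<dots> = emeasure (\<kappa> (X w)) {y \<in> space F. h (e (X w), f y) \<in> B}"
        using measurable_space[OF f]
        by (subst emeasure_distr[OF fk Bs]) (auto simp: sF intro!: arg_cong2[of _ _ _ _ emeasure])
      finally show ?case
        using Xw by (auto simp: indicator_def space_pair_measure intro!: arg_cong2[of _ _ _ _ emeasure])
    qed
  qed
  also have "\<dots> = emeasure \<pi> {w \<in> space \<pi>. X w \<in> C} * c"
    by (subst nn_integral_cmult)
      (auto simp: mult.commute nn_integral_indicator[symmetric] simp del: nn_integral_indicator intro!: arg_cong2[of _ _ _ _ times] nn_integral_cong simp: indicator_def)
  finally show ?thesis .
qed

text \<open>
  The innovations \<open>z\<close> of the path \<open>m + C *v z\<close>.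
\<close>

definition whiten :: "'n::{finite,linorder} path \<Rightarrow> 'n mat \<Rightarrow> 'n path \<Rightarrow> 'n path" where
  "whiten m C x = matrix_inv C *v (x - m)"

lemma measurable_whiten [measurable]: "whiten m C \<in> borel_measurable borel"
  unfolding whiten_def[abs_def] by measurable

text \<open>
  The Gaussian law with mean \<open>m\<close> and covariance \<open>C ** transpose C\<close>, given by its representation.
\<close>

definition path_law :: "'n::{finite,linorder} path \<Rightarrow> 'n mat \<Rightarrow> 'n path measure" where
  "path_law m C = distr noise borel (\<lambda>\<omega>. m + C *v innov (\<lambda>_. 1) \<omega>)"

lemma sets_path_law [simp, measurable_cong]: "sets (path_law m C) = sets borel"
  by (simp add: path_law_def)

lemma space_path_law [simp]: "space (path_law m C) = UNIV"
  by (simp add: path_law_def)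

lemma prob_space_path_law: "prob_space (path_law m C)"
  unfolding path_law_def by (rule noise.prob_space_distr) measurable

lemma distr_noise_fst: "distr noise borel (\<lambda>\<omega>. fst (\<omega> t)) = std_normal_distribution"
proof -
  have "distr noise borel (\<lambda>\<omega>. fst (\<omega> t)) = distr (distr noise std_normal_pair (\<lambda>\<omega>. \<omega> t)) borel fst"
    by (subst distr_distr) (auto simp: o_def)
  also have "distr noise std_normal_pair (\<lambda>\<omega>. \<omega> t) = std_normal_pair"
    unfolding noise_def by (rule noise_factors.PiM_component) simp
  also have "distr std_normal_pair borel fst = distr std_normal_pair std_normal_distribution fst"
    by (rule distr_cong) auto
  also have "\<dots> = std_normal_distribution"
    by (rule std_normal.distr_pair_fst)
  finally show ?thesis .
qed

lemma matrix_inv_cancel: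
  fixes C :: "real^'n^'n"
  assumes "invertible C"
  shows "C ** matrix_inv C = mat 1" "matrix_inv C ** C = mat 1"
  using someI_ex[OF assms[unfolded invertible_def]] by (auto simp: matrix_inv_def)

lemma whiten_left_inverse:
  assumes "invertible C"
  shows "whiten m C (m + C *v z) = z"
  using assms by (simp add: whiten_def matrix_vector_mul_assoc matrix_inv_cancel)

lemma emeasure_path_law_past_independent:
  assumes C: "lower_triangular C" "invertible C" and "s < t"
    and D [measurable]: "D \<in> sets (path_space {..s})" and B [measurable]: "B \<in> sets borel"
  shows "emeasure (path_law m C) {x. past s x \<in> D \<and> whiten m C x $ t \<in> B} =
    emeasure (path_law m C) {x. past s x \<in> D} * emeasure std_normal_distribution B"
proof -
  let ?x = "\<lambda>\<omega>. m + C *v innov (\<lambda>_. 1) \<omega>"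
  have "emeasure (path_law m C) {x. past s x \<in> D \<and> whiten m C x $ t \<in> B} =
      (\<integral>\<^sup>+\<omega>. indicator D (past s (?x \<omega>)) * indicator B (fst (\<omega> t)) \<partial>noise)"
  proof -
    have "emeasure (path_law m C) {x. past s x \<in> D \<and> whiten m C x $ t \<in> B} =
      (\<integral>\<^sup>+x. indicator {x. past s x \<in> D \<and> whiten m C x $ t \<in> B} x \<partial>path_law m C)"
    proof (subst nn_integral_indicator)
      have "{x \<in> space borel. past s x \<in> D \<and> whiten m C x $ t \<in> B} \<in> sets borel" by measurable
      then show "{x. past s x \<in> D \<and> whiten m C x $ t \<in> B} \<in> sets (path_law m C)" by simp
    qed simp
    also have "\<dots> = (\<integral>\<^sup>+\<omega>. indicator {x. past s x \<in> D \<and> whiten m C x $ t \<in> B} (?x \<omega>) \<partial>noise)"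
      unfolding path_law_def by (subst nn_integral_distr) auto
    also have "\<dots> = (\<integral>\<^sup>+\<omega>. indicator D (past s (?x \<omega>)) * indicator B (fst (\<omega> t)) \<partial>noise)"
      using C by (intro nn_integral_cong) (auto simp: indicator_def whiten_left_inverse innov_nth)
    finally show ?thesis .
  qed
  also have "\<dots> = (\<integral>\<^sup>+\<omega>. \<integral>\<^sup>+\<omega>'. indicator D (past s (?x \<omega>)) * indicator B (fst (\<omega>' t)) \<partial>noise \<partial>noise)"
    using \<open>s < t\<close> C by (subst nn_integral_noise_resample[where J = "{..s}"])
      (auto simp: innov_override_on past_glue override_on_apply_notin)
  also have "\<dots> = (\<integral>\<^sup>+\<omega>. indicator D (past s (?x \<omega>)) \<partial>noise) * (\<integral>\<^sup>+\<omega>'. indicator B (fst (\<omega>' t)) \<partial>noise)"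
    by (simp add: nn_integral_cmult nn_integral_multc)
  also have "(\<integral>\<^sup>+\<omega>'. indicator B (fst (\<omega>' t)) \<partial>noise) = emeasure std_normal_distribution B"
    unfolding distr_noise_fst[of t, symmetric] by (simp add: nn_integral_distr flip: nn_integral_indicator)
  also have "(\<integral>\<^sup>+\<omega>. indicator D (past s (?x \<omega>)) \<partial>noise) = (\<integral>\<^sup>+x. indicator D (past s x) \<partial>path_law m C)"
    unfolding path_law_def by (subst nn_integral_distr) auto
  also have "\<dots> = emeasure (path_law m C) {x. past s x \<in> D}"
  proof (subst nn_integral_indicator[symmetric])
    have "{x \<in> space borel. past s x \<in> D} \<in> sets borel" by measurable
    then show "{x. past s x \<in> D} \<in> sets (path_law m C)" by simp
  qed (intro nn_integral_cong, auto simp: indicator_def)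
  finally show ?thesis .
qed

text \<open>
  Makes innovations functions of past and future, the form in which conditional laws act on them.
\<close>

definition join :: "'n::{finite,linorder} \<Rightarrow> ('n \<Rightarrow> real) \<times> ('n \<Rightarrow> real) \<Rightarrow> 'n path" where
  "join t z = (\<chi> s. if s \<le> t then fst z s else snd z s)"

lemma join_past_future [simp]: "join t (past t x, future t x) = x"
  by (simp add: join_def past_def future_def vec_eq_iff not_le)

lemma measurable_join [measurable]: "join t \<in> path_space {..t} \<Otimes>\<^sub>M path_space {t<..} \<rightarrow>\<^sub>M borel"
  unfolding join_def[abs_def]
proof (rule borel_measurable_vec_lambda)
  fix s show "(\<lambda>x. if s \<le> t then fst x s else snd x s) \<in> borel_measurable (path_space {..t} \<Otimes>\<^sub>M path_space {t<..})"
    by (cases "s \<le> t") (auto intro: measurable_compose[OF measurable_fst measurable_path_space_component]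
         measurable_compose[OF measurable_snd measurable_path_space_component])
qed

text \<open>
  The map \<open>p\<close> selects one of the two paths and \<open>e\<close>, \<open>f\<close> the corresponding component of a pair of pasts
  and of futures; keeping them as parameters serves both directions of bi-causality.
\<close>

lemma future_innovation_independent:
  fixes \<pi> :: "('n::{finite,linorder} path \<times> 'n path) measure"
  assumes \<pi>: "prob_space \<pi>" "sets \<pi> = sets borel" "cond_pair_law s \<pi> \<kappa>"
    and C: "lower_triangular C" "invertible C" and cpl: "cond_path_law s (path_law m C) \<kappa>'"
    and p: "p \<in> borel \<rightarrow>\<^sub>M borel" "distr \<pi> borel p = path_law m C"
    and e: "e \<in> path_space {..s} \<Otimes>\<^sub>M path_space {..s} \<rightarrow>\<^sub>M path_space {..s}" "\<And>w. past s (p w) = e (map_prod (past s) (past s) w)"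
    and f: "f \<in> path_space {s<..} \<Otimes>\<^sub>M path_space {s<..} \<rightarrow>\<^sub>M path_space {s<..}" "\<And>w. future s (p w) = f (map_prod (future s) (future s) w)"
    and kernels: "AE w in \<pi>. distr (\<kappa> (map_prod (past s) (past s) w)) (path_space {s<..}) f = \<kappa>' (past s (p w))"
    and "s < t" and D: "D \<in> sets (path_space {..s} \<Otimes>\<^sub>M path_space {..s})" and B: "B \<in> sets borel"
  shows "emeasure \<pi> {w. map_prod (past s) (past s) w \<in> D \<and> whiten m C (p w) $ t \<in> B} =
    emeasure \<pi> {w. map_prod (past s) (past s) w \<in> D} * emeasure std_normal_distribution B"
proof -
  have sp: "space \<pi> = UNIV" using sets_eq_imp_space_eq[OF \<pi>(2)] by simp
  have pi_meas: "f \<in> \<pi> \<rightarrow>\<^sub>M N \<longleftrightarrow> f \<in> borel \<Otimes>\<^sub>M borel \<rightarrow>\<^sub>M N" for f and N :: "'z measure"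
    unfolding borel_prod using measurable_cong_sets[OF \<pi>(2) refl] by blast
  have d: "distr \<pi> (path_law m C) p = path_law m C"
    using p(2) by (metis distr_cong sets_path_law)
  have *: "emeasure \<pi> {w \<in> space \<pi>. map_prod (past s) (past s) w \<in> D \<and> (\<lambda>z. whiten m C (join s z) $ t) (past s (p w), future s (p w)) \<in> B} =
    emeasure \<pi> {w \<in> space \<pi>. map_prod (past s) (past s) w \<in> D} * emeasure std_normal_distribution B"
  proof (rule marginal_kernel_transfers_independence[where X = "map_prod (past s) (past s)" and Y = "map_prod (future s) (future s)"
        and X' = "past s" and Y' = "future s" and p = p and e = e and f = f and \<kappa> = \<kappa> and \<kappa>' = \<kappa>' and \<nu> = "path_law m C"])
    show "reg_cond_law \<pi> (path_space {..s} \<Otimes>\<^sub>M path_space {..s}) (map_prod (past s) (past s))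
       (path_space {s<..} \<Otimes>\<^sub>M path_space {s<..}) (map_prod (future s) (future s)) \<kappa>"
      using \<pi>(3) by (simp add: cond_pair_law_def)
    show "reg_cond_law (path_law m C) (path_space {..s}) (past s) (path_space {s<..}) (future s) \<kappa>'"
      using cpl by (simp add: cond_path_law_def)
    show "p \<in> \<pi> \<rightarrow>\<^sub>M path_law m C"
      using p(1) measurable_cong_sets[OF \<pi>(2) sets_path_law[of m C]] by blast
  qed (use \<pi>(1) d e f kernels B D in \<open>simp_all add: pi_meas prob_space_path_law emeasure_path_law_past_independent[OF C \<open>s < t\<close> _ B] cong: measurable_cong_sets\<close>)
  then show ?thesis by (simp add: sp)
qed

text \<open>
  Makes the innovation at time \<open>s\<close> measurable with respect to the past up to \<open>s\<close>: by triangularity the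
  later coordinates may be set to zero.
\<close>

lemma whiten_past:
  assumes "lower_triangular C" "invertible C"
  shows "whiten m C (\<chi> i. if i \<le> s then past s x i else 0) $ s = whiten m C x $ s"
  unfolding whiten_def
proof (rule lower_triangular_determines[OF assms(1) _ order_refl])
  fix j assume "j \<le> s"
  then show "(C *v (matrix_inv C *v ((\<chi> i. if i \<le> s then past s x i else 0) - m))) $ j = (C *v (matrix_inv C *v (x - m))) $ j"
    using assms(2) by (simp add: matrix_vector_mul_assoc matrix_inv_cancel past_def)
qed

lemma measurable_whiten_past:
  "(\<lambda>p. whiten m C (\<chi> i. if i \<le> s then p i else 0) $ s) \<in> borel_measurable (path_space {..s})"
proof -
  have [measurable]: "(\<lambda>p. \<chi> i. if i \<le> s then p i else (0::real)) \<in> borel_measurable (path_space {..s})"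
  proof (rule borel_measurable_vec_lambda)
    fix i show "(\<lambda>p. if i \<le> s then p i else (0::real)) \<in> borel_measurable (path_space {..s})"
      by (cases "i \<le> s") (auto intro: measurable_path_space_component)
  qed
  show ?thesis by measurable
qed

lemma distr_path_law_whiten:
  assumes "invertible C"
  shows "distr (path_law m C) borel (\<lambda>x. whiten m C x $ t) = std_normal_distribution"
  unfolding path_law_def
  by (subst distr_distr) (auto simp: o_def whiten_left_inverse assms innov_nth distr_noise_fst)

text \<open>
  Say \<open>s < t\<close>. Conditioning at time \<open>s\<close>, the innovation of the second path at \<open>t\<close> is independent
  of both pasts up to \<open>s\<close>, and the innovation of the first path at \<open>s\<close> is a function of the first of them.
  The case \<open>t < s\<close> exchanges the two paths.
\<close>

lemma bicausal_innovations_independent: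
  fixes \<pi> :: "('n::{finite,linorder} path \<times> 'n path) measure"
  assumes \<pi>: "\<pi> \<in> Cpl_bc (path_law a L) (path_law b M)"
    and L: "lower_triangular L" "invertible L" and M: "lower_triangular M" "invertible M" and "s \<noteq> t"
  shows "distr \<pi> (borel \<Otimes>\<^sub>M borel) (\<lambda>w. (whiten a L (fst w) $ s, whiten b M (snd w) $ t)) = std_normal_pair"
proof -
  have prob: "prob_space \<pi>" and "sets \<pi> = sets (path_law a L \<Otimes>\<^sub>M path_law b M)"
    and d: "distr \<pi> (path_law a L) fst = path_law a L" "distr \<pi> (path_law b M) snd = path_law b M"
    using \<pi> by (auto simp: Cpl_bc_def Cpl_def)
  then have sets: "sets \<pi> = sets (borel \<Otimes>\<^sub>M borel)" by (simp cong: sets_pair_measure_cong)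
  have sets': "sets \<pi> = sets borel" using sets by (simp only: borel_prod)
  have fs: "fst \<in> borel \<rightarrow>\<^sub>M (borel :: 'n path measure)" "snd \<in> borel \<rightarrow>\<^sub>M (borel :: 'n path measure)"
    by (simp_all add: borel_measurable_continuous_onI continuous_on_fst continuous_on_snd)
  note [measurable_cong] = sets
  have sp: "space \<pi> = UNIV" using sets_eq_imp_space_eq[OF sets] by (simp add: space_pair_measure)
  interpret prob_space \<pi> by fact
  have d': "distr \<pi> borel fst = path_law a L" "distr \<pi> borel snd = path_law b M"
    using d by (metis distr_cong sets_path_law)+
  have marg: "emeasure \<pi> {w. whiten a L (fst w) $ i \<in> A} = emeasure std_normal_distribution A"
    "emeasure \<pi> {w. whiten b M (snd w) $ i \<in> A} = emeasure std_normal_distribution A"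
    if [measurable]: "A \<in> sets borel" for A i
  proof -
    show "emeasure \<pi> {w. whiten a L (fst w) $ i \<in> A} = emeasure std_normal_distribution A"
      unfolding distr_path_law_whiten[OF L(2), of a i, symmetric] d'(1)[symmetric]
      by (subst distr_distr; (subst emeasure_distr)?) (auto simp: sp vimage_def intro!: arg_cong2[of _ _ _ _ emeasure])
    show "emeasure \<pi> {w. whiten b M (snd w) $ i \<in> A} = emeasure std_normal_distribution A"
      unfolding distr_path_law_whiten[OF M(2), of b i, symmetric] d'(2)[symmetric]
      by (subst distr_distr; (subst emeasure_distr)?) (auto simp: sp vimage_def intro!: arg_cong2[of _ _ _ _ emeasure])
  qed
  define W1 where "W1 i p = whiten a L (\<chi> j. if j \<le> i then p j else 0) $ i" for i p
  define W2 where "W2 i p = whiten b M (\<chi> j. if j \<le> i then p j else 0) $ i" for i p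
  have W [measurable]: "W1 i \<in> borel_measurable (path_space {..i})" "W2 i \<in> borel_measurable (path_space {..i})" for i
    unfolding W1_def[abs_def] W2_def[abs_def] by (rule measurable_whiten_past)+
  have W': "W1 i (past i x) = whiten a L x $ i" "W2 i (past i x) = whiten b M x $ i" for i x
    unfolding W1_def W2_def using L M by (auto simp: whiten_past)
  have bc: "\<exists>\<kappa>1 \<kappa>2 \<kappa>. cond_path_law i (path_law a L) \<kappa>1 \<and> cond_path_law i (path_law b M) \<kappa>2 \<and> cond_pair_law i \<pi> \<kappa> \<and>
     (AE w in \<pi>. distr (\<kappa> (map_prod (past i) (past i) w)) (path_space {i<..}) fst = \<kappa>1 (past i (fst w))) \<and>
     (AE w in \<pi>. distr (\<kappa> (map_prod (past i) (past i) w)) (path_space {i<..}) snd = \<kappa>2 (past i (snd w)))"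
    if "i < j" for i j
  proof -
    obtain \<kappa>1 \<kappa>2 \<kappa> where k: "cond_path_law i (path_law a L) \<kappa>1" "cond_path_law i (path_law b M) \<kappa>2" "cond_pair_law i \<pi> \<kappa>"
      and c: "AE (x, y) in \<pi>. \<kappa> (past i x, past i y) \<in> Cpl (\<kappa>1 (past i x)) (\<kappa>2 (past i y))"
      using \<pi> \<open>i < j\<close> unfolding Cpl_bc_def by blast
    have sk: "sets (\<kappa>1 (past i x)) = sets (path_space {i<..})" "sets (\<kappa>2 (past i x)) = sets (path_space {i<..})" for x
    proof -
      have past: "past i x \<in> space (path_space {..i})" using measurable_space[OF measurable_past] by auto
      have "\<kappa>1 \<in> path_space {..i} \<rightarrow>\<^sub>M subprob_algebra (path_space {i<..})"
        using k(1) by (auto simp: cond_path_law_def reg_cond_law_def intro: measurable_prob_algebraD)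
      from sets_kernel[OF this past] show "sets (\<kappa>1 (past i x)) = sets (path_space {i<..})" .
      have "\<kappa>2 \<in> path_space {..i} \<rightarrow>\<^sub>M subprob_algebra (path_space {i<..})"
        using k(2) by (auto simp: cond_path_law_def reg_cond_law_def intro: measurable_prob_algebraD)
      from sets_kernel[OF this past] show "sets (\<kappa>2 (past i x)) = sets (path_space {i<..})" .
    qed
    have "AE w in \<pi>. distr (\<kappa> (map_prod (past i) (past i) w)) (path_space {i<..}) fst = \<kappa>1 (past i (fst w)) \<and>
      distr (\<kappa> (map_prod (past i) (past i) w)) (path_space {i<..}) snd = \<kappa>2 (past i (snd w))"
      using c
    proof eventually_elim
      case (elim w)
      obtain x y where w: "w = (x, y)" by (cases w)
      have "distr (\<kappa> (past i x, past i y)) (path_space {i<..}) fst = distr (\<kappa> (past i x, past i y)) (\<kappa>1 (past i x)) fst"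
        "distr (\<kappa> (past i x, past i y)) (path_space {i<..}) snd = distr (\<kappa> (past i x, past i y)) (\<kappa>2 (past i y)) snd"
        by (rule distr_cong; simp add: sk)+
      then show ?case using elim by (simp add: w Cpl_def)
    qed
    then show ?thesis using k by auto
  qed
  show ?thesis
  proof (rule pair_measure_eqI[symmetric])
    fix A B assume "A \<in> sets std_normal_distribution" "B \<in> sets std_normal_distribution"
    then have [measurable]: "A \<in> sets borel" "B \<in> sets borel" by auto
    have "emeasure \<pi> {w. whiten a L (fst w) $ s \<in> A \<and> whiten b M (snd w) $ t \<in> B} =
      emeasure std_normal_distribution A * emeasure std_normal_distribution B"
    proof (cases "s < t")
      case True
      from bc[OF True] obtain \<kappa>1 \<kappa>2 \<kappa> where k: "cond_path_law s (path_law b M) \<kappa>2" "cond_pair_law s \<pi> \<kappa>"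
        "AE w in \<pi>. distr (\<kappa> (map_prod (past s) (past s) w)) (path_space {s<..}) snd = \<kappa>2 (past s (snd w))" by blast
      let ?D = "{z \<in> space (path_space {..s} \<Otimes>\<^sub>M path_space {..s}). W1 s (fst z) \<in> A}"
      have in_D: "map_prod (past s) (past s) w \<in> ?D \<longleftrightarrow> whiten a L (fst w) $ s \<in> A" for w
        using measurable_space[OF measurable_past, of _ s] by (cases w) (auto simp: W' space_pair_measure)
      have "emeasure \<pi> {w. map_prod (past s) (past s) w \<in> ?D \<and> whiten b M (snd w) $ t \<in> B} =
          emeasure \<pi> {w. map_prod (past s) (past s) w \<in> ?D} * emeasure std_normal_distribution B"
        by (rule future_innovation_independent[OF prob sets' k(2) M k(1) fs(2) d'(2) measurable_snd _ measurable_snd _ k(3) True])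
          (simp, simp, measurable)
      then show ?thesis unfolding in_D by (simp add: marg)
    next
      case False
      with \<open>s \<noteq> t\<close> have "t < s" by auto
      from bc[OF this] obtain \<kappa>1 \<kappa>2 \<kappa> where k: "cond_path_law t (path_law a L) \<kappa>1" "cond_pair_law t \<pi> \<kappa>"
        "AE w in \<pi>. distr (\<kappa> (map_prod (past t) (past t) w)) (path_space {t<..}) fst = \<kappa>1 (past t (fst w))" by blast
      let ?D = "{z \<in> space (path_space {..t} \<Otimes>\<^sub>M path_space {..t}). W2 t (snd z) \<in> B}"
      have in_D: "map_prod (past t) (past t) w \<in> ?D \<longleftrightarrow> whiten b M (snd w) $ t \<in> B" for w
        using measurable_space[OF measurable_past, of _ t] by (cases w) (auto simp: W' space_pair_measure)
      have "emeasure \<pi> {w. map_prod (past t) (past t) w \<in> ?D \<and> whiten a L (fst w) $ s \<in> A} =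
          emeasure \<pi> {w. map_prod (past t) (past t) w \<in> ?D} * emeasure std_normal_distribution A"
        by (rule future_innovation_independent[OF prob sets' k(2) L k(1) fs(1) d'(1) measurable_fst _ measurable_fst _ k(3) \<open>t < s\<close>])
          (simp, simp, measurable)
      then show ?thesis unfolding in_D by (simp add: marg conj_commute mult.commute)
    qed
    moreover have "emeasure (distr \<pi> (borel \<Otimes>\<^sub>M borel) (\<lambda>w. (whiten a L (fst w) $ s, whiten b M (snd w) $ t))) (A \<times> B) =
       emeasure \<pi> {w. whiten a L (fst w) $ s \<in> A \<and> whiten b M (snd w) $ t \<in> B}"
      by (subst emeasure_distr) (auto simp: sp intro!: arg_cong2[of _ _ _ _ emeasure])
    ultimately show "emeasure std_normal_distribution A * emeasure std_normal_distribution B =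
      emeasure (distr \<pi> (borel \<Otimes>\<^sub>M borel) (\<lambda>w. (whiten a L (fst w) $ s, whiten b M (snd w) $ t))) (A \<times> B)"
      by simp
  qed (auto simp: sets_std_normal_pair intro: std_normal.sigma_finite_measure_axioms)
qed

section \<open>Moments\<close>

lemma integrable_std_normal: "integrable std_normal_distribution (\<lambda>x. x)" "integrable std_normal_distribution (\<lambda>x. x\<^sup>2)"
  using integrable_std_normal_distribution_moment[of 1] integrable_std_normal_distribution_moment[of 2] by auto

lemma integral_std_normal: "(\<integral>x. x \<partial>std_normal_distribution) = 0" "(\<integral>x. x\<^sup>2 \<partial>std_normal_distribution) = 1"
  using integral_std_normal_distribution_moment_odd[of 1] std_normal_distribution_even_moments(1)[of 1] by (auto simp: fact_numeral)

lemma abs_mult_le_sum_squares: "\<bar>x * y\<bar> \<le> x\<^sup>2 + (y::real)\<^sup>2"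
proof -
  have "2 * \<bar>x * y\<bar> \<le> x\<^sup>2 + y\<^sup>2" using sum_squares_bound[of "\<bar>x\<bar>" "\<bar>y\<bar>"] by (simp add: abs_mult)
  then show ?thesis by linarith
qed

lemma std_normal_pair_moments:
  "integrable std_normal_pair (\<lambda>z. (fst z)\<^sup>2)" "(\<integral>z. (fst z)\<^sup>2 \<partial>std_normal_pair) = 1"
  "integrable std_normal_pair (\<lambda>z. (snd z)\<^sup>2)"
  "integrable std_normal_pair (\<lambda>z. fst z * snd z)" "(\<integral>z. fst z * snd z \<partial>std_normal_pair) = 0"
proof -
  have f: "distr std_normal_pair std_normal_distribution fst = std_normal_distribution" by (rule std_normal.distr_pair_fst)
  show 1: "integrable std_normal_pair (\<lambda>z. (fst z)\<^sup>2)"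
    using integrable_std_normal(2) by (subst (asm) f[symmetric], subst (asm) integrable_distr_eq) auto
  show "(\<integral>z. (fst z)\<^sup>2 \<partial>std_normal_pair) = 1"
    using integral_std_normal(2) by (subst (asm) f[symmetric], subst (asm) integral_distr) auto
  have "integrable std_normal_pair (\<lambda>(x, y). (\<lambda>z. (fst z)\<^sup>2) (y, x))"
    by (rule std_normal_pair.integrable_product_swap[OF 1])
  then show 2: "integrable std_normal_pair (\<lambda>z. (snd z)\<^sup>2)" by (simp add: case_prod_beta')
  show 3: "integrable std_normal_pair (\<lambda>z. fst z * snd z)"
    by (rule Bochner_Integration.integrable_bound[OF Bochner_Integration.integrable_add[OF 1 2]]) (auto simp: abs_mult_le_sum_squares)
  show "(\<integral>z. fst z * snd z \<partial>std_normal_pair) = 0"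
    by (subst std_normal_pair.integral_fst'[OF 3, symmetric]) (simp add: integral_std_normal)
qed

lemma distr_noise_component: "distr noise std_normal_pair (\<lambda>\<omega>. \<omega> t) = std_normal_pair"
  unfolding noise_def by (rule noise_factors.PiM_component) simp

text \<open>
  The characteristic function identifies the law of \<open>u \<bullet> x\<close> as that of \<open>u \<bullet> m + \<sigma> z\<close> with \<open>z\<close> standard
  normal and \<open>\<sigma>\<^sup>2 = u \<bullet> S u\<close>, which also covers the degenerate case \<open>\<sigma> = 0\<close>.
\<close>

lemma gaussian_law_variance:
  fixes m :: "'a::euclidean_space"
  assumes g: "gaussian_law \<pi> m S"
  shows "integrable \<pi> (\<lambda>x. u \<bullet> x)" "(\<integral>x. u \<bullet> x \<partial>\<pi>) = u \<bullet> m"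
    "integrable \<pi> (\<lambda>x. (u \<bullet> (x - m))\<^sup>2)" "(\<integral>x. (u \<bullet> (x - m))\<^sup>2 \<partial>\<pi>) = u \<bullet> S u"
proof -
  from g have [measurable_cong]: "sets \<pi> = sets borel" and p: "prob_space \<pi>" and lin: "linear S"
    and ch: "\<And>v. (CLINT x|\<pi>. iexp (v \<bullet> x)) = exp (\<i> * complex_of_real (v \<bullet> m) - complex_of_real (v \<bullet> S v) / 2)"
    by (auto simp: gaussian_law_def)
  interpret prob_space \<pi> by fact
  define q where "q = u \<bullet> S u"
  interpret d: real_distribution "distr \<pi> borel (\<lambda>x. u \<bullet> x)"
    by (rule real_distribution_distr) measurable
  have char1: "char (distr \<pi> borel (\<lambda>x. u \<bullet> x)) s = exp (\<i> * complex_of_real (s * (u \<bullet> m)) - complex_of_real (s\<^sup>2 * q) / 2)" for s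
  proof -
    have "char (distr \<pi> borel (\<lambda>x. u \<bullet> x)) s = (CLINT x|\<pi>. iexp ((s *\<^sub>R u) \<bullet> x))"
      unfolding char_def by (subst integral_distr) auto
    then show ?thesis
      unfolding ch by (simp add: q_def linear_scale[OF lin] power2_eq_square mult_ac)
  qed
  \<comment> \<open>A characteristic function is bounded by \<open>1\<close>; this is where positive semidefiniteness of \<open>S\<close> comes from.\<close>
  have "norm (exp (\<i> * complex_of_real (u \<bullet> m) - complex_of_real q / 2)) \<le> 1"
    using d.cmod_char_le_1[of 1] char1[of 1] by simp
  then have q: "q \<ge> 0" by (simp add: norm_exp_eq_Re)
  define \<sigma> where "\<sigma> = sqrt q"
  have q': "q = \<sigma>\<^sup>2" using q by (simp add: \<sigma>_def)
  have char2: "char (distr std_normal_distribution borel (\<lambda>z. u \<bullet> m + \<sigma> * z)) s = exp (\<i> * complex_of_real (s * (u \<bullet> m)) - complex_of_real (s\<^sup>2 * q) / 2)" for s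
  proof -
    have "char (distr std_normal_distribution borel (\<lambda>z. u \<bullet> m + \<sigma> * z)) s = (CLINT z|std_normal_distribution. iexp (s * (u \<bullet> m)) * iexp ((s * \<sigma>) * z))"
      unfolding char_def by (subst integral_distr) (auto simp only: of_real_add ring_distribs exp_add mult.assoc, measurable)
    also have "\<dots> = iexp (s * (u \<bullet> m)) * char std_normal_distribution (s * \<sigma>)"
      by (simp only: integral_mult_right_zero char_def)
    also have "\<dots> = exp (\<i> * complex_of_real (s * (u \<bullet> m)) - complex_of_real (s\<^sup>2 * q) / 2)"
      unfolding char_std_normal_distribution q'
      by (simp only: exp_of_real[symmetric] exp_add[symmetric] of_real_minus of_real_divide of_real_numeral
        diff_conv_add_uminus minus_divide_left power_mult_distrib)
    finally show ?thesis .
  qed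
  have eq: "distr \<pi> borel (\<lambda>x. u \<bullet> x) = distr std_normal_distribution borel (\<lambda>z. u \<bullet> m + \<sigma> * z)"
    using char1 char2 d.real_distribution_axioms
    by (intro Levy_uniqueness std_normal.real_distribution_distr) auto
  have "integrable std_normal_distribution (\<lambda>z. u \<bullet> m + \<sigma> * z)"
    by (intro Bochner_Integration.integrable_add integrable_mult_right impI integrable_std_normal) auto
  then have "integrable (distr std_normal_distribution borel (\<lambda>z. u \<bullet> m + \<sigma> * z)) (\<lambda>x. x)"
    by (subst integrable_distr_eq) auto
  then show "integrable \<pi> (\<lambda>x. u \<bullet> x)"
    unfolding eq[symmetric] by (subst (asm) integrable_distr_eq) auto
  have "(\<integral>x. u \<bullet> x \<partial>\<pi>) = (\<integral>x. x \<partial>distr \<pi> borel (\<lambda>x. u \<bullet> x))" by (subst integral_distr) auto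
  also have "\<dots> = (\<integral>z. u \<bullet> m + \<sigma> * z \<partial>std_normal_distribution)"
    unfolding eq by (subst integral_distr) auto
  also have "\<dots> = u \<bullet> m"
    by (subst Bochner_Integration.integral_add) (auto simp: integrable_std_normal integral_std_normal std_normal.prob_space[simplified])
  finally show "(\<integral>x. u \<bullet> x \<partial>\<pi>) = u \<bullet> m" .
  have "integrable std_normal_distribution (\<lambda>z. \<sigma>\<^sup>2 * z\<^sup>2)"
    by (intro integrable_mult_right impI integrable_std_normal)
  then have "integrable (distr std_normal_distribution borel (\<lambda>z. u \<bullet> m + \<sigma> * z)) (\<lambda>x. (x - u \<bullet> m)\<^sup>2)"
    by (subst integrable_distr_eq) (auto simp: power_mult_distrib)
  then show "integrable \<pi> (\<lambda>x. (u \<bullet> (x - m))\<^sup>2)"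
    unfolding eq[symmetric] by (subst (asm) integrable_distr_eq) (auto simp: inner_diff_right)
  have "(\<integral>x. (u \<bullet> (x - m))\<^sup>2 \<partial>\<pi>) = (\<integral>x. (x - u \<bullet> m)\<^sup>2 \<partial>distr \<pi> borel (\<lambda>x. u \<bullet> x))"
    by (subst integral_distr) (auto simp: inner_diff_right)
  also have "\<dots> = (\<integral>z. \<sigma>\<^sup>2 * z\<^sup>2 \<partial>std_normal_distribution)"
    unfolding eq by (subst integral_distr) (auto simp: power_mult_distrib)
  also have "\<dots> = u \<bullet> S u" by (simp add: integral_std_normal q'[symmetric] q_def)
  finally show "(\<integral>x. (u \<bullet> (x - m))\<^sup>2 \<partial>\<pi>) = u \<bullet> S u" .
qed

section \<open>The transport cost of a bi-causal coupling\<close>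

locale gaussian_pair =
  fixes a b :: "'n::{finite,linorder} path" and L M :: "'n mat"
  assumes L: "lower_triangular L" "invertible L" and M: "lower_triangular M" "invertible M"
begin

abbreviation "\<mu> \<equiv> path_law a L"
abbreviation "\<nu> \<equiv> path_law b M"
abbreviation "\<xi> w t \<equiv> whiten a L (fst w) $ t"
abbreviation "\<eta> w t \<equiv> whiten b M (snd w) $ t"

definition corr :: "('n path \<times> 'n path) measure \<Rightarrow> 'n \<Rightarrow> real" where
  "corr \<pi> t = (\<integral>w. \<xi> w t * \<eta> w t \<partial>\<pi>)"

text \<open>
  The part of the cost that is common to all couplings, in the splitting
  \<open>\<bar>x - y\<bar>\<^sup>2 = \<bar>x - b\<bar>\<^sup>2 + \<bar>y - a\<bar>\<^sup>2 - \<bar>a - b\<bar>\<^sup>2 - 2 (x - a) \<bullet> (y - b)\<close>.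
\<close>

definition base_cost :: real where
  "base_cost = (\<integral>x. (norm (x - b))\<^sup>2 \<partial>\<mu>) + (\<integral>y. (norm (y - a))\<^sup>2 \<partial>\<nu>) - (norm (a - b))\<^sup>2"

lemma cpl_facts:
  assumes "\<pi> \<in> Cpl \<mu> \<nu>"
  shows "prob_space \<pi>" "sets \<pi> = sets (borel \<Otimes>\<^sub>M borel)" "sets \<pi> = sets borel" "space \<pi> = UNIV"
    "distr \<pi> borel fst = \<mu>" "distr \<pi> borel snd = \<nu>"
proof -
  show "prob_space \<pi>" using assms by (simp add: Cpl_def)
  show s: "sets \<pi> = sets (borel \<Otimes>\<^sub>M borel)" using assms by (simp add: Cpl_def cong: sets_pair_measure_cong)
  then show "sets \<pi> = sets borel" by (simp only: borel_prod)
  show "space \<pi> = UNIV" using sets_eq_imp_space_eq[OF s] by (simp add: space_pair_measure)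
  have "distr \<pi> \<mu> fst = \<mu>" "distr \<pi> \<nu> snd = \<nu>" using assms by (auto simp: Cpl_def)
  then show "distr \<pi> borel fst = \<mu>" "distr \<pi> borel snd = \<nu>"
    by (metis distr_cong sets_path_law)+
qed

lemma marginal_integrals:
  fixes f :: "'n path \<Rightarrow> real"
  assumes \<pi>: "\<pi> \<in> Cpl \<mu> \<nu>" and [measurable]: "f \<in> borel_measurable borel"
  shows "integrable \<pi> (\<lambda>w. f (fst w)) \<longleftrightarrow> integrable \<mu> f" "(\<integral>w. f (fst w) \<partial>\<pi>) = (\<integral>x. f x \<partial>\<mu>)"
    "integrable \<pi> (\<lambda>w. f (snd w)) \<longleftrightarrow> integrable \<nu> f" "(\<integral>w. f (snd w) \<partial>\<pi>) = (\<integral>x. f x \<partial>\<nu>)"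
proof -
  note c = cpl_facts[OF \<pi>]
  note [measurable_cong] = c(2)
  show "integrable \<pi> (\<lambda>w. f (fst w)) \<longleftrightarrow> integrable \<mu> f" "(\<integral>w. f (fst w) \<partial>\<pi>) = (\<integral>x. f x \<partial>\<mu>)"
    unfolding c(5)[symmetric] by (subst integrable_distr_eq integral_distr; simp)+
  show "integrable \<pi> (\<lambda>w. f (snd w)) \<longleftrightarrow> integrable \<nu> f" "(\<integral>w. f (snd w) \<partial>\<pi>) = (\<integral>x. f x \<partial>\<nu>)"
    unfolding c(6)[symmetric] by (subst integrable_distr_eq integral_distr; simp)+
qed

lemma path_law_whiten_moments:
  assumes "invertible C"
  shows "integrable (path_law m C) (\<lambda>x. (whiten m C x $ t)\<^sup>2)" "(\<integral>x. (whiten m C x $ t)\<^sup>2 \<partial>path_law m C) = 1"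
proof -
  note e = distr_path_law_whiten[OF assms, of m t, symmetric]
  show "integrable (path_law m C) (\<lambda>x. (whiten m C x $ t)\<^sup>2)"
    using integrable_std_normal(2) by (subst (asm) e, subst (asm) integrable_distr_eq) auto
  show "(\<integral>x. (whiten m C x $ t)\<^sup>2 \<partial>path_law m C) = 1"
    using integral_std_normal(2) by (subst (asm) e, subst (asm) integral_distr) auto
qed

lemma innovation_moments:
  assumes \<pi>: "\<pi> \<in> Cpl \<mu> \<nu>"
  shows "integrable \<pi> (\<lambda>w. (\<xi> w t)\<^sup>2)" "(\<integral>w. (\<xi> w t)\<^sup>2 \<partial>\<pi>) = 1"
    "integrable \<pi> (\<lambda>w. (\<eta> w t)\<^sup>2)" "(\<integral>w. (\<eta> w t)\<^sup>2 \<partial>\<pi>) = 1"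
    "integrable \<pi> (\<lambda>w. \<xi> w s * \<eta> w t)"
proof -
  note c = cpl_facts[OF \<pi>]
  note [measurable_cong] = c(2)
  have 1: "integrable \<pi> (\<lambda>w. (\<xi> w t)\<^sup>2) \<and> (\<integral>w. (\<xi> w t)\<^sup>2 \<partial>\<pi>) = 1" for t
    using path_law_whiten_moments[OF L(2), of a t] by (simp add: marginal_integrals[OF \<pi>, of "\<lambda>x. (whiten a L x $ t)\<^sup>2"])
  have 2: "integrable \<pi> (\<lambda>w. (\<eta> w t)\<^sup>2) \<and> (\<integral>w. (\<eta> w t)\<^sup>2 \<partial>\<pi>) = 1" for t
    using path_law_whiten_moments[OF M(2), of b t] by (simp add: marginal_integrals[OF \<pi>, of "\<lambda>x. (whiten b M x $ t)\<^sup>2"])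
  show "integrable \<pi> (\<lambda>w. (\<xi> w t)\<^sup>2)" "(\<integral>w. (\<xi> w t)\<^sup>2 \<partial>\<pi>) = 1"
    "integrable \<pi> (\<lambda>w. (\<eta> w t)\<^sup>2)" "(\<integral>w. (\<eta> w t)\<^sup>2 \<partial>\<pi>) = 1" using 1 2 by auto
  show "integrable \<pi> (\<lambda>w. \<xi> w s * \<eta> w t)"
    by (rule Bochner_Integration.integrable_bound[OF Bochner_Integration.integrable_add[of \<pi> "\<lambda>w. (\<xi> w s)\<^sup>2" "\<lambda>w. (\<eta> w t)\<^sup>2"]])
       (use 1 2 in \<open>auto simp: abs_mult_le_sum_squares\<close>)
qed

text \<open>
  Used with \<open>c = 1\<close> and \<open>c = -1\<close> to bound the correlation, and with \<open>c = corr \<pi> t\<close> when that is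
  \<open>1\<close> or \<open>-1\<close>, where the integral vanishes.
\<close>

lemma integral_innovation_square:
  assumes \<pi>: "\<pi> \<in> Cpl \<mu> \<nu>"
  shows "integrable \<pi> (\<lambda>w. (\<eta> w t - c * \<xi> w t)\<^sup>2)" "(\<integral>w. (\<eta> w t - c * \<xi> w t)\<^sup>2 \<partial>\<pi>) = 1 - 2 * c * corr \<pi> t + c\<^sup>2"
proof -
  note i = innovation_moments[OF \<pi>]
  have e: "(\<eta> w t - c * \<xi> w t)\<^sup>2 = (\<eta> w t)\<^sup>2 + ((- 2 * c) * (\<xi> w t * \<eta> w t) + c\<^sup>2 * (\<xi> w t)\<^sup>2)" for w
    by (simp add: power2_eq_square algebra_simps)
  show "integrable \<pi> (\<lambda>w. (\<eta> w t - c * \<xi> w t)\<^sup>2)"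
    unfolding e by (intro Bochner_Integration.integrable_add integrable_mult_right i)
  show "(\<integral>w. (\<eta> w t - c * \<xi> w t)\<^sup>2 \<partial>\<pi>) = 1 - 2 * c * corr \<pi> t + c\<^sup>2"
    unfolding e corr_def
    by (subst Bochner_Integration.integral_add, intro i, intro Bochner_Integration.integrable_add integrable_mult_right i,
       subst Bochner_Integration.integral_add, intro integrable_mult_right i, intro integrable_mult_right i)
       (simp add: i)
qed

lemma abs_corr_le_1:
  assumes \<pi>: "\<pi> \<in> Cpl \<mu> \<nu>"
  shows "\<bar>corr \<pi> t\<bar> \<le> 1"
proof -
  have "0 \<le> (\<integral>w. (\<eta> w t - c * \<xi> w t)\<^sup>2 \<partial>\<pi>)" for c by (rule Bochner_Integration.integral_nonneg) simp
  from this[of 1] this[of "-1"] show ?thesis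
    unfolding integral_innovation_square[OF \<pi>] by (simp add: abs_le_iff)
qed

lemma bicausal_uncorrelated:
  assumes \<pi>: "\<pi> \<in> Cpl_bc \<mu> \<nu>" and "s \<noteq> t"
  shows "(\<integral>w. \<xi> w s * \<eta> w t \<partial>\<pi>) = 0"
proof -
  have "\<pi> \<in> Cpl \<mu> \<nu>" using \<pi> by (simp add: Cpl_bc_def)
  note [measurable_cong] = cpl_facts(2)[OF this]
  have "(\<integral>w. \<xi> w s * \<eta> w t \<partial>\<pi>) = (\<integral>z. fst z * snd z \<partial>distr \<pi> (borel \<Otimes>\<^sub>M borel) (\<lambda>w. (\<xi> w s, \<eta> w t)))"
    by (subst integral_distr) auto
  also have "\<dots> = 0"
    unfolding bicausal_innovations_independent[OF \<pi> L M \<open>s \<noteq> t\<close>] by (rule std_normal_pair_moments)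
  finally show ?thesis .
qed

lemma unwhiten: "invertible C \<Longrightarrow> C *v whiten m C x = x - m" for C :: "'n mat"
  by (simp add: whiten_def matrix_vector_mul_assoc matrix_inv_cancel)

lemma integrable_norm_square:
  fixes C :: "'n mat"
  assumes "invertible C"
  shows "integrable (path_law m C) (\<lambda>x. (norm (x - c))\<^sup>2)"
proof -
  interpret prob_space "path_law m C" by (rule prob_space_path_law)
  define k where "k = onorm ((*v) C)"
  have "integrable (path_law m C) (\<lambda>x. 2 * (norm (m - c))\<^sup>2 + 2 * k\<^sup>2 * (\<Sum>t\<in>UNIV. (whiten m C x $ t)\<^sup>2))"
    by (intro Bochner_Integration.integrable_add integrable_mult_right Bochner_Integration.integrable_sum path_law_whiten_moments assms) auto
  then show ?thesis
  proof (rule Bochner_Integration.integrable_bound)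
    show "AE x in path_law m C. norm ((norm (x - c))\<^sup>2) \<le> norm (2 * (norm (m - c))\<^sup>2 + 2 * k\<^sup>2 * (\<Sum>t\<in>UNIV. (whiten m C x $ t)\<^sup>2))"
    proof (intro AE_I2)
      fix x
      have "norm (x - c) \<le> norm (m - c) + norm (C *v whiten m C x)"
        using norm_triangle_ineq[of "m - c" "x - m"] by (simp add: unwhiten[OF assms])
      also have "norm (C *v whiten m C x) \<le> k * norm (whiten m C x)"
        unfolding k_def by (rule onorm) (rule matrix_vector_mul_bounded_linear)
      finally have "(norm (x - c))\<^sup>2 \<le> (norm (m - c) + k * norm (whiten m C x))\<^sup>2"
        by (intro power_mono) auto
      also have "\<dots> \<le> 2 * (norm (m - c))\<^sup>2 + 2 * (k * norm (whiten m C x))\<^sup>2"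
        using sum_squares_bound[of "norm (m - c)" "k * norm (whiten m C x)"] by (simp add: power2_sum)
      also have "(norm (whiten m C x))\<^sup>2 = (\<Sum>t\<in>UNIV. (whiten m C x $ t)\<^sup>2)"
        unfolding power2_norm_eq_inner inner_vec_def by (simp add: power2_eq_square)
      then have "(k * norm (whiten m C x))\<^sup>2 = k\<^sup>2 * (\<Sum>t\<in>UNIV. (whiten m C x $ t)\<^sup>2)" by (simp add: power_mult_distrib)
      finally show "norm ((norm (x - c))\<^sup>2) \<le> norm (2 * (norm (m - c))\<^sup>2 + 2 * k\<^sup>2 * (\<Sum>t\<in>UNIV. (whiten m C x $ t)\<^sup>2))"
        by simp
    qed
  qed measurable
qed

lemma inner_unwhiten:
  "(x - a) \<bullet> (y - b) = (\<Sum>t\<in>UNIV. \<Sum>s\<in>UNIV. (transpose M ** L) $ t $ s * (whiten a L x $ s * whiten b M y $ t))"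
proof -
  have "(x - a) \<bullet> (y - b) = (M *v whiten b M y) \<bullet> (L *v whiten a L x)"
    by (simp only: unwhiten[OF L(2)] unwhiten[OF M(2)] inner_commute)
  also have "\<dots> = whiten b M y \<bullet> ((transpose M ** L) *v whiten a L x)"
    by (metis inner_commute inner_matrix_vector_mult matrix_vector_mul_assoc transpose_matrix_vector)
  finally show ?thesis
    by (simp add: inner_vec_def matrix_vector_mult_def sum_distrib_left mult_ac)
qed

text \<open>
  In terms of innovations \<open>(x - a) \<bullet> (y - b)\<close> is a bilinear form with matrix \<open>transpose M ** L\<close>. Its
  off-diagonal terms have expectation zero by bi-causality, so only the diagonal \<open>N\<close> contributes.
\<close>

lemma transport_cost:
  assumes \<pi>: "\<pi> \<in> Cpl_bc \<mu> \<nu>"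
  shows "(\<integral>\<^sup>+(x, y). ennreal ((norm (x - y))\<^sup>2) \<partial>\<pi>) = ennreal (base_cost - 2 * (\<Sum>t\<in>UNIV. N_mat L M $ t $ t * corr \<pi> t))"
    and "0 \<le> base_cost - 2 * (\<Sum>t\<in>UNIV. N_mat L M $ t $ t * corr \<pi> t)"
proof -
  have c: "\<pi> \<in> Cpl \<mu> \<nu>" using \<pi> by (simp add: Cpl_bc_def)
  interpret prob_space \<pi> by (rule cpl_facts[OF c])
  have i1: "integrable \<pi> (\<lambda>w. (norm (fst w - b))\<^sup>2)" "integrable \<pi> (\<lambda>w. (norm (snd w - a))\<^sup>2)"
    using integrable_norm_square[OF L(2)] integrable_norm_square[OF M(2)]
    by (simp_all add: marginal_integrals[OF c, of "\<lambda>x. (norm (x - _))\<^sup>2"])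
  have int1: "(\<integral>w. (norm (fst w - b))\<^sup>2 \<partial>\<pi>) = (\<integral>x. (norm (x - b))\<^sup>2 \<partial>\<mu>)" "(\<integral>w. (norm (snd w - a))\<^sup>2 \<partial>\<pi>) = (\<integral>x. (norm (x - a))\<^sup>2 \<partial>\<nu>)"
    by (simp_all add: marginal_integrals[OF c, of "\<lambda>x. (norm (x - _))\<^sup>2"])
  have i2: "integrable \<pi> (\<lambda>w. (fst w - a) \<bullet> (snd w - b))"
    unfolding inner_unwhiten
    by (intro Bochner_Integration.integrable_sum integrable_mult_right innovation_moments[OF c])
  have int2: "(\<integral>w. (fst w - a) \<bullet> (snd w - b) \<partial>\<pi>) = (\<Sum>t\<in>UNIV. N_mat L M $ t $ t * corr \<pi> t)"
  proof -
    have "(\<integral>w. (fst w - a) \<bullet> (snd w - b) \<partial>\<pi>) = (\<Sum>t\<in>UNIV. \<Sum>s\<in>UNIV. (transpose M ** L) $ t $ s * (\<integral>w. \<xi> w s * \<eta> w t \<partial>\<pi>))"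
      unfolding inner_unwhiten
      by (subst Bochner_Integration.integral_sum, intro Bochner_Integration.integrable_sum integrable_mult_right innovation_moments[OF c],
         subst Bochner_Integration.integral_sum, intro integrable_mult_right innovation_moments[OF c]) simp
    also have "\<dots> = (\<Sum>t\<in>UNIV. (transpose M ** L) $ t $ t * (\<integral>w. \<xi> w t * \<eta> w t \<partial>\<pi>))"
    proof (intro sum.cong refl)
      fix t :: 'n
      have "(\<Sum>s\<in>UNIV. (transpose M ** L) $ t $ s * (\<integral>w. \<xi> w s * \<eta> w t \<partial>\<pi>)) = (\<Sum>s\<in>{t}. (transpose M ** L) $ t $ s * (\<integral>w. \<xi> w s * \<eta> w t \<partial>\<pi>))"
        by (rule sum.mono_neutral_right) (auto simp: bicausal_uncorrelated[OF \<pi>])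
      then show "(\<Sum>s\<in>UNIV. (transpose M ** L) $ t $ s * (\<integral>w. \<xi> w s * \<eta> w t \<partial>\<pi>)) = (transpose M ** L) $ t $ t * (\<integral>w. \<xi> w t * \<eta> w t \<partial>\<pi>)"
        by simp
    qed
    finally show ?thesis by (simp add: N_mat_def corr_def)
  qed
  have e: "(norm (fst w - snd w))\<^sup>2 = ((norm (fst w - b))\<^sup>2 + (norm (snd w - a))\<^sup>2 - (norm (a - b))\<^sup>2) - 2 * ((fst w - a) \<bullet> (snd w - b))" for w
    by (simp add: power2_norm_eq_inner inner_simps inner_commute algebra_simps)
  have int: "integrable \<pi> (\<lambda>w. (norm (fst w - snd w))\<^sup>2)"
    unfolding e by (intro Bochner_Integration.integrable_diff Bochner_Integration.integrable_add integrable_mult_right i1 i2) auto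
  have val: "(\<integral>w. (norm (fst w - snd w))\<^sup>2 \<partial>\<pi>) = base_cost - 2 * (\<Sum>t\<in>UNIV. N_mat L M $ t $ t * corr \<pi> t)"
    unfolding e base_cost_def int1[symmetric] int2[symmetric]
    using i1 i2 by (simp add: prob_space)
  show "(\<integral>\<^sup>+(x, y). ennreal ((norm (x - y))\<^sup>2) \<partial>\<pi>) = ennreal (base_cost - 2 * (\<Sum>t\<in>UNIV. N_mat L M $ t $ t * corr \<pi> t))"
    unfolding val[symmetric] case_prod_beta by (rule nn_integral_eq_integral[OF int]) simp
  show "0 \<le> base_cost - 2 * (\<Sum>t\<in>UNIV. N_mat L M $ t $ t * corr \<pi> t)"
    unfolding val[symmetric] by (rule Bochner_Integration.integral_nonneg) simp
qed

lemma objective_eq: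
  assumes \<pi>: "\<pi> \<in> Cpl_bc \<mu> \<nu>"
  shows "objective l \<mu> \<nu> \<pi> = ereal (base_cost - 2 * (\<Sum>t\<in>UNIV. N_mat L M $ t $ t * corr \<pi> t)) + ereal l * KL \<pi> (\<mu> \<Otimes>\<^sub>M \<nu>)"
  unfolding objective_def transport_cost(1)[OF \<pi>] using transport_cost(2)[OF \<pi>] by simp

lemma pi_P_bicausal:
  assumes P: "diag_contraction P"
  shows "pi_P a b L M P \<in> Cpl_bc \<mu> \<nu>"
proof -
  have r: "\<bar>P $ t $ t\<bar> \<le> 1" for t using P by (auto simp: diag_contraction_def abs_le_iff minus_le_iff)
  have "distr noise borel (\<lambda>\<omega>. b + M *v innov (\<lambda>t. P $ t $ t) \<omega>) = \<nu>"
    unfolding path_law_def by (rule gaussian_law_unique[OF gaussian_law_path gaussian_law_path]) (auto simp: r)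
  then show ?thesis
    using coupled_paths_bicausal[OF L(1) matrix_inv_cancel(1)[OF L(2)] M(1) matrix_inv_cancel(1)[OF M(2)], of a b "\<lambda>t. P $ t $ t"]
    by (simp add: pi_P_eq_distr_noise[OF P] path_law_def)
qed

lemma corr_pi_P:
  assumes P: "diag_contraction P"
  shows "corr (pi_P a b L M P) t = P $ t $ t"
proof -
  have [measurable]: "coupled_paths a b L M (\<lambda>t. P $ t $ t) \<in> noise \<rightarrow>\<^sub>M borel \<Otimes>\<^sub>M borel"
    unfolding borel_prod by measurable
  have "corr (pi_P a b L M P) t = (\<integral>\<omega>. fst (\<omega> t) * innov (\<lambda>t. P $ t $ t) \<omega> $ t \<partial>noise)"
    unfolding corr_def pi_P_eq_distr_noise[OF P]
    by (subst integral_distr) (auto simp: coupled_paths_def whiten_left_inverse L M innov_nth borel_prod[symmetric])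
  also have "\<dots> = (\<integral>\<omega>. (\<lambda>z. P $ t $ t * (fst z)\<^sup>2 + sqrt (1 - (P $ t $ t)\<^sup>2) * (fst z * snd z)) (\<omega> t) \<partial>noise)"
    by (simp add: innov_nth power2_eq_square algebra_simps)
  also have "\<dots> = (\<integral>z. P $ t $ t * (fst z)\<^sup>2 + sqrt (1 - (P $ t $ t)\<^sup>2) * (fst z * snd z) \<partial>std_normal_pair)"
    by (subst distr_noise_component[of t, symmetric], subst integral_distr) auto
  also have "\<dots> = P $ t $ t"
    by (subst Bochner_Integration.integral_add) (auto simp: std_normal_pair_moments)
  finally show ?thesis .
qed

text \<open>
  A Gaussian law is determined by the variances of its linear functionals. For a coupling only the
  mixed second moments are free, and bi-causality leaves of these only the correlations of
  simultaneous innovations, which are the diagonal of \<open>P\<close>.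
\<close>

lemma gaussian_bicausal_eq_pi_P:
  assumes \<pi>: "\<pi> \<in> Cpl_bc \<mu> \<nu>" and g: "is_gaussian \<pi>"
  defines "P \<equiv> (\<chi> i j. if i = j then corr \<pi> i else 0)"
  shows "diag_contraction P" "\<pi> = pi_P a b L M P"
proof -
  have c: "\<pi> \<in> Cpl \<mu> \<nu>" using \<pi> by (simp add: Cpl_bc_def)
  note [measurable_cong] = cpl_facts(2)[OF c]
  show diag: "diag_contraction P"
    using abs_corr_le_1[OF c] by (auto simp: diag_contraction_def P_def abs_le_iff minus_le_iff)
  obtain m S where g: "gaussian_law \<pi> m S" using g by (auto simp: is_gaussian_def)
  have gm: "gaussian_law \<mu> a ((*v) (L ** transpose L))" "gaussian_law \<nu> b ((*v) (M ** transpose M))"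
    unfolding path_law_def by (rule gaussian_law_path; simp)+
  have mean: "w \<bullet> m = w \<bullet> (a, b)" for w
  proof -
    obtain u v where w: "w = (u, v)" by (cases w)
    have "integrable \<pi> (\<lambda>z. u \<bullet> fst z)" "(\<integral>z. u \<bullet> fst z \<partial>\<pi>) = u \<bullet> a"
      "integrable \<pi> (\<lambda>z. v \<bullet> snd z)" "(\<integral>z. v \<bullet> snd z \<partial>\<pi>) = v \<bullet> b"
      using gaussian_law_variance(1,2)[OF gm(1), of u] gaussian_law_variance(1,2)[OF gm(2), of v]
      by (simp_all add: marginal_integrals[OF c])
    then have "(\<integral>z. w \<bullet> z \<partial>\<pi>) = u \<bullet> a + v \<bullet> b"
      by (simp add: w inner_prod_def)
    then show ?thesis using gaussian_law_variance(2)[OF g, of w] by (simp add: w inner_prod_def)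
  qed
  then have m: "m = (a, b)" by (metis vector_eq_rdot inner_commute)
  let ?B = "block_op (L ** transpose L) (L ** P ** transpose M) (M ** transpose P ** transpose L) (M ** transpose M)"
  have quad: "w \<bullet> S w = w \<bullet> ?B w" for w
  proof -
    obtain u v where w: "w = (u, v)" by (cases w)
    define p q where "p = u v* L" "q = v v* M"
    have ux: "u \<bullet> (x - a) = p \<bullet> whiten a L x" for x
      unfolding p_q_def using inner_matrix_vector_mult[of u L "whiten a L x"] by (simp only: unwhiten[OF L(2)] transpose_matrix_vector)
    have vy: "v \<bullet> (x - b) = q \<bullet> whiten b M x" for x
      unfolding p_q_def using inner_matrix_vector_mult[of v M "whiten b M x"] by (simp only: unwhiten[OF M(2)] transpose_matrix_vector)
    have "integrable \<pi> (\<lambda>z. (u \<bullet> (fst z - a))\<^sup>2)" "(\<integral>z. (u \<bullet> (fst z - a))\<^sup>2 \<partial>\<pi>) = (\<Sum>t\<in>UNIV. (p $ t)\<^sup>2)"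
      using gaussian_law_variance(3,4)[OF gm(1), of u]
      by (simp_all add: marginal_integrals[OF c, of "\<lambda>x. (u \<bullet> (x - a))\<^sup>2"] quad_form_gram p_q_def)
    moreover have "integrable \<pi> (\<lambda>z. (v \<bullet> (snd z - b))\<^sup>2)" "(\<integral>z. (v \<bullet> (snd z - b))\<^sup>2 \<partial>\<pi>) = (\<Sum>t\<in>UNIV. (q $ t)\<^sup>2)"
      using gaussian_law_variance(3,4)[OF gm(2), of v]
      by (simp_all add: marginal_integrals[OF c, of "\<lambda>x. (v \<bullet> (x - b))\<^sup>2"] quad_form_gram p_q_def)
    moreover have cross: "(u \<bullet> (fst z - a)) * (v \<bullet> (snd z - b)) = (\<Sum>t\<in>UNIV. \<Sum>s\<in>UNIV. (p $ s * q $ t) * (\<xi> z s * \<eta> z t))" for z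
      unfolding ux vy unfolding inner_vec_def sum_product by (subst sum.swap) (simp add: mult_ac)
    moreover have "integrable \<pi> (\<lambda>z. (u \<bullet> (fst z - a)) * (v \<bullet> (snd z - b)))"
      unfolding cross by (intro Bochner_Integration.integrable_sum integrable_mult_right innovation_moments[OF c])
    moreover have "(\<integral>z. (u \<bullet> (fst z - a)) * (v \<bullet> (snd z - b)) \<partial>\<pi>) = (\<Sum>t\<in>UNIV. p $ t * q $ t * corr \<pi> t)"
    proof -
      have "(\<integral>z. (u \<bullet> (fst z - a)) * (v \<bullet> (snd z - b)) \<partial>\<pi>) = (\<Sum>t\<in>UNIV. \<Sum>s\<in>UNIV. (p $ s * q $ t) * (\<integral>w. \<xi> w s * \<eta> w t \<partial>\<pi>))"
        unfolding cross
        by (subst Bochner_Integration.integral_sum, intro Bochner_Integration.integrable_sum integrable_mult_right innovation_moments[OF c],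
          subst Bochner_Integration.integral_sum, intro integrable_mult_right innovation_moments[OF c]) simp
      also have "\<dots> = (\<Sum>t\<in>UNIV. p $ t * q $ t * corr \<pi> t)"
      proof (intro sum.cong refl)
        fix t :: 'n
        have "(\<Sum>s\<in>UNIV. (p $ s * q $ t) * (\<integral>w. \<xi> w s * \<eta> w t \<partial>\<pi>)) = (\<Sum>s\<in>{t}. (p $ s * q $ t) * (\<integral>w. \<xi> w s * \<eta> w t \<partial>\<pi>))"
          by (rule sum.mono_neutral_right) (auto simp: bicausal_uncorrelated[OF \<pi>])
        then show "(\<Sum>s\<in>UNIV. (p $ s * q $ t) * (\<integral>w. \<xi> w s * \<eta> w t \<partial>\<pi>)) = p $ t * q $ t * corr \<pi> t"
          by (simp add: corr_def)
      qed
      finally show ?thesis .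
    qed
    moreover have "(w \<bullet> (z - m))\<^sup>2 = (u \<bullet> (fst z - a))\<^sup>2 + (v \<bullet> (snd z - b))\<^sup>2 + 2 * ((u \<bullet> (fst z - a)) * (v \<bullet> (snd z - b)))" for z
      by (simp add: w m inner_prod_def power2_eq_square algebra_simps)
    ultimately have "(\<integral>z. (w \<bullet> (z - m))\<^sup>2 \<partial>\<pi>) = (\<Sum>t\<in>UNIV. (p $ t)\<^sup>2) + (\<Sum>t\<in>UNIV. (q $ t)\<^sup>2) + 2 * (\<Sum>t\<in>UNIV. p $ t * q $ t * corr \<pi> t)"
      by simp
    then have "w \<bullet> S w = (\<Sum>t\<in>UNIV. (p $ t)\<^sup>2) + (\<Sum>t\<in>UNIV. (q $ t)\<^sup>2) + 2 * (\<Sum>t\<in>UNIV. p $ t * q $ t * corr \<pi> t)"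
      by (simp only: gaussian_law_variance(4)[OF g])
    then show ?thesis
      unfolding w
      by (subst quad_form_block_op) (auto simp: P_def p_q_def sum.distrib sum_distrib_left algebra_simps)
  qed
  have "gaussian_law \<pi> (a, b) ?B"
    using g unfolding gaussian_law_def quad m by (auto simp: linear_block_op block_op_symmetric)
  then show "\<pi> = pi_P a b L M P"
    unfolding pi_P_def by (rule gaussian_eqI[symmetric])
qed

end

section \<open>The Gibbs variational principle\<close>

lemma KL_eq_integral_log_density:
  assumes R: "prob_space R" and p [measurable]: "p \<in> borel_measurable R" and p0: "\<And>x. 0 \<le> p x"
    and \<pi>: "\<pi> = density R (\<lambda>x. ennreal (p x))"
  shows "KL \<pi> R = enn2ereal (\<integral>\<^sup>+x. ennreal (ln (p x)) \<partial>\<pi>) - enn2ereal (\<integral>\<^sup>+x. ennreal (- ln (p x)) \<partial>\<pi>)"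
    and "integrable \<pi> (\<lambda>x. ln (p x)) \<Longrightarrow> KL \<pi> R = ereal (\<integral>x. ln (p x) \<partial>\<pi>)"
proof -
  interpret R: prob_space R by fact
  have ac: "absolutely_continuous R \<pi>" unfolding \<pi> by (rule absolutely_continuousI_density) measurable
  have "AE x in R. RN_deriv R \<pi> x = ennreal (p x)"
    by (rule AE_mp[OF R.RN_deriv_unique[of "\<lambda>x. ennreal (p x)" \<pi>]]) (auto simp: \<pi>)
  then have "AE x in \<pi>. RN_deriv R \<pi> x = ennreal (p x)"
    unfolding \<pi> by (subst AE_density) auto
  then have ae: "AE x in \<pi>. enn2real (RN_deriv R \<pi> x) = p x"
    by eventually_elim (simp add: p0)
  have "(\<integral>\<^sup>+x. ennreal (ln (enn2real (RN_deriv R \<pi> x))) \<partial>\<pi>) = (\<integral>\<^sup>+x. ennreal (ln (p x)) \<partial>\<pi>)"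
    "(\<integral>\<^sup>+x. ennreal (- ln (enn2real (RN_deriv R \<pi> x))) \<partial>\<pi>) = (\<integral>\<^sup>+x. ennreal (- ln (p x)) \<partial>\<pi>)"
    using ae by (auto intro!: nn_integral_cong_AE elim: eventually_mono)
  then show KL: "KL \<pi> R = enn2ereal (\<integral>\<^sup>+x. ennreal (ln (p x)) \<partial>\<pi>) - enn2ereal (\<integral>\<^sup>+x. ennreal (- ln (p x)) \<partial>\<pi>)"
    using ac by (simp add: KL_def)
  assume int: "integrable \<pi> (\<lambda>x. ln (p x))"
  then obtain r q where "0 \<le> r" "0 \<le> q" and rq: "(\<integral>\<^sup>+x. ennreal (ln (p x)) \<partial>\<pi>) = ennreal r" "(\<integral>\<^sup>+x. ennreal (- ln (p x)) \<partial>\<pi>) = ennreal q"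
    "(\<integral>x. ln (p x) \<partial>\<pi>) = r - q"
    by (rule integrableE)
  then show "KL \<pi> R = ereal (\<integral>x. ln (p x) \<partial>\<pi>)"
    unfolding KL by simp
qed

text \<open>
  Let \<open>p\<close> be the density of \<open>\<pi>\<close>. The difference of the two sides is the integral of
  \<open>ln p - ln h = - ln (h / p)\<close> under \<open>\<pi>\<close>, that is, the relative entropy of \<open>\<pi>\<close> with respect to \<open>h R\<close>.
  Since \<open>ln r \<le> r - 1\<close> with equality only at \<open>r = 1\<close>, and since \<open>h / p\<close> integrates to at most \<open>1\<close> under
  \<open>\<pi>\<close>, it is nonnegative and vanishes only for \<open>p = h\<close> almost everywhere. Integrability has to
  be settled on the way: the negative part of \<open>ln p\<close> is always integrable because \<open>- p ln p \<le> 1\<close>, and if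
  the positive part is not, then the entropy is infinite.
\<close>

lemma gibbs_variational_principle:
  assumes R: "prob_space R" and h [measurable]: "h \<in> borel_measurable R" and h0: "\<And>x. 0 < h x"
    and P: "prob_space (density R (\<lambda>x. ennreal (h x)))"
    and \<pi>: "prob_space \<pi>" "sets \<pi> = sets R" and int: "integrable \<pi> (\<lambda>x. ln (h x))"
  shows "ereal (\<integral>x. ln (h x) \<partial>\<pi>) \<le> KL \<pi> R"
    and "KL \<pi> R = ereal (\<integral>x. ln (h x) \<partial>\<pi>) \<Longrightarrow> \<pi> = density R (\<lambda>x. ennreal (h x))"
proof -
  interpret R: prob_space R by fact
  interpret \<pi>: prob_space \<pi> by fact
  let ?P = "density R (\<lambda>x. ennreal (h x))"
  have "ereal (\<integral>x. ln (h x) \<partial>\<pi>) \<le> KL \<pi> R \<and> (KL \<pi> R = ereal (\<integral>x. ln (h x) \<partial>\<pi>) \<longrightarrow> \<pi> = ?P)"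
  proof (cases "absolutely_continuous R \<pi>")
    case False
    then show ?thesis by (simp add: KL_def)
  next
    case ac: True
    define p where "p x = enn2real (RN_deriv R \<pi> x)" for x
    have p [measurable]: "p \<in> borel_measurable R" unfolding p_def[abs_def] by measurable
    have p0: "0 \<le> p x" for x by (simp add: p_def)
    have "AE x in R. RN_deriv R \<pi> x \<noteq> \<infinity>"
      by (rule R.RN_deriv_finite[OF \<pi>.sigma_finite_measure_axioms ac \<pi>(2)])
    then have "AE x in R. RN_deriv R \<pi> x = ennreal (p x)"
      by eventually_elim (simp add: p_def less_top[symmetric])
    then have "density R (RN_deriv R \<pi>) = density R (\<lambda>x. ennreal (p x))"
      by (intro density_cong) auto
    then have \<pi>p: "\<pi> = density R (\<lambda>x. ennreal (p x))"
      using R.density_RN_deriv[OF ac \<pi>(2)] by simp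
    note KLp = KL_eq_integral_log_density[OF R p p0 \<pi>p]
    note [measurable_cong] = \<pi>(2)
    have neg_le: "ennreal (p x) * ennreal (- ln (p x)) \<le> 1" for x
    proof (cases "0 < p x \<and> p x < 1")
      case True
      then have "p x * (- ln (p x)) \<le> p x * (1 / p x - 1)"
        using ln_le_minus_one[of "1 / p x"] by (intro mult_left_mono) (auto simp: ln_div)
      also have "\<dots> \<le> 1" using True by (simp add: algebra_simps)
      finally show ?thesis using True by (simp add: ennreal_mult[symmetric] ln_le_zero_iff)
    next
      case False
      then have "p x = 0 \<or> ennreal (- ln (p x)) = 0"
        using p0[of x] by (auto simp: ennreal_eq_0_iff not_less)
      then show ?thesis by auto
    qed
    have "(\<integral>\<^sup>+x. ennreal (- ln (p x)) \<partial>\<pi>) = (\<integral>\<^sup>+x. ennreal (p x) * ennreal (- ln (p x)) \<partial>R)"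
      unfolding \<pi>p by (subst nn_integral_density) auto
    also have "\<dots> \<le> (\<integral>\<^sup>+x. 1 \<partial>R)" by (intro nn_integral_mono neg_le)
    finally have neg: "(\<integral>\<^sup>+x. ennreal (- ln (p x)) \<partial>\<pi>) \<le> 1" by (simp add: R.emeasure_space_1)
    then have neg': "(\<integral>\<^sup>+x. ennreal (- ln (p x)) \<partial>\<pi>) < \<infinity>" by (rule le_less_trans) simp
    have [measurable]: "p \<in> borel_measurable \<pi>" "h \<in> borel_measurable \<pi>" by measurable
    show ?thesis
    proof (cases "(\<integral>\<^sup>+x. ennreal (ln (p x)) \<partial>\<pi>) = \<infinity>")
      case True
      then have "KL \<pi> R = \<infinity>" unfolding KLp(1) using neg' by simp
      then show ?thesis by simp
    next
      case False
      have intp: "integrable \<pi> (\<lambda>x. ln (p x))"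
        using False neg' by (simp add: real_integrable_def less_top)
      have KL: "KL \<pi> R = ereal (\<integral>x. ln (p x) \<partial>\<pi>)" by (rule KLp(2)[OF intp])
      have pos: "AE x in \<pi>. 0 < p x"
        unfolding \<pi>p by (subst AE_density) auto
      have "(\<integral>\<^sup>+x. ennreal (h x / p x) \<partial>\<pi>) = (\<integral>\<^sup>+x. ennreal (p x) * ennreal (h x / p x) \<partial>R)"
        by (subst \<pi>p, subst nn_integral_density) auto
      also have "\<dots> \<le> (\<integral>\<^sup>+x. ennreal (h x) \<partial>R)"
        using p0 h0 by (intro nn_integral_mono) (auto simp: ennreal_mult[symmetric] less_imp_le)
      also have "\<dots> = emeasure ?P (space ?P)" by (simp add: emeasure_density cong: nn_integral_cong)
      also have "\<dots> = 1" using P by (rule prob_space.emeasure_space_1)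
      finally have le1: "(\<integral>\<^sup>+x. ennreal (h x / p x) \<partial>\<pi>) \<le> 1" .
      have inthp: "integrable \<pi> (\<lambda>x. h x / p x)"
        using le_less_trans[OF le1] p0 h0 by (intro integrableI_nonneg) (auto simp: less_imp_le)
      have "ennreal (\<integral>x. h x / p x \<partial>\<pi>) \<le> 1"
        using nn_integral_eq_integral[OF inthp] le1 p0 h0 by (simp add: less_imp_le)
      then have le1': "(\<integral>x. h x / p x \<partial>\<pi>) \<le> 1" by simp
      define d where "d x = h x / p x - 1 + (ln (p x) - ln (h x))" for x
      have intd: "integrable \<pi> d" unfolding d_def[abs_def]
        using inthp intp int by simp
      have d_val: "(\<integral>x. d x \<partial>\<pi>) = (\<integral>x. h x / p x \<partial>\<pi>) - 1 + ((\<integral>x. ln (p x) \<partial>\<pi>) - (\<integral>x. ln (h x) \<partial>\<pi>))"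
        unfolding d_def using inthp intp int by (simp add: \<pi>.prob_space)
      have d: "0 \<le> d x \<and> (d x = 0 \<longrightarrow> p x = h x)" if "0 < p x" for x
      proof -
        have r: "0 < h x / p x" using that h0 by simp
        have e: "d x = h x / p x - 1 - ln (h x / p x)" using ln_divide_pos[OF h0 that] by (simp add: d_def)
        show ?thesis
        proof (intro conjI impI)
          show "0 \<le> d x" using ln_le_minus_one[OF r] unfolding e by simp
          assume "d x = 0"
          then have "ln (h x / p x) = h x / p x - 1" unfolding e by simp
          then have "h x / p x = 1" by (rule ln_eq_minus_one[OF r])
          then show "p x = h x" using that by simp
        qed
      qed
      have AEd: "AE x in \<pi>. 0 \<le> d x" using pos by eventually_elim (use d in blast)
      then have d_nonneg: "0 \<le> (\<integral>x. d x \<partial>\<pi>)" by (rule integral_nonneg_AE)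
      have "\<pi> = ?P" if "(\<integral>x. ln (p x) \<partial>\<pi>) = (\<integral>x. ln (h x) \<partial>\<pi>)"
      proof -
        have "(\<integral>x. d x \<partial>\<pi>) = 0" using d_nonneg d_val le1' that by simp
        then have "AE x in \<pi>. d x = 0" using integral_nonneg_eq_0_iff_AE[OF intd AEd] by simp
        then have "AE x in \<pi>. p x = h x" using pos by eventually_elim (use d in blast)
        then have "AE x in R. ennreal (p x) \<le> ennreal (h x)"
          unfolding \<pi>p by (subst (asm) AE_density) (auto elim!: eventually_mono simp: not_less intro!: ennreal_leI, metis h0 less_imp_le order_trans not_le)
        \<comment> \<open>Off the set where \<open>p > 0\<close> only the inequality of the densities is known; equality follows from comparing the masses of \<open>A\<close> and of its complement.\<close>
        then have le: "emeasure \<pi> A \<le> emeasure ?P A" if [measurable]: "A \<in> sets R" for A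
          by (subst \<pi>p) (auto simp: emeasure_density intro!: nn_integral_mono_AE mult_right_mono elim!: eventually_mono)
        interpret P: prob_space ?P by (rule P)
        show ?thesis
        proof (rule measure_eqI)
          fix A assume "A \<in> sets \<pi>"
          then have A [measurable]: "A \<in> sets R" by (simp add: \<pi>(2))
          have sp: "space \<pi> = space R" using \<pi>(2) by (rule sets_eq_imp_space_eq)
          have "measure \<pi> A \<le> measure ?P A" "measure \<pi> (space R - A) \<le> measure ?P (space R - A)"
            using le[of A] le[of "space R - A"] by (auto simp: \<pi>.emeasure_eq_measure P.emeasure_eq_measure)
          moreover have "measure \<pi> (space R - A) = 1 - measure \<pi> A" "measure ?P (space R - A) = 1 - measure ?P A"
            using \<pi>.prob_compl[of A] P.prob_compl[of A] A by (auto simp: sp \<pi>(2))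
          ultimately show "emeasure \<pi> A = emeasure ?P A"
            by (simp add: \<pi>.emeasure_eq_measure P.emeasure_eq_measure)
        qed (simp add: \<pi>(2))
      qed
      moreover have "(\<integral>x. ln (h x) \<partial>\<pi>) \<le> (\<integral>x. ln (p x) \<partial>\<pi>)"
        using d_nonneg d_val le1' by simp
      ultimately show ?thesis by (simp add: KL)
    qed
  qed
  then show "ereal (\<integral>x. ln (h x) \<partial>\<pi>) \<le> KL \<pi> R" "KL \<pi> R = ereal (\<integral>x. ln (h x) \<partial>\<pi>) \<Longrightarrow> \<pi> = ?P"
    by auto
qed

section \<open>The density of a non-degenerate Gaussian coupling\<close>

text \<open>
  The Mehler kernel: the density of a standard Gaussian pair with correlation \<open>\<rho>\<close> with respect to the
  product of its marginals.
\<close>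

definition mehler :: "real \<Rightarrow> real \<times> real \<Rightarrow> real" where
  "mehler \<rho> z = exp ((2 * \<rho> * (fst z * snd z) - \<rho>\<^sup>2 * (fst z)\<^sup>2 - \<rho>\<^sup>2 * (snd z)\<^sup>2) / (2 * (1 - \<rho>\<^sup>2))) / sqrt (1 - \<rho>\<^sup>2)"

lemma measurable_mehler [measurable]: "mehler \<rho> \<in> borel_measurable (borel \<Otimes>\<^sub>M borel)"
  unfolding mehler_def[abs_def] by measurable

lemma mehler_pos: "\<bar>\<rho>\<bar> < 1 \<Longrightarrow> 0 < mehler \<rho> z"
  by (simp add: mehler_def abs_square_less_1)

lemma ln_mehler: "\<bar>\<rho>\<bar> < 1 \<Longrightarrow> ln (mehler \<rho> z) =
    (2 * \<rho> * (fst z * snd z) - \<rho>\<^sup>2 * (fst z)\<^sup>2 - \<rho>\<^sup>2 * (snd z)\<^sup>2) / (2 * (1 - \<rho>\<^sup>2)) - ln (sqrt (1 - \<rho>\<^sup>2))"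
  by (simp add: mehler_def ln_div abs_square_less_1)

text \<open>
  With \<open>x\<close> fixed, substitute \<open>y = \<rho> x + q z\<close> where \<open>q = sqrt (1 - \<rho>\<^sup>2)\<close>.
\<close>

lemma correlated_pair_density:
  assumes \<rho>: "\<bar>\<rho>\<bar> < 1"
  shows "distr std_normal_pair std_normal_pair (\<lambda>z. (fst z, \<rho> * fst z + sqrt (1 - \<rho>\<^sup>2) * snd z)) =
    density std_normal_pair (\<lambda>z. ennreal (mehler \<rho> z))" (is "?D = ?E")
proof (rule measure_eqI)
  fix A assume "A \<in> sets ?D"
  then have A [measurable]: "A \<in> sets (borel \<Otimes>\<^sub>M borel)" by (simp add: sets_std_normal_pair)
  define q where "q = sqrt (1 - \<rho>\<^sup>2)"
  have q: "q > 0" "q\<^sup>2 = 1 - \<rho>\<^sup>2" using \<rho> by (auto simp: q_def abs_square_less_1 less_imp_le)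
  \<comment> \<open>Completing the square.\<close>
  have dens: "std_normal_density ((y - \<rho> * x) / q) / q = std_normal_density y * mehler \<rho> (x, y)" for x y
  proof -
    have "- ((y - \<rho> * x) / q)\<^sup>2 / 2 = - y\<^sup>2 / 2 + (2 * \<rho> * (x * y) - \<rho>\<^sup>2 * x\<^sup>2 - \<rho>\<^sup>2 * y\<^sup>2) / (2 * q\<^sup>2)"
    proof -
      have "- ((y - \<rho> * x) / q)\<^sup>2 / 2 = (- (y - \<rho> * x)\<^sup>2) / (2 * q\<^sup>2)" by (simp add: power_divide)
      also have "- (y - \<rho> * x)\<^sup>2 = - y\<^sup>2 * q\<^sup>2 + (2 * \<rho> * (x * y) - \<rho>\<^sup>2 * x\<^sup>2 - \<rho>\<^sup>2 * y\<^sup>2)"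
        unfolding q(2) by (simp add: power2_eq_square algebra_simps)
      also have "\<dots> / (2 * q\<^sup>2) = - y\<^sup>2 / 2 + (2 * \<rho> * (x * y) - \<rho>\<^sup>2 * x\<^sup>2 - \<rho>\<^sup>2 * y\<^sup>2) / (2 * q\<^sup>2)"
        using q(1) by (simp only: add_divide_distrib) (simp add: field_simps)
      finally show ?thesis .
    qed
    then show ?thesis
      using q(1) unfolding std_normal_density_def mehler_def q_def[symmetric] fst_conv snd_conv q(2)[symmetric]
      by (simp only: exp_add) (simp add: field_simps)
  qed
  have "emeasure ?D A = (\<integral>\<^sup>+z. indicator A (fst z, \<rho> * fst z + q * snd z) \<partial>std_normal_pair)"
    by (subst nn_integral_indicator[symmetric], simp add: sets_std_normal_pair, subst nn_integral_distr)
       (simp_all add: q_def)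
  also have "\<dots> = (\<integral>\<^sup>+x. \<integral>\<^sup>+y. indicator A (x, \<rho> * x + q * y) \<partial>std_normal_distribution \<partial>std_normal_distribution)"
    by (subst std_normal.nn_integral_fst[symmetric]) auto
  also have "\<dots> = (\<integral>\<^sup>+x. \<integral>\<^sup>+y. ennreal (mehler \<rho> (x, y)) * indicator A (x, y) \<partial>std_normal_distribution \<partial>std_normal_distribution)"
  proof (rule nn_integral_cong)
    fix x :: real
    have [measurable]: "(\<lambda>y. indicator A (x, y) :: ennreal) \<in> borel_measurable borel" by measurable
    have "(\<integral>\<^sup>+y. indicator A (x, \<rho> * x + q * y) \<partial>std_normal_distribution) =
        (\<integral>\<^sup>+y. ennreal (std_normal_density y) * indicator A (x, \<rho> * x + q * y) \<partial>lborel)"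
      by (subst nn_integral_density) auto
    also have "\<dots> = (\<integral>\<^sup>+y. ennreal q * (ennreal (std_normal_density ((\<rho> * x + q * y - \<rho> * x) / q) / q) * indicator A (x, \<rho> * x + q * y)) \<partial>lborel)"
      using q by (intro nn_integral_cong) (auto simp: ennreal_mult[symmetric] mult.assoc[symmetric])
    also have "\<dots> = ennreal q * (\<integral>\<^sup>+y. ennreal (std_normal_density ((\<rho> * x + q * y - \<rho> * x) / q) / q) * indicator A (x, \<rho> * x + q * y) \<partial>lborel)"
      by (subst nn_integral_cmult) auto
    also have "\<dots> = (\<integral>\<^sup>+y. ennreal (std_normal_density ((y - \<rho> * x) / q) / q) * indicator A (x, y) \<partial>lborel)"
      using q(1) by (subst nn_integral_real_affine[where c = q and t = "\<rho> * x"]) auto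
    also have "\<dots> = (\<integral>\<^sup>+y. ennreal (std_normal_density y) * (ennreal (mehler \<rho> (x, y)) * indicator A (x, y)) \<partial>lborel)"
      unfolding dens using mehler_pos[OF \<rho>] by (simp add: ennreal_mult less_imp_le mult.assoc)
    also have "\<dots> = (\<integral>\<^sup>+y. ennreal (mehler \<rho> (x, y)) * indicator A (x, y) \<partial>std_normal_distribution)"
      by (subst nn_integral_density) auto
    finally show "(\<integral>\<^sup>+y. indicator A (x, \<rho> * x + q * y) \<partial>std_normal_distribution) =
      (\<integral>\<^sup>+y. ennreal (mehler \<rho> (x, y)) * indicator A (x, y) \<partial>std_normal_distribution)" .
  qed
  also have "\<dots> = (\<integral>\<^sup>+z. ennreal (mehler \<rho> z) * indicator A z \<partial>std_normal_pair)"
    by (subst std_normal.nn_integral_fst[symmetric]) auto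
  also have "\<dots> = emeasure ?E A"
    by (subst emeasure_density) (auto simp: sets_std_normal_pair)
  finally show "emeasure ?D A = emeasure ?E A" .
qed simp

text \<open>
  Both sides are products over time of the pair laws of the previous lemma.
\<close>

lemma correlated_noise_density:
  fixes r :: "'n::finite \<Rightarrow> real"
  assumes r: "\<And>t. \<bar>r t\<bar> < 1"
  shows "distr noise noise (\<lambda>\<omega> t. (fst (\<omega> t), r t * fst (\<omega> t) + sqrt (1 - (r t)\<^sup>2) * snd (\<omega> t))) =
    density noise (\<lambda>\<omega>. ennreal (\<Prod>t\<in>UNIV. mehler (r t) (\<omega> t)))" (is "?D = ?E")
proof -
  define T where "T t z = (fst z, r t * fst z + sqrt (1 - (r t)\<^sup>2) * snd z)" for t and z :: "real \<times> real"
  have T [measurable]: "T t \<in> std_normal_pair \<rightarrow>\<^sub>M std_normal_pair" for t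
    unfolding T_def[abs_def] by measurable
  define K where "K t = density std_normal_pair (\<lambda>z. ennreal (mehler (r t) z))" for t
  have K: "K t = distr std_normal_pair std_normal_pair (T t)" for t
    unfolding K_def T_def by (rule correlated_pair_density[OF r, symmetric])
  have Ks: "sets (K t) = sets std_normal_pair" for t by (simp add: K_def)
  have Kp: "prob_space (K t)" for t unfolding K by (rule std_normal_pair.prob_space_distr) measurable
  interpret K: product_prob_space K UNIV
    by (intro product_prob_spaceI Kp)
  have PiK: "sets (PiM UNIV K) = sets noise" unfolding noise_def by (rule sets_PiM_cong) (auto simp: Ks)
  have em: "emeasure noise (Pi\<^sub>E UNIV B) = (\<Prod>t\<in>UNIV. emeasure std_normal_pair (B t))" "Pi\<^sub>E UNIV B \<in> sets noise"
    if "\<And>t. B t \<in> sets std_normal_pair" for B :: "'n \<Rightarrow> (real \<times> real) set"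
    unfolding noise_def using that by (auto intro: noise_factors.emeasure_PiM)
  have TT: "(\<lambda>\<omega> t. T t (\<omega> t)) \<in> noise \<rightarrow>\<^sub>M noise"
    unfolding noise_def by (rule measurable_PiM_single') (auto simp: space_PiM)
  \<comment> \<open>Each side is identified with the product measure through its values on boxes.\<close>
  have "?D = PiM UNIV K"
  proof (rule K.PiM_eqI)
    fix A assume "\<And>i. i \<in> UNIV \<Longrightarrow> A i \<in> sets (K i)"
    then have A: "A i \<in> sets std_normal_pair" for i by (simp add: Ks)
    have TA: "T t -` A t \<in> sets std_normal_pair" for t
      using measurable_sets[OF T A, of t t] by simp
    have "emeasure ?D (Pi\<^sub>E UNIV A) = emeasure noise (Pi\<^sub>E UNIV (\<lambda>t. T t -` A t))"
      using TT em(2)[OF A] unfolding T_def[symmetric]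
      by (subst emeasure_distr) (auto intro!: arg_cong2[of _ _ _ _ emeasure])
    also have "\<dots> = (\<Prod>t\<in>UNIV. emeasure (K t) (A t))"
      unfolding em(1)[OF TA] K using A by (intro prod.cong) (auto simp: emeasure_distr)
    finally show "emeasure ?D (Pi\<^sub>E UNIV A) = (\<Prod>t\<in>UNIV. emeasure (K t) (A t))" .
  qed (auto simp: PiK)
  moreover have "?E = PiM UNIV K"
  proof (rule K.PiM_eqI)
    fix A assume "\<And>i. i \<in> UNIV \<Longrightarrow> A i \<in> sets (K i)"
    then have A [measurable]: "A i \<in> sets std_normal_pair" for i by (simp add: Ks)
    note [measurable] = A[unfolded sets_std_normal_pair]
    have m: "(\<lambda>\<omega>. ennreal (\<Prod>t\<in>UNIV. mehler (r t) (\<omega> t))) \<in> borel_measurable noise"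
      by (intro measurable_compose[OF _ measurable_ennreal] borel_measurable_prod measurable_compose[OF measurable_noise_component])
        measurable
    have "emeasure ?E (Pi\<^sub>E UNIV A) = (\<integral>\<^sup>+\<omega>. ennreal (\<Prod>t\<in>UNIV. mehler (r t) (\<omega> t)) * indicator (Pi\<^sub>E UNIV A) \<omega> \<partial>noise)"
      by (rule emeasure_density[OF m em(2)[OF A]])
    also have "\<dots> = (\<integral>\<^sup>+\<omega>. (\<Prod>t\<in>UNIV. ennreal (mehler (r t) (\<omega> t)) * indicator (A t) (\<omega> t)) \<partial>noise)"
    proof (intro nn_integral_cong)
      fix \<omega> :: "'n \<Rightarrow> real \<times> real"
      have "indicator (Pi\<^sub>E UNIV A) \<omega> = (\<Prod>t\<in>UNIV. indicator (A t) (\<omega> t) :: ennreal)"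
        by (auto simp: indicator_def PiE_iff)
      then show "ennreal (\<Prod>t\<in>UNIV. mehler (r t) (\<omega> t)) * indicator (Pi\<^sub>E UNIV A) \<omega> =
          (\<Prod>t\<in>UNIV. ennreal (mehler (r t) (\<omega> t)) * indicator (A t) (\<omega> t))"
        using mehler_pos[OF r] by (simp add: prod.distrib prod_ennreal less_imp_le)
    qed
    also have "\<dots> = (\<Prod>t\<in>UNIV. \<integral>\<^sup>+z. ennreal (mehler (r t) z) * indicator (A t) z \<partial>std_normal_pair)"
      unfolding noise_def by (rule noise_factors.product_nn_integral_prod) auto
    also have "\<dots> = (\<Prod>t\<in>UNIV. emeasure (K t) (A t))"
      unfolding K_def by (intro prod.cong refl emeasure_density[symmetric]) auto
    finally show "emeasure ?E (Pi\<^sub>E UNIV A) = (\<Prod>t\<in>UNIV. emeasure (K t) (A t))" .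
  qed (auto simp: PiK)
  ultimately show ?thesis by simp
qed

context gaussian_pair begin

lemma product_law_is_uncorrelated_coupling:
  "\<mu> \<Otimes>\<^sub>M \<nu> = distr noise borel (coupled_paths a b L M (\<lambda>_. 0))"
proof (rule char_determines_measure)
  interpret m: prob_space \<mu> by (rule prob_space_path_law)
  interpret n: prob_space \<nu> by (rule prob_space_path_law)
  interpret mn: pair_prob_space \<mu> \<nu> ..
  show "prob_space (\<mu> \<Otimes>\<^sub>M \<nu>)" by (rule mn.prob_space_axioms)
  show "prob_space (distr noise borel (coupled_paths a b L M (\<lambda>_. 0)))" by (rule noise.prob_space_distr) measurable
  show s: "sets (\<mu> \<Otimes>\<^sub>M \<nu>) = sets borel"
    unfolding borel_prod[symmetric] by (rule sets_pair_measure_cong) auto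
  fix w :: "'n path \<times> 'n path"
  obtain u v where w: "w = (u, v)" by (cases w)
  have gm: "gaussian_law \<mu> a ((*v) (L ** transpose L))" "gaussian_law \<nu> b ((*v) (M ** transpose M))"
    unfolding path_law_def by (rule gaussian_law_path; simp)+
  have int: "integrable (\<mu> \<Otimes>\<^sub>M \<nu>) (\<lambda>z. iexp (w \<bullet> z))"
    by (rule mn.integrable_iexp) (auto simp: measurable_cong_sets[OF s refl])
  have "(CLINT z|\<mu> \<Otimes>\<^sub>M \<nu>. iexp (w \<bullet> z)) = (CLINT x|\<mu>. CLINT y|\<nu>. iexp (u \<bullet> x) * iexp (v \<bullet> y))"
    unfolding mn.integral_fst'[OF int, symmetric] by (simp only: w inner_Pair of_real_add ring_distribs exp_add)
  also have "\<dots> = (CLINT x|\<mu>. iexp (u \<bullet> x)) * (CLINT y|\<nu>. iexp (v \<bullet> y))"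
    by (simp only: integral_mult_right_zero integral_mult_left_zero)
  also have "\<dots> = exp (\<i> * complex_of_real (u \<bullet> a) - complex_of_real (\<Sum>t\<in>UNIV. ((u v* L) $ t)\<^sup>2) / 2) *
      exp (\<i> * complex_of_real (v \<bullet> b) - complex_of_real (\<Sum>t\<in>UNIV. ((v v* M) $ t)\<^sup>2) / 2)"
    using gm by (simp only: gaussian_law_def quad_form_gram)
  also have "\<dots> = exp (\<i> * complex_of_real (u \<bullet> a + v \<bullet> b) -
      complex_of_real (\<Sum>t\<in>UNIV. ((u v* L) $ t)\<^sup>2 + 2 * 0 * (u v* L) $ t * (v v* M) $ t + ((v v* M) $ t)\<^sup>2) / 2)"
    by (simp add: exp_add[symmetric] sum.distrib algebra_simps add_divide_distrib)
  also have "\<dots> = (CLINT \<omega>|noise. iexp (u \<bullet> (a + L *v innov (\<lambda>_. 1) \<omega>) + v \<bullet> (b + M *v innov (\<lambda>_. 0) \<omega>)))"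
    by (rule char_innov_pair[symmetric]) simp
  also have "\<dots> = (CLINT z|distr noise borel (coupled_paths a b L M (\<lambda>_. 0)). iexp (w \<bullet> z))"
    by (subst integral_distr) (auto simp: coupled_paths_def w)
  finally show "(CLINT z|\<mu> \<Otimes>\<^sub>M \<nu>. iexp (w \<bullet> z)) = (CLINT z|distr noise borel (coupled_paths a b L M (\<lambda>_. 0)). iexp (w \<bullet> z))" .
qed simp

definition coupling_density :: "('n \<Rightarrow> real) \<Rightarrow> 'n path \<times> 'n path \<Rightarrow> real" where
  "coupling_density r w = (\<Prod>t\<in>UNIV. mehler (r t) (\<xi> w t, \<eta> w t))"

lemma measurable_coupling_density [measurable]: "coupling_density r \<in> borel_measurable (borel \<Otimes>\<^sub>M borel)"
  unfolding coupling_density_def[abs_def] by measurable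

text \<open>
  The coupling \<open>pi_P\<close> is the image of correlated noise under the map that sends the uncorrelated noise to
  \<open>\<mu> \<Otimes>\<^sub>M \<nu>\<close>; as this map can be inverted through \<open>whiten\<close>, the density on the noise space carries over.
\<close>

lemma pi_P_density:
  assumes P: "diag_contraction P" and P1: "\<And>t. \<bar>P $ t $ t\<bar> < 1"
  shows "pi_P a b L M P = density (\<mu> \<Otimes>\<^sub>M \<nu>) (\<lambda>w. ennreal (coupling_density (\<lambda>t. P $ t $ t) w))"
proof -
  let ?r = "\<lambda>t. P $ t $ t"
  let ?c = "coupled_paths a b L M (\<lambda>_. 0)"
  define T where "T \<omega> t = (fst (\<omega> t), ?r t * fst (\<omega> t) + sqrt (1 - (?r t)\<^sup>2) * snd (\<omega> t))" for \<omega> :: "'n \<Rightarrow> real \<times> real" and t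
  have T: "T \<in> noise \<rightarrow>\<^sub>M noise"
    unfolding noise_def T_def[abs_def] by (rule measurable_PiM_single') (auto simp: space_PiM)
  have [measurable]: "?c \<in> noise \<rightarrow>\<^sub>M borel \<Otimes>\<^sub>M borel" unfolding borel_prod by measurable
  have cT: "coupled_paths a b L M ?r \<omega> = ?c (T \<omega>)" for \<omega>
    by (simp add: coupled_paths_def innov_def T_def)
  have dens: "coupling_density ?r (?c \<omega>) = (\<Prod>t\<in>UNIV. mehler (?r t) (\<omega> t))" for \<omega>
    by (simp add: coupling_density_def coupled_paths_def whiten_left_inverse L M innov_nth)
  have "pi_P a b L M P = distr (distr noise noise T) (borel \<Otimes>\<^sub>M borel) ?c"
    unfolding pi_P_eq_distr_noise[OF P] borel_prod using T by (subst distr_distr) (auto simp: o_def cT cong: distr_cong)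
  also have "\<dots> = distr (density noise (\<lambda>\<omega>. ennreal (coupling_density ?r (?c \<omega>)))) (borel \<Otimes>\<^sub>M borel) ?c"
    unfolding dens T_def[abs_def] by (subst correlated_noise_density) (auto simp: P1)
  also have "\<dots> = density (distr noise (borel \<Otimes>\<^sub>M borel) ?c) (\<lambda>w. ennreal (coupling_density ?r w))"
    by (rule density_distr[symmetric]) measurable
  finally show ?thesis by (simp only: product_law_is_uncorrelated_coupling borel_prod)
qed

text \<open>
  The logarithm of a Mehler kernel is quadratic and the second moments of the innovations are fixed,
  so the expectation depends on the coupling only through its correlations, in an affine way.
\<close>

lemma expectation_log_density:
  assumes \<pi>: "\<pi> \<in> Cpl \<mu> \<nu>" and r: "\<And>t. \<bar>r t\<bar> < 1"
  shows "integrable \<pi> (\<lambda>w. ln (coupling_density r w))"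
    "(\<integral>w. ln (coupling_density r w) \<partial>\<pi>) =
      (\<Sum>t\<in>UNIV. r t / (1 - (r t)\<^sup>2) * corr \<pi> t) - (\<Sum>t\<in>UNIV. (r t)\<^sup>2 / (1 - (r t)\<^sup>2) + ln (sqrt (1 - (r t)\<^sup>2)))"
proof -
  interpret prob_space \<pi> by (rule cpl_facts[OF \<pi>])
  note m = innovation_moments[OF \<pi>]
  define f where "f t w = r t / (1 - (r t)\<^sup>2) * (\<xi> w t * \<eta> w t) - (r t)\<^sup>2 / (2 * (1 - (r t)\<^sup>2)) * (\<xi> w t)\<^sup>2
      - (r t)\<^sup>2 / (2 * (1 - (r t)\<^sup>2)) * (\<eta> w t)\<^sup>2 - ln (sqrt (1 - (r t)\<^sup>2))" for t w
  have f: "ln (mehler (r t) (\<xi> w t, \<eta> w t)) = f t w" for t w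
  proof -
    define D where "D = 1 - (r t)\<^sup>2"
    have "D \<noteq> 0" using r[of t] by (auto simp: abs_square_eq_1 D_def)
    then show ?thesis unfolding ln_mehler[OF r] f_def D_def[symmetric] by (simp add: field_simps)
  qed
  have ln: "ln (coupling_density r w) = (\<Sum>t\<in>UNIV. f t w)" for w
    unfolding coupling_density_def f[symmetric] by (rule ln_prod) (simp_all add: less_imp_neq[OF mehler_pos[OF r], symmetric])
  have fi: "integrable \<pi> (f t)" for t
    unfolding f_def by (intro Bochner_Integration.integrable_diff integrable_mult_right m) auto
  have fv: "(\<integral>w. f t w \<partial>\<pi>) = r t / (1 - (r t)\<^sup>2) * corr \<pi> t - ((r t)\<^sup>2 / (1 - (r t)\<^sup>2) + ln (sqrt (1 - (r t)\<^sup>2)))" for t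
  proof -
    have "(\<integral>w. f t w \<partial>\<pi>) = r t / (1 - (r t)\<^sup>2) * corr \<pi> t - (r t)\<^sup>2 / (2 * (1 - (r t)\<^sup>2)) * 1
      - (r t)\<^sup>2 / (2 * (1 - (r t)\<^sup>2)) * 1 - ln (sqrt (1 - (r t)\<^sup>2))"
      unfolding f_def corr_def using m
      by (subst Bochner_Integration.integral_diff, simp, simp, subst Bochner_Integration.integral_diff, simp, simp, subst Bochner_Integration.integral_diff, simp, simp)
        (simp add: prob_space)
    moreover have "(r t)\<^sup>2 / (2 * (1 - (r t)\<^sup>2)) = ((r t)\<^sup>2 / (1 - (r t)\<^sup>2)) / 2"
      by (simp only: divide_divide_eq_left mult.commute)
    moreover have "E = A - X / 2 * 1 - X / 2 * 1 - C \<Longrightarrow> E = A - (X + C)" for E A X C :: real by simp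
    ultimately show ?thesis by (simp only:)
  qed
  show "integrable \<pi> (\<lambda>w. ln (coupling_density r w))"
    unfolding ln by (intro Bochner_Integration.integrable_sum fi)
  show "(\<integral>w. ln (coupling_density r w) \<partial>\<pi>) =
      (\<Sum>t\<in>UNIV. r t / (1 - (r t)\<^sup>2) * corr \<pi> t) - (\<Sum>t\<in>UNIV. (r t)\<^sup>2 / (1 - (r t)\<^sup>2) + ln (sqrt (1 - (r t)\<^sup>2)))"
    unfolding ln by (subst Bochner_Integration.integral_sum[OF fi]) (simp add: fv sum_subtractf)
qed

end

section \<open>The optimizers\<close>

lemma AW2_sq_eq_if_minimal:
  assumes "\<pi> \<in> Cpl_bc \<mu> \<nu>" "\<And>\<pi>'. \<pi>' \<in> Cpl_bc \<mu> \<nu> \<Longrightarrow> objective l \<mu> \<nu> \<pi> \<le> objective l \<mu> \<nu> \<pi>'"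
  shows "AW2_sq l \<mu> \<nu> = objective l \<mu> \<nu> \<pi>"
  unfolding AW2_sq_def using assms by (intro antisym INF_lower INF_greatest)

context gaussian_pair begin

abbreviation "N t \<equiv> N_mat L M $ t $ t"

lemma P_mat_diag: "P_mat l L M $ t $ t = f_ent l (N t)"
  by (simp add: P_mat_def map_matrix_def)

text \<open>
  The objective is a constant minus \<open>2 (\<Sum>t. N t * corr \<pi> t)\<close>, with all correlations in \<open>[-1, 1]\<close>. The
  sum is at most \<open>\<Sum>t. \<bar>N t\<bar>\<close>, and this value is attained by a Gaussian coupling; equality
  holds exactly if every single term is maximal.
\<close>

lemma transport_optimizer_iff:
  "optimizer 0 \<mu> \<nu> \<pi> \<longleftrightarrow> \<pi> \<in> Cpl_bc \<mu> \<nu> \<and> (\<forall>t. N t \<noteq> 0 \<longrightarrow> corr \<pi> t = sgn (N t))"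
proof -
  define \<pi>0 where "\<pi>0 = pi_P a b L M (P_mat 0 L M)"
  have diag: "diag_contraction (P_mat 0 L M)" by (rule diag_contraction_P_mat) simp
  have \<pi>0: "\<pi>0 \<in> Cpl_bc \<mu> \<nu>" unfolding \<pi>0_def by (rule pi_P_bicausal[OF diag])
  have obj: "objective 0 \<mu> \<nu> \<pi>' = ereal (base_cost - 2 * (\<Sum>t\<in>UNIV. N t * corr \<pi>' t))" if "\<pi>' \<in> Cpl_bc \<mu> \<nu>" for \<pi>'
    using objective_eq[OF that, of 0] by (simp flip: zero_ereal_def)
  have obj0: "objective 0 \<mu> \<nu> \<pi>0 = ereal (base_cost - 2 * (\<Sum>t\<in>UNIV. \<bar>N t\<bar>))"
    unfolding obj[OF \<pi>0] unfolding \<pi>0_def corr_pi_P[OF diag] P_mat_diag by (simp add: f_ent_0 abs_sgn)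
  have le: "N t * corr \<pi>' t \<le> \<bar>N t\<bar>" if "\<pi>' \<in> Cpl_bc \<mu> \<nu>" for \<pi>' t
  proof -
    have "\<bar>corr \<pi>' t\<bar> \<le> 1" using that by (intro abs_corr_le_1) (simp add: Cpl_bc_def)
    then have "\<bar>N t\<bar> * \<bar>corr \<pi>' t\<bar> \<le> \<bar>N t\<bar> * 1" by (intro mult_left_mono) auto
    then show ?thesis using abs_ge_self[of "N t * corr \<pi>' t"] by (simp add: abs_mult)
  qed
  have AW: "AW2_sq 0 \<mu> \<nu> = objective 0 \<mu> \<nu> \<pi>0"
  proof (rule AW2_sq_eq_if_minimal[OF \<pi>0])
    fix \<pi>' assume "\<pi>' \<in> Cpl_bc \<mu> \<nu>"
    then show "objective 0 \<mu> \<nu> \<pi>0 \<le> objective 0 \<mu> \<nu> \<pi>'"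
      unfolding obj0 using sum_mono[of UNIV "\<lambda>t. N t * corr \<pi>' t" "\<lambda>t. \<bar>N t\<bar>"] le by (simp add: obj)
  qed
  have "objective 0 \<mu> \<nu> \<pi> = AW2_sq 0 \<mu> \<nu> \<longleftrightarrow> (\<forall>t. N t \<noteq> 0 \<longrightarrow> corr \<pi> t = sgn (N t))" if \<pi>: "\<pi> \<in> Cpl_bc \<mu> \<nu>"
  proof -
    have "objective 0 \<mu> \<nu> \<pi> = AW2_sq 0 \<mu> \<nu> \<longleftrightarrow> (\<Sum>t\<in>UNIV. \<bar>N t\<bar> - N t * corr \<pi> t) = 0"
      unfolding AW obj0 obj[OF \<pi>] by (auto simp: sum_subtractf)
    also have "\<dots> \<longleftrightarrow> (\<forall>t. \<bar>N t\<bar> - N t * corr \<pi> t = 0)"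
      using le[OF \<pi>] by (subst sum_nonneg_eq_0_iff) auto
    also have "\<dots> \<longleftrightarrow> (\<forall>t. N t \<noteq> 0 \<longrightarrow> corr \<pi> t = sgn (N t))"
    proof (intro all_cong1)
      fix t
      have "\<bar>N t\<bar> - N t * corr \<pi> t = N t * (sgn (N t) - corr \<pi> t)" by (simp add: right_diff_distrib abs_sgn)
      then show "(\<bar>N t\<bar> - N t * corr \<pi> t = 0) = (N t \<noteq> 0 \<longrightarrow> corr \<pi> t = sgn (N t))" by auto
    qed
    finally show ?thesis .
  qed
  then show ?thesis unfolding optimizer_def by blast
qed

text \<open>
  Correlation \<open>1\<close> or \<open>-1\<close> between standardised variables makes one a multiple of the other almost
  surely, so the second path is a function of the first one.
\<close>

lemma perfectly_correlated_coupling: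
  assumes \<pi>: "\<pi> \<in> Cpl \<mu> \<nu>" and \<sigma>: "\<And>t. corr \<pi> t = \<sigma> t" "\<And>t. (\<sigma> t)\<^sup>2 = 1"
  shows "\<pi> = distr \<mu> (borel \<Otimes>\<^sub>M borel) (\<lambda>x. (x, b + M *v (\<chi> t. \<sigma> t * whiten a L x $ t)))"
proof -
  note c = cpl_facts[OF \<pi>]
  note [measurable_cong] = c(2)
  interpret prob_space \<pi> by fact
  define F where "F x = b + M *v (\<chi> t. \<sigma> t * whiten a L x $ t)" for x
  have [measurable]: "F \<in> borel_measurable borel"
  proof -
    have [measurable]: "(\<lambda>x. \<chi> t. \<sigma> t * whiten a L x $ t) \<in> borel_measurable borel"
      by (rule borel_measurable_vec_lambda) measurable
    show ?thesis unfolding F_def[abs_def] by measurable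
  qed
  have "AE w in \<pi>. \<eta> w t = \<sigma> t * \<xi> w t" for t
  proof -
    have "(\<integral>w. (\<eta> w t - \<sigma> t * \<xi> w t)\<^sup>2 \<partial>\<pi>) = 0"
      using integral_innovation_square(2)[OF \<pi>, of t "\<sigma> t"] \<sigma>[of t] by (simp add: power2_eq_square)
    then have "AE w in \<pi>. (\<eta> w t - \<sigma> t * \<xi> w t)\<^sup>2 = 0"
      by (subst (asm) integral_nonneg_eq_0_iff_AE[OF integral_innovation_square(1)[OF \<pi>]]) auto
    then show ?thesis by eventually_elim simp
  qed
  then have "AE w in \<pi>. \<forall>t\<in>UNIV. \<eta> w t = \<sigma> t * \<xi> w t" by (intro AE_finite_allI) auto
  then have ae: "AE w in \<pi>. w = (fst w, F (fst w))"
  proof eventually_elim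
    case (elim w)
    then have "(\<chi> t. \<sigma> t * \<xi> w t) = whiten b M (snd w)" by (simp add: vec_eq_iff)
    then have "F (fst w) = snd w" unfolding F_def by (simp add: unwhiten M(2))
    then show ?case by simp
  qed
  have "\<pi> = distr \<pi> (borel \<Otimes>\<^sub>M borel) (\<lambda>w. w)"
    by (rule distr_id2[symmetric, OF c(2)[symmetric]])
  also have "\<dots> = distr \<pi> (borel \<Otimes>\<^sub>M borel) (\<lambda>w. (fst w, F (fst w)))"
    using ae by (intro distr_cong_AE) auto
  also have "\<dots> = distr (distr \<pi> borel fst) (borel \<Otimes>\<^sub>M borel) (\<lambda>x. (x, F x))"
    by (subst distr_distr) (auto simp: o_def)
  finally show ?thesis unfolding c(5) F_def .
qed

lemma invertible_N_iff: "invertible (N_mat L M) \<longleftrightarrow> (\<forall>t. N t \<noteq> 0)"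
proof -
  have "det (N_mat L M) = (\<Prod>t\<in>UNIV. N t)" by (rule det_diagonal) (simp add: N_mat_def)
  then show ?thesis by (simp add: invertible_det_nz)
qed

lemma transport_optimizer_pi_P:
  assumes P: "diag_contraction P" and N: "\<And>t. N t \<noteq> 0 \<Longrightarrow> P $ t $ t = P_mat 0 L M $ t $ t"
  shows "optimizer 0 \<mu> \<nu> (pi_P a b L M P)"
  unfolding transport_optimizer_iff
  using pi_P_bicausal[OF P] N by (auto simp: corr_pi_P[OF P] P_mat_diag f_ent_0)

text \<open>
  If \<open>N\<close> is invertible, all correlations of an optimizer are signs and the coupling is determined. If
  \<open>N t = 0\<close>, the correlation at \<open>t\<close> does not enter the cost, and changing it gives another optimizer.
\<close>

lemma transport_unique_optimizer_iff:
  assumes P: "diag_contraction P" and N: "\<And>t. N t \<noteq> 0 \<Longrightarrow> P $ t $ t = P_mat 0 L M $ t $ t"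
  shows "unique_optimizer 0 \<mu> \<nu> (pi_P a b L M P) \<longleftrightarrow> invertible (N_mat L M)"
proof
  assume inv: "invertible (N_mat L M)"
  then have nz: "N t \<noteq> 0" for t by (simp add: invertible_N_iff)
  have eq: "\<pi> = distr \<mu> (borel \<Otimes>\<^sub>M borel) (\<lambda>x. (x, b + M *v (\<chi> t. sgn (N t) * whiten a L x $ t)))" if "optimizer 0 \<mu> \<nu> \<pi>" for \<pi>
    using that nz unfolding transport_optimizer_iff
    by (intro perfectly_correlated_coupling) (auto simp: Cpl_bc_def sgn_if)
  show "unique_optimizer 0 \<mu> \<nu> (pi_P a b L M P)"
    unfolding unique_optimizer_def
  proof (intro conjI allI impI)
    show opt: "optimizer 0 \<mu> \<nu> (pi_P a b L M P)" by (rule transport_optimizer_pi_P[OF P N])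
    fix \<pi>' assume "optimizer 0 \<mu> \<nu> \<pi>'"
    from eq[OF this] eq[OF opt] show "\<pi>' = pi_P a b L M P" by (rule trans[OF _ sym])
  qed
next
  assume u: "unique_optimizer 0 \<mu> \<nu> (pi_P a b L M P)"
  show "invertible (N_mat L M)"
    unfolding invertible_N_iff
  proof (intro allI notI)
    fix t assume t: "N t = 0"
    define Q :: "'n mat" where "Q = (\<chi> i j. if i = t \<and> j = t then (if P $ t $ t = 1 then -1 else 1) else P $ i $ j)"
    have Q: "diag_contraction Q" using P by (auto simp: diag_contraction_def Q_def)
    have "optimizer 0 \<mu> \<nu> (pi_P a b L M Q)"
      using t N by (intro transport_optimizer_pi_P[OF Q]) (auto simp: Q_def)
    then have "pi_P a b L M Q = pi_P a b L M P" using u by (simp add: unique_optimizer_def)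
    then have "Q $ t $ t = P $ t $ t" using corr_pi_P[OF Q, of t] corr_pi_P[OF P, of t] by simp
    then show False by (simp add: Q_def split: if_splits)
  qed
qed

lemma transport_gaussian_optimizer:
  assumes opt: "optimizer 0 \<mu> \<nu> \<pi>" and g: "is_gaussian \<pi>"
  shows "\<exists>P. diag_contraction P \<and> (\<forall>t. N t \<noteq> 0 \<longrightarrow> P $ t $ t = P_mat 0 L M $ t $ t) \<and> \<pi> = pi_P a b L M P"
proof -
  from opt have \<pi>: "\<pi> \<in> Cpl_bc \<mu> \<nu>" and c: "N t \<noteq> 0 \<Longrightarrow> corr \<pi> t = sgn (N t)" for t
    by (auto simp: transport_optimizer_iff)
  show ?thesis
    using gaussian_bicausal_eq_pi_P[OF \<pi> g] c
    by (intro exI[of _ "\<chi> i j. if i = j then corr \<pi> i else 0"]) (auto simp: P_mat_diag f_ent_0)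
qed

text \<open>
  Up to the sign of \<open>x\<close>, the value \<open>f_ent l x\<close> is the positive root \<open>s\<close> of \<open>s\<^sup>2 + 2 c s - 1 = 0\<close> with
  \<open>c = l / (4 \<bar>x\<bar>)\<close>. The equation in the conclusion is the first order condition for the correlation that
  balances transport cost against entropy.
\<close>

lemma f_ent_bound_and_stationarity:
  assumes l: "l > 0"
  shows "\<bar>f_ent l x\<bar> < 1" "l * (f_ent l x / (1 - (f_ent l x)\<^sup>2)) = 2 * x"
proof -
  define c where "c = l / (4 * \<bar>x\<bar>)"
  define s where "s = sqrt (c\<^sup>2 + 1) - c"
  have "\<bar>f_ent l x\<bar> < 1 \<and> l * (f_ent l x / (1 - (f_ent l x)\<^sup>2)) = 2 * x"
  proof (cases "x = 0")
    case True
    then show ?thesis by (simp add: f_ent_def)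
  next
    case False
    have c: "c > 0" using l False by (simp add: c_def)
    have f: "f_ent l x = sgn x * s" using False by (simp add: f_ent_def s_def c_def)
    have "sqrt (c\<^sup>2 + 1) < c + 1" using c by (intro real_less_lsqrt) (auto simp: power2_eq_square algebra_simps)
    moreover have "c < sqrt (c\<^sup>2 + 1)" by (rule real_less_rsqrt) simp
    ultimately have s: "0 < s" "s < 1" by (auto simp: s_def)
    have "(s + c)\<^sup>2 = c\<^sup>2 + 1" by (simp add: s_def)
    then have s2: "1 - s\<^sup>2 = 2 * c * s" by (simp add: power2_eq_square algebra_simps)
    have f2: "(f_ent l x)\<^sup>2 = s\<^sup>2" using False by (simp add: f power_mult_distrib sgn_if)
    have "l * (f_ent l x / (1 - (f_ent l x)\<^sup>2)) = sgn x * (l / (2 * c))"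
      unfolding f2 s2 unfolding f using s c by (simp add: field_simps)
    also have "l / (2 * c) = 2 * \<bar>x\<bar>" using l False by (simp add: c_def field_simps)
    finally show ?thesis using s False by (simp add: f abs_mult abs_sgn_eq sgn_mult_abs)
  qed
  then show "\<bar>f_ent l x\<bar> < 1" "l * (f_ent l x / (1 - (f_ent l x)\<^sup>2)) = 2 * x" by auto
qed

text \<open>
  Let \<open>h\<close> be the density of the candidate. By the stationarity equation the part of
  \<open>l * (\<integral>w. ln (h w) \<partial>\<pi>)\<close> that is linear in the correlations cancels the one of the transport cost.
  Therefore the objective of any bi-causal \<open>\<pi>\<close> is a constant plus \<open>l\<close> times the excess of
  \<open>KL \<pi> (\<mu> \<Otimes>\<^sub>M \<nu>)\<close> over that integral, and the Gibbs variational principle applies.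
\<close>

lemma entropic_unique_optimizer:
  assumes l: "l > 0"
  shows "unique_optimizer l \<mu> \<nu> (pi_P a b L M (P_mat l L M))"
proof -
  define P where "P = P_mat l L M"
  define r where "r t = P $ t $ t" for t
  have P: "diag_contraction P" unfolding P_def using l by (intro diag_contraction_P_mat) simp
  have r: "\<bar>r t\<bar> < 1" "l * (r t / (1 - (r t)\<^sup>2)) = 2 * N t" for t
    unfolding r_def P_def P_mat_diag by (rule f_ent_bound_and_stationarity[OF l])+
  have dens: "pi_P a b L M P = density (\<mu> \<Otimes>\<^sub>M \<nu>) (\<lambda>w. ennreal (coupling_density r w))"
    unfolding r_def by (rule pi_P_density[OF P]) (use r in \<open>simp add: r_def\<close>)
  interpret m: prob_space \<mu> by (rule prob_space_path_law)
  interpret n: prob_space \<nu> by (rule prob_space_path_law)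
  interpret R: pair_prob_space \<mu> \<nu> ..
  have R: "prob_space (\<mu> \<Otimes>\<^sub>M \<nu>)" by (rule R.prob_space_axioms)
  have sR: "sets (\<mu> \<Otimes>\<^sub>M \<nu>) = sets (borel \<Otimes>\<^sub>M borel)" by (rule sets_pair_measure_cong) auto
  have hm: "coupling_density r \<in> borel_measurable (\<mu> \<Otimes>\<^sub>M \<nu>)"
    using measurable_coupling_density measurable_cong_sets[OF sR refl] by blast
  have hpos: "0 < coupling_density r w" for w
    unfolding coupling_density_def by (intro prod_pos) (simp add: mehler_pos r)
  have P_bc: "pi_P a b L M P \<in> Cpl_bc \<mu> \<nu>" by (rule pi_P_bicausal[OF P])
  have pP: "prob_space (density (\<mu> \<Otimes>\<^sub>M \<nu>) (\<lambda>w. ennreal (coupling_density r w)))"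
    using P_bc by (simp add: dens[symmetric] Cpl_bc_def Cpl_def)
  define c where "c = (\<Sum>t\<in>UNIV. (r t)\<^sup>2 / (1 - (r t)\<^sup>2) + ln (sqrt (1 - (r t)\<^sup>2)))"
  define e where "e \<pi> = (\<integral>w. ln (coupling_density r w) \<partial>\<pi>)" for \<pi>
  have cancel: "base_cost - 2 * (\<Sum>t\<in>UNIV. N t * corr \<pi> t) + l * e \<pi> = base_cost - l * c"
    and int: "integrable \<pi> (\<lambda>w. ln (coupling_density r w))" if "\<pi> \<in> Cpl_bc \<mu> \<nu>" for \<pi>
  proof -
    have \<pi>: "\<pi> \<in> Cpl \<mu> \<nu>" using that by (simp add: Cpl_bc_def)
    show "integrable \<pi> (\<lambda>w. ln (coupling_density r w))" by (rule expectation_log_density(1)[OF \<pi> r(1)])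
    have "l * e \<pi> = (\<Sum>t\<in>UNIV. l * (r t / (1 - (r t)\<^sup>2)) * corr \<pi> t) - l * c"
      unfolding e_def c_def expectation_log_density(2)[OF \<pi> r(1)] by (simp add: right_diff_distrib sum_distrib_left mult.assoc)
    also have "(\<Sum>t\<in>UNIV. l * (r t / (1 - (r t)\<^sup>2)) * corr \<pi> t) = 2 * (\<Sum>t\<in>UNIV. N t * corr \<pi> t)"
      unfolding r(2) by (simp add: sum_distrib_left mult.assoc)
    finally show "base_cost - 2 * (\<Sum>t\<in>UNIV. N t * corr \<pi> t) + l * e \<pi> = base_cost - l * c" by simp
  qed
  have KL_P: "KL (pi_P a b L M P) (\<mu> \<Otimes>\<^sub>M \<nu>) = ereal (e (pi_P a b L M P))"
    unfolding e_def by (rule KL_eq_integral_log_density(2)[OF R hm _ dens int[OF P_bc]]) (simp add: hpos less_imp_le)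
  have obj_P: "objective l \<mu> \<nu> (pi_P a b L M P) = ereal (base_cost - l * c)"
    unfolding objective_eq[OF P_bc] KL_P using cancel[OF P_bc] by simp
  have lower: "ereal (base_cost - l * c) \<le> objective l \<mu> \<nu> \<pi>"
    and eq: "objective l \<mu> \<nu> \<pi> = ereal (base_cost - l * c) \<Longrightarrow> \<pi> = pi_P a b L M P" if \<pi>: "\<pi> \<in> Cpl_bc \<mu> \<nu>" for \<pi>
  proof -
    have c: "\<pi> \<in> Cpl \<mu> \<nu>" using \<pi> by (simp add: Cpl_bc_def)
    have s: "sets \<pi> = sets (\<mu> \<Otimes>\<^sub>M \<nu>)" using cpl_facts(2)[OF c] sR by simp
    note gibbs = gibbs_variational_principle[OF R hm hpos pP cpl_facts(1)[OF c] s int[OF \<pi>], folded e_def dens]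
    note o = objective_eq[OF \<pi>, of l] and k = cancel[OF \<pi>]
    show "ereal (base_cost - l * c) \<le> objective l \<mu> \<nu> \<pi>"
    proof (cases "KL \<pi> (\<mu> \<Otimes>\<^sub>M \<nu>)")
      case (real x)
      then have "l * e \<pi> \<le> l * x" using gibbs(1) l by simp
      then show ?thesis unfolding o real using k by simp
    qed (use gibbs(1) l o in auto)
    assume "objective l \<mu> \<nu> \<pi> = ereal (base_cost - l * c)"
    then have "KL \<pi> (\<mu> \<Otimes>\<^sub>M \<nu>) = ereal (e \<pi>)"
    proof (cases "KL \<pi> (\<mu> \<Otimes>\<^sub>M \<nu>)")
      case (real x)
      assume "objective l \<mu> \<nu> \<pi> = ereal (base_cost - l * c)"
      then have "l * x = l * e \<pi>"
        using k unfolding o real times_ereal.simps plus_ereal.simps ereal.inject by linarith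
      then show ?thesis using l real by simp
    qed (use gibbs(1) l o in auto)
    then show "\<pi> = pi_P a b L M P" by (rule gibbs(2))
  qed
  have AW: "AW2_sq l \<mu> \<nu> = ereal (base_cost - l * c)"
    unfolding obj_P[symmetric] by (rule AW2_sq_eq_if_minimal[OF P_bc]) (simp add: obj_P lower)
  show ?thesis
    unfolding unique_optimizer_def optimizer_def P_def[symmetric] AW
    by (intro conjI P_bc obj_P allI impI eq; elim conjE)
qed

end

lemma cholesky_gaussian:
  assumes "invertible A" "cholesky A L"
  shows "lower_triangular L" "invertible L" "gaussian a ((*v) A) = path_law a L"
proof -
  have A: "A = L ** transpose L" using assms(2) by (simp add: cholesky_def)
  show "lower_triangular L" using assms(2) by (auto simp: cholesky_def lower_triangular_def less_imp_neq[symmetric])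
  show "invertible L" using assms(1) unfolding A invertible_det_nz by (simp add: det_mul)
  show "gaussian a ((*v) A) = path_law a L"
    unfolding A path_law_def by (intro gaussian_eqI gaussian_law_path) simp
qed

theorem theorem1p2:
  fixes l :: real
    and a b :: "'n::{finite,linorder} path"
    and A B L M :: "'n mat"
    and \<mu> \<nu> :: "'n path measure"
  assumes "l \<ge> 0"
    and "\<mu> = gaussian a ((*v) A)" and "invertible A" and "cholesky A L"
    and "\<nu> = gaussian b ((*v) B)" and "invertible B" and "cholesky B M"
  shows "(l > 0 \<longrightarrow> unique_optimizer l \<mu> \<nu> (pi_P a b L M (P_mat l L M))) \<and>
    (l = 0 \<longrightarrow>
      (\<forall>P. diag_contraction P \<and> (\<forall>t. N_mat L M $ t $ t \<noteq> 0 \<longrightarrow> P $ t $ t = P_mat l L M $ t $ t) \<longrightarrow>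
         optimizer l \<mu> \<nu> (pi_P a b L M P) \<and>
         (unique_optimizer l \<mu> \<nu> (pi_P a b L M P) \<longleftrightarrow> invertible (N_mat L M))) \<and>
      (\<forall>\<pi>. optimizer l \<mu> \<nu> \<pi> \<and> is_gaussian \<pi> \<longrightarrow>
         (\<exists>P. diag_contraction P \<and> (\<forall>t. N_mat L M $ t $ t \<noteq> 0 \<longrightarrow> P $ t $ t = P_mat l L M $ t $ t) \<and>
           \<pi> = pi_P a b L M P)))"
proof -
  have \<mu>: "\<mu> = path_law a L" and \<nu>: "\<nu> = path_law b M"
    using assms cholesky_gaussian(3) by auto
  interpret gaussian_pair a b L M
    using assms cholesky_gaussian(1,2) by unfold_locales auto
  show ?thesis
    unfolding \<mu> \<nu>
    apply (intro conjI impI allI; (elim conjE)?)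
       apply (rule entropic_unique_optimizer, assumption)
      apply (simp add: transport_optimizer_pi_P)
     apply (simp add: transport_unique_optimizer_iff)
    apply (simp add: transport_gaussian_optimizer)
    done
qed

end
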